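(* Let $\mathcal{F}$ be a saturated fusion system on a finite $p$-group $S$, and let $\mathcal{H}$ be a saturated fusion subsystem of $\mathcal{F}$ on $S$. The following are equivalent. (1) $E^p_{\mathcal{F}}(S)=E^p_{\mathcal{H}}(S)$. (2) $A^p_{\mathcal{F}}(S)=A^p_{\mathcal{H}}(S)$. (3) $O^p_{\mathcal{F}}(S)=O^p_{\mathcal{H}}(S)$.
   Context: $p$ is a prime. A fusion system $\mathcal{F}$ on a finite $p$-group $S$ is a category whose objects are the subgroups of $S$ and whose morphism sets consist of injective group homomorphisms, with $\mathrm{Hom}_S(P,Q)\subseteq \mathrm{Hom}_{\mathcal{F}}(P,Q)$ (where $\mathrm{Hom}_S(P,Q)$ is the set of maps induced by conjugation by elements of $S$), such that every morphism is the composite of an isomorphism in $\mathcal{F}$ and an inclusion. Saturation is in the sense of Broto–Levi–Oliver: call $P\le S$ fully normalized (resp. fully centralized) if $|N_S(P)|\ge|N_S(Q)|$ (resp. $|C_S(P)|\ge |C_S(Q)|$) for all $Q$ that are $\mathcal{F}$-isomorphic to $P$; then $\mathcal{F}$ is saturated if (I) every fully normalized $P$ is fully centralized and $\mathrm{Aut}_S(P)$ is a Sylow $p$-subgroup of $\mathrm{Aut}_{\mathcal{F}}(P)$, and (II) every $\varphi\in \mathrm{Hom}_{\mathcal{F}}(P,S)$ with $\varphi(P)$ fully centralized extends to a morphism in $\mathcal{F}$ on $N_\varphi=\{g\in N_S(P)\mid \varphi c_g\varphi^{-1}\in \mathrm{Aut}_S(\varphi(P))\}$. A fusion subsystem of $\mathcal{F}$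 on $T\le S$ is a subcategory of $\mathcal{F}$ that is a fusion system on $T$. For a finite group $G$, $O^p(G)$ is the smallest normal subgroup of $p$-power index. For a group $P$ and $B\le\mathrm{Aut}(P)$, $[P,B]=\langle u^{-1}\alpha(u)\mid u\in P,\alpha\in B\rangle$. For a saturated fusion system $\mathcal{F}$ on $S$: the hyperfocal subgroup is $O^p_{\mathcal{F}}(S)=\langle [P,O^p(\mathrm{Aut}_{\mathcal{F}}(P))]\mid P\le S\rangle$; the focal subgroup is $A^p_{\mathcal{F}}(S)=[S,\mathcal{F}]=\langle [P,\mathrm{Aut}_{\mathcal{F}}(P)]\mid P\le S\rangle$; the elementary focal subgroup is $E^p_{\mathcal{F}}(S)=\Phi(S)[S,\mathcal{F}]=\Phi(S)O^p_{\mathcal{F}}(S)$, where $\Phi(S)$ is the Frattini subgroup. *)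

theory Defs
  imports "HOL-Algebra.Algebra" "HOL-Computational_Algebra.Primes"
begin

section \<open>Finite groups\<close>

definition finite_p_group :: "nat \<Rightarrow> ('a, 'b) monoid_scheme \<Rightarrow> bool" where
  "finite_p_group p S \<longleftrightarrow> group S \<and> finite (carrier S) \<and> (\<exists>n. order S = p ^ n)"

definition sylow_subgroup :: "nat \<Rightarrow> 'a set \<Rightarrow> ('a, 'b) monoid_scheme \<Rightarrow> bool" where
  "sylow_subgroup p H G \<longleftrightarrow> subgroup H G \<and> card H = p ^ multiplicity p (order G)"

definition centralizer :: "('a, 'b) monoid_scheme \<Rightarrow> 'a set \<Rightarrow> 'a set" where
  "centralizer S P = {g \<in> carrier S. \<forall>x\<in>P. g \<otimes>\<^bsub>S\<^esub> x = x \<otimes>\<^bsub>S\<^esub> g}"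

definition maximal_subgroup :: "'a set \<Rightarrow> ('a, 'b) monoid_scheme \<Rightarrow> bool" where
  "maximal_subgroup M S \<longleftrightarrow> subgroup M S \<and> M \<noteq> carrier S \<and>
     (\<forall>K. subgroup K S \<and> M \<subseteq> K \<longrightarrow> K = M \<or> K = carrier S)"

definition frattini :: "('a, 'b) monoid_scheme \<Rightarrow> 'a set" where
  "frattini S = carrier S \<inter> \<Inter>{M. maximal_subgroup M S}"

definition normal_p_index :: "nat \<Rightarrow> ('a, 'b) monoid_scheme \<Rightarrow> 'a set \<Rightarrow> bool" where
  "normal_p_index p G N \<longleftrightarrow> N \<lhd> G \<and> (\<exists>k. card (rcosets\<^bsub>G\<^esub> N) = p ^ k)"

text \<open>\<open>O\<^sup>p(G)\<close>; the least element is taken with respect to inclusion.\<close>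

definition p_residual :: "nat \<Rightarrow> ('a, 'b) monoid_scheme \<Rightarrow> 'a set" where
  "p_residual p G = (LEAST N. normal_p_index p G N)"

lemma normal_p_index_Int:
  fixes G (structure)
  assumes "group G" "finite (carrier G)" "Factorial_Ring.prime p"
    and N: "normal_p_index p G N" and M: "normal_p_index p G M"
  shows "normal_p_index p G (N \<inter> M)"
proof -
  interpret group G by fact
  have nN: "N \<lhd> G" and nM: "M \<lhd> G" using N M by (auto simp: normal_p_index_def)
  have sN: "subgroup N G" and sM: "subgroup M G" using nN nM by (simp_all add: normal_imp_subgroup)
  interpret I: second_isomorphism_grp N G M
    using nN sM by (simp add: second_isomorphism_grp_def second_isomorphism_grp_axioms_def)
  have nI: "N \<inter> M \<lhd> G" using normal_subgroup_intersect[OF nN nM] by simp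
  have sNM: "subgroup (N <#> M) G" by (rule I.normal_set_mult_subgroup)
  have gM: "group (G\<lparr>carrier := M\<rparr>)" and gNM: "group (G\<lparr>carrier := N <#> M\<rparr>)"
    using sM sNM by (simp_all add: subgroup_imp_group)
  have sI: "subgroup (N \<inter> M) (G\<lparr>carrier := M\<rparr>)"
    using subgroup_incl[OF subgroups_Inter_pair[OF sN sM] sM] by simp
  have sN': "subgroup N (G\<lparr>carrier := N <#> M\<rparr>)"
    using subgroup_incl[OF sN sNM I.H_contained_in_set_mult] .
  have eq: "card (rcosets\<^bsub>G\<lparr>carrier := M\<rparr>\<^esub> (N \<inter> M)) = card (rcosets\<^bsub>G\<lparr>carrier := N <#> M\<rparr>\<^esub> N)"
    using I.normal_intersection_quotient_isom bij_betw_same_card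
    by (fastforce simp: iso_def FactGroup_def)
  have lM: "card (rcosets\<^bsub>G\<lparr>carrier := M\<rparr>\<^esub> (N \<inter> M)) * card (N \<inter> M) = card M"
    using group.lagrange[OF gM sI] by (simp add: order_def)
  have lNM: "card (rcosets\<^bsub>G\<lparr>carrier := N <#> M\<rparr>\<^esub> N) * card N = card (N <#> M)"
    using group.lagrange[OF gNM sN'] by (simp add: order_def)
  have lG: "card (rcosets L) * card L = order G" if "subgroup L G" for L
    using lagrange[OF that] .
  have pos: "card L > 0" if "subgroup L G" for L
    using subgroup.finite_imp_card_positive[OF that assms(2)] .
  have sI': "subgroup (N \<inter> M) G" using nI by (rule normal_imp_subgroup)
  have prod: "card (N <#> M) * card (N \<inter> M) = card N * card M"
    unfolding lM[symmetric] lNM[symmetric] eq by (simp add: mult_ac)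
  have "card (rcosets (N \<inter> M)) * card (rcosets (N <#> M)) * (card (N \<inter> M) * card (N <#> M))
      = (card (rcosets (N \<inter> M)) * card (N \<inter> M)) * (card (rcosets (N <#> M)) * card (N <#> M))"
    by (simp add: mult_ac)
  also have "\<dots> = (card (rcosets N) * card N) * (card (rcosets M) * card M)"
    by (simp only: lG[OF sI'] lG[OF sNM] lG[OF sN] lG[OF sM])
  also have "\<dots> = card (rcosets N) * card (rcosets M) * (card N * card M)"
    by (simp add: mult_ac)
  finally have "card (rcosets (N \<inter> M)) * card (rcosets (N <#> M)) * (card (N \<inter> M) * card (N <#> M))
      = card (rcosets N) * card (rcosets M) * (card N * card M)" .
  then have "card (rcosets (N \<inter> M)) * card (rcosets (N <#> M)) = card (rcosets N) * card (rcosets M)"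
    using prod pos[OF sN] pos[OF sM] by (simp add: mult.commute)
  then have "card (rcosets (N \<inter> M)) dvd card (rcosets N) * card (rcosets M)"
    by (metis dvd_triv_left)
  moreover obtain a b where "card (rcosets N) = p ^ a" "card (rcosets M) = p ^ b"
    using N M by (auto simp: normal_p_index_def)
  ultimately have "card (rcosets (N \<inter> M)) dvd p ^ (a + b)" by (simp add: power_add)
  then show ?thesis
    using nI divides_primepow_nat[OF assms(3)] by (auto simp: normal_p_index_def)
qed

lemma p_residual_least:
  fixes G (structure)
  assumes "group G" "finite (carrier G)" "Factorial_Ring.prime p"
  shows "normal_p_index p G (p_residual p G)"
    and "normal_p_index p G N \<Longrightarrow> p_residual p G \<subseteq> N"
proof -
  interpret group G by fact
  have "card (rcosets (carrier G)) * order G = order G"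
    using lagrange[OF subgroup_self] by (simp add: order_def)
  moreover have "order G > 0" using assms(2) by (simp add: order_gt_0_iff_finite)
  ultimately have "card (rcosets (carrier G)) = p ^ 0" by simp
  moreover have "carrier G \<lhd> G" by (simp add: normal_inv_iff subgroup_self)
  ultimately have "normal_p_index p G (carrier G)" unfolding normal_p_index_def by blast
  then obtain K where K: "normal_p_index p G K"
    and min: "\<And>N. normal_p_index p G N \<Longrightarrow> card K \<le> card N"
    using ex_has_least_nat[of "normal_p_index p G" "carrier G" card] by blast
  have fin: "finite K"
    using K assms(2) by (meson finite_subset normal_imp_subgroup normal_p_index_def subgroup.subset)
  have le: "K \<subseteq> N" if "normal_p_index p G N" for N
  proof -
    have "card K \<le> card (K \<inter> N)" using min normal_p_index_Int[OF assms K that] by blast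
    then show ?thesis using fin by (metis card_seteq inf_le1 inf_le2)
  qed
  have eq: "p_residual p G = K"
    unfolding p_residual_def using K le by (intro Least_equality) auto
  show "normal_p_index p G (p_residual p G)" using K eq by simp
  show "normal_p_index p G N \<Longrightarrow> p_residual p G \<subseteq> N" using le eq by simp
qed

section \<open>Fusion systems\<close>

text \<open>
  A family of morphism sets on the subgroups of \<open>S\<close> is a function \<open>F\<close>, with \<open>F P Q\<close> the set
  of morphisms from \<open>P\<close> to \<open>Q\<close>. Maps are extensional on their source, so that equality of
  functions is equality of maps, and composition is \<^const>\<open>compose\<close>. The values of \<open>F\<close> on sets
  that are not subgroups of \<open>S\<close> are irrelevant.
\<close>

type_synonym 'a hom_family = "'a set \<Rightarrow> 'a set \<Rightarrow> ('a \<Rightarrow> 'a) set"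

definition conj_map :: "('a, 'b) monoid_scheme \<Rightarrow> 'a \<Rightarrow> 'a set \<Rightarrow> 'a \<Rightarrow> 'a" where
  "conj_map S g P = (\<lambda>x\<in>P. g \<otimes>\<^bsub>S\<^esub> x \<otimes>\<^bsub>S\<^esub> inv\<^bsub>S\<^esub> g)"

definition conj_hom :: "('a, 'b) monoid_scheme \<Rightarrow> 'a hom_family" where
  "conj_hom S P Q = {conj_map S g P | g. g \<in> carrier S \<and> conj_map S g P ` P \<subseteq> Q}"

definition inj_homs :: "('a, 'b) monoid_scheme \<Rightarrow> 'a hom_family" where
  "inj_homs S P Q = mon (S\<lparr>carrier := P\<rparr>) (S\<lparr>carrier := Q\<rparr>) \<inter> extensional P"

definition fus_iso :: "'a hom_family \<Rightarrow> 'a hom_family" where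
  "fus_iso F P Q = {\<phi> \<in> F P Q. \<exists>\<psi>\<in>F Q P.
     compose P \<psi> \<phi> = (\<lambda>x\<in>P. x) \<and> compose Q \<phi> \<psi> = (\<lambda>x\<in>Q. x)}"

text \<open>Identities and inclusions are conjugations by \<open>\<one>\<close>, so they are morphisms by the second
  condition below.\<close>

definition fusion_system :: "('a, 'b) monoid_scheme \<Rightarrow> 'a hom_family \<Rightarrow> bool" where
  "fusion_system S F \<longleftrightarrow>
     (\<forall>P Q. subgroup P S \<and> subgroup Q S \<longrightarrow> F P Q \<subseteq> inj_homs S P Q) \<and>
     (\<forall>P Q. subgroup P S \<and> subgroup Q S \<longrightarrow> conj_hom S P Q \<subseteq> F P Q) \<and>
     (\<forall>P Q R \<phi> \<psi>. subgroup P S \<and> subgroup Q S \<and> subgroup R S \<and> \<phi> \<in> F P Q \<and> \<psi> \<in> F Q R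
        \<longrightarrow> compose P \<psi> \<phi> \<in> F P R) \<and>
     (\<forall>P Q \<phi>. subgroup P S \<and> subgroup Q S \<and> \<phi> \<in> F P Q \<longrightarrow>
        (\<exists>R \<psi>. subgroup R S \<and> R \<subseteq> Q \<and> \<psi> \<in> fus_iso F P R \<and> \<phi> = compose P (\<lambda>x\<in>R. x) \<psi>))"

definition fus_conjugate :: "'a hom_family \<Rightarrow> 'a set \<Rightarrow> 'a set \<Rightarrow> bool" where
  "fus_conjugate F P Q \<longleftrightarrow> fus_iso F P Q \<noteq> {}"

definition aut_group :: "'a hom_family \<Rightarrow> 'a set \<Rightarrow> ('a \<Rightarrow> 'a) monoid" where
  "aut_group F P = (BijGroup P)\<lparr>carrier := F P P\<rparr>"

definition fully_normalized ::
    "('a, 'b) monoid_scheme \<Rightarrow> 'a hom_family \<Rightarrow> 'a set \<Rightarrow> bool" where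
  "fully_normalized S F P \<longleftrightarrow>
     (\<forall>Q. subgroup Q S \<and> fus_conjugate F P Q \<longrightarrow> card (normalizer S P) \<ge> card (normalizer S Q))"

definition fully_centralized ::
    "('a, 'b) monoid_scheme \<Rightarrow> 'a hom_family \<Rightarrow> 'a set \<Rightarrow> bool" where
  "fully_centralized S F P \<longleftrightarrow>
     (\<forall>Q. subgroup Q S \<and> fus_conjugate F P Q \<longrightarrow> card (centralizer S P) \<ge> card (centralizer S Q))"

text \<open>\<open>N\<^sub>\<phi>\<close>; the map \<open>\<phi> c\<^sub>g \<phi>\<^sup>-\<^sup>1\<close> is written as a function on \<open>\<phi> ` P\<close>.\<close>

definition extension_domain ::
    "('a, 'b) monoid_scheme \<Rightarrow> 'a set \<Rightarrow> ('a \<Rightarrow> 'a) \<Rightarrow> 'a set" where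
  "extension_domain S P \<phi> = {g \<in> normalizer S P.
     (\<lambda>y\<in>\<phi> ` P. \<phi> (conj_map S g P (inv_into P \<phi> y))) \<in> conj_hom S (\<phi> ` P) (\<phi> ` P)}"

definition saturated :: "nat \<Rightarrow> ('a, 'b) monoid_scheme \<Rightarrow> 'a hom_family \<Rightarrow> bool" where
  "saturated p S F \<longleftrightarrow>
     (\<forall>P. subgroup P S \<and> fully_normalized S F P \<longrightarrow>
        fully_centralized S F P \<and> sylow_subgroup p (conj_hom S P P) (aut_group F P)) \<and>
     (\<forall>P \<phi>. subgroup P S \<and> \<phi> \<in> F P (carrier S) \<and> fully_centralized S F (\<phi> ` P) \<longrightarrow>
        (\<exists>\<psi>\<in>F (extension_domain S P \<phi>) (carrier S). restrict \<psi> P = \<phi>))"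

definition fusion_subsystem ::
    "('a, 'b) monoid_scheme \<Rightarrow> 'a hom_family \<Rightarrow> 'a set \<Rightarrow> 'a hom_family \<Rightarrow> bool" where
  "fusion_subsystem S F T H \<longleftrightarrow>
     subgroup T S \<and> fusion_system (S\<lparr>carrier := T\<rparr>) H \<and>
     (\<forall>P Q. subgroup P (S\<lparr>carrier := T\<rparr>) \<and> subgroup Q (S\<lparr>carrier := T\<rparr>) \<longrightarrow> H P Q \<subseteq> F P Q)"

section \<open>Hyperfocal, focal and elementary focal subgroups\<close>

definition aut_commutator ::
    "('a, 'b) monoid_scheme \<Rightarrow> 'a set \<Rightarrow> ('a \<Rightarrow> 'a) set \<Rightarrow> 'a set" where
  "aut_commutator S P B = generate S {inv\<^bsub>S\<^esub> u \<otimes>\<^bsub>S\<^esub> \<alpha> u | u \<alpha>. u \<in> P \<and> \<alpha> \<in> B}"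

definition hyperfocal :: "nat \<Rightarrow> ('a, 'b) monoid_scheme \<Rightarrow> 'a hom_family \<Rightarrow> 'a set" where
  "hyperfocal p S F =
     generate S (\<Union>P\<in>{P. subgroup P S}. aut_commutator S P (p_residual p (aut_group F P)))"

definition focal :: "('a, 'b) monoid_scheme \<Rightarrow> 'a hom_family \<Rightarrow> 'a set" where
  "focal S F = generate S (\<Union>P\<in>{P. subgroup P S}. aut_commutator S P (F P P))"

definition elementary_focal :: "('a, 'b) monoid_scheme \<Rightarrow> 'a hom_family \<Rightarrow> 'a set" where
  "elementary_focal S F = frattini S <#>\<^bsub>S\<^esub> focal S F"

end

theory Submission
  imports Defs "HOL-Number_Theory.Cong"
begin

text \<open>
  Write \<open>T\<close> for the hyperfocal subgroup. Every morphism of a saturated fusion system is, modulo \<open>T\<close>,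
  conjugation by an element of \<open>S\<close>, so the focal subgroup is \<open>[S, S] T\<close> and (3) implies (2), which
  trivially implies (1).

  For (1) implies (3), suppose that the hyperfocal subgroup \<open>T'\<close> of \<open>H\<close> is properly contained in that
  of \<open>F\<close>, and choose \<open>N\<close> maximal among the normal subgroups of \<open>S\<close> with \<open>T' \<le> N < T\<close>. Then \<open>T/N\<close>
  is central of order \<open>p\<close> in \<open>S/N\<close>, which gives an \<open>S\<close>-invariant character \<open>\<lambda>\<close> of \<open>T\<close> with values in
  the integers modulo \<open>p\<close>. For \<open>\<phi> : P \<rightarrow> S\<close> in \<open>F\<close> the map \<open>\<lambda> \<circ> \<phi> - \<lambda>\<close> on \<open>P \<inter> T\<close> extends to a character of
  \<open>P\<close>. Transferring these characters to \<open>S\<close> and summing over the orbits \<open>(P, \<phi>)\<close> of a virtual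
  \<open>(S, S)\<close>-biset whose fixed point numbers are \<open>F\<close>-stable and whose degree \<open>n\<close> is prime to \<open>p\<close>
  (constructed as by Broto, Levi and Oliver) yields a character \<open>\<chi>\<close> of \<open>S\<close> such that
  \<open>\<chi> + n \<lambda>\<close> is \<open>F\<close>-invariant on \<open>T\<close>. An \<open>F\<close>-invariant character vanishes on \<open>u = x\<^sup>-\<^sup>1 \<alpha>(x)\<close> for every
  automorphism \<open>\<alpha>\<close> of order \<open>m\<close> prime to \<open>p\<close>, because the product of the \<open>\<alpha>\<^sup>i(u)\<close>, \<open>i < m\<close>, is trivial;
  hence \<open>\<chi> = - n \<lambda>\<close> on \<open>T\<close>. So \<open>\<chi>\<close> is nontrivial on \<open>T\<close>, but it vanishes on \<open>T'\<close>, on commutators and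
  on the Frattini subgroup, that is, on the elementary focal subgroup of \<open>H\<close>.
\<close>

section \<open>Group actions and finite p-groups\<close>

text \<open>Averaging cannot produce an invariant character, since group orders may not be divided
  by modulo \<open>p\<close>. Two devices replace it. Characters are integer functions whose
  additivity holds only modulo \<open>p\<close>, so that sums over S \<times> S and the cancellation
  of |S|^2 take place exactly, in the integers. And the biset enters only through its orbit
  multiplicities: they may be negative, but they must be integers, because they multiply characters
  modulo \<open>p\<close>.

  At t in \<open>T\<close> the transfer of \<lambda> \<circ> \<phi> - \<lambda> splits into a part
  built from values of \<lambda> \<circ> \<phi> and the part - [S:P] \<lambda>(t). The second parts
  add up to - n \<lambda>(t). The first parts, added over the biset, depend on t only through the
  fixed point numbers of the cyclic groups generated by the pairs (y, t^k), so their stability makes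
  the total F-invariant.

  The degree n is prime to \<open>p\<close> because modulo \<open>p\<close> only twisted diagonals
  of order |S| contribute, and their multiplicities add up to |Aut_F(S) : Inn(S)|.\<close>

lemma prime_dvd_card_imp_other:
  assumes "Factorial_Ring.prime p" "int p dvd int (card F)" "finite F" "x \<in> F"
  obtains y where "y \<in> F" "y \<noteq> x"
proof (rule ccontr)
  assume "\<not> thesis"
  then have "F = {x}" using that assms(4) by blast
  then show False using assms by simp
qed

locale finite_action = group G for G (structure) +
  fixes Y :: "'x set" and act :: "'a \<Rightarrow> 'x \<Rightarrow> 'x"
  assumes fin_G: "finite (carrier G)" and fin_Y: "finite Y"
    and act_closed: "\<lbrakk>g \<in> carrier G; x \<in> Y\<rbrakk> \<Longrightarrow> act g x \<in> Y"
    and act_one: "x \<in> Y \<Longrightarrow> act \<one> x = x"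
    and act_mult: "\<lbrakk>g \<in> carrier G; h \<in> carrier G; x \<in> Y\<rbrakk> \<Longrightarrow> act (g \<otimes> h) x = act g (act h x)"
begin

definition orb :: "'x \<Rightarrow> 'x set" where "orb x = (\<lambda>g. act g x) ` carrier G"
definition stab :: "'x \<Rightarrow> 'a set" where "stab x = {g \<in> carrier G. act g x = x}"

lemma orb_subset: "x \<in> Y \<Longrightarrow> orb x \<subseteq> Y"
  by (auto simp: orb_def act_closed)

lemma orb_refl: "x \<in> Y \<Longrightarrow> x \<in> orb x"
  unfolding orb_def using act_one[of x] by (metis imageI one_closed)

lemma orb_eq:
  assumes "x \<in> Y" "y \<in> orb x" shows "orb y = orb x"
proof -
  obtain g where g: "g \<in> carrier G" "y = act g x" using assms(2) by (auto simp: orb_def)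
  have "orb y \<subseteq> orb x"
    unfolding orb_def using g assms(1) by (auto simp: act_mult[symmetric])
  moreover have "orb x \<subseteq> orb y"
  proof
    fix z assume "z \<in> orb x"
    then obtain h where h: "h \<in> carrier G" "z = act h x" by (auto simp: orb_def)
    have "z = act (h \<otimes> inv g) y"
      using g h assms(1) by (simp add: act_mult[symmetric] m_assoc)
    then show "z \<in> orb y" using g h by (auto simp: orb_def)
  qed
  ultimately show ?thesis by blast
qed

lemma fibre_orb: "R \<in> orb ` Y \<Longrightarrow> {x \<in> Y. orb x = R} = R"
  by (auto dest: orb_eq intro: orb_refl subsetD[OF orb_subset])

lemma sum_orbits:
  fixes f :: "'x \<Rightarrow> 'c::comm_monoid_add"
  shows "sum f Y = (\<Sum>R\<in>orb ` Y. sum f R)"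
  using sum.image_gen[OF fin_Y, of f orb] by (simp add: fibre_orb)

text \<open>The elements carrying \<open>x\<close> to a given point of its orbit form a coset of the
  stabilizer, so every term of the orbit sum occurs equally often. This trades orbit sums for sums
  over the group; f = 1 is the orbit-stabilizer theorem.\<close>

lemma sum_act:
  fixes f :: "'x \<Rightarrow> int"
  assumes x: "x \<in> Y"
  shows "(\<Sum>g\<in>carrier G. f (act g x)) = int (card (stab x)) * sum f (orb x)"
proof -
  have "(\<Sum>g\<in>carrier G. f (act g x)) =
      (\<Sum>y\<in>orb x. \<Sum>g | g \<in> carrier G \<and> act g x = y. f (act g x))"
    unfolding orb_def by (rule sum.image_gen[OF fin_G])
  also have "\<dots> = (\<Sum>y\<in>orb x. int (card (stab x)) * f y)"
  proof (rule sum.cong[OF refl])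
    fix y assume "y \<in> orb x"
    then obtain h where h: "h \<in> carrier G" "y = act h x" by (auto simp: orb_def)
    have "{g \<in> carrier G. act g x = y} = (\<lambda>g. h \<otimes> g) ` stab x"
    proof safe
      fix g assume g: "g \<in> carrier G" "y = act g x"
      have "act (inv h \<otimes> g) x = act (inv h) (act h x)" using g h x by (simp add: act_mult)
      also have "\<dots> = x" using h x by (simp add: act_mult[symmetric] act_one)
      finally have "inv h \<otimes> g \<in> stab x" using g h by (simp add: stab_def)
      moreover have "g = h \<otimes> (inv h \<otimes> g)" using g h by (simp add: m_assoc[symmetric])
      ultimately show "g \<in> (\<lambda>g. h \<otimes> g) ` stab x" by blast
    qed (use h x in \<open>auto simp: stab_def act_mult\<close>)
    moreover have "inj_on (\<lambda>g. h \<otimes> g) (stab x)"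
      using h by (auto simp: inj_on_def stab_def)
    ultimately have "card {g \<in> carrier G. act g x = y} = card (stab x)" by (simp add: card_image)
    then show "(\<Sum>g | g \<in> carrier G \<and> act g x = y. f (act g x)) = int (card (stab x)) * f y"
      by simp
  qed
  finally show ?thesis by (simp add: sum_distrib_left)
qed

lemma card_orb_stab: "x \<in> Y \<Longrightarrow> card (orb x) * card (stab x) = order G"
  using sum_act[of x "\<lambda>_. 1"] by (simp add: order_def mult.commute flip: of_nat_mult)

text \<open>The sum over an orbit is its length times a value of \<open>f\<close>, so divisibility
  may be checked one orbit at a time. In this form it serves both the fixed point congruence for
  p-groups and the integrality of the biset.\<close>

lemma dvd_sum_invariant:
  fixes f :: "'x \<Rightarrow> int"
  assumes inv: "\<And>g x. \<lbrakk>g \<in> carrier G; x \<in> Y\<rbrakk> \<Longrightarrow> f (act g x) = f x"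
    and dvd: "\<And>x. x \<in> Y \<Longrightarrow> k dvd int (card (orb x)) * f x"
  shows "k dvd sum f Y"
  unfolding sum_orbits
proof (rule dvd_sum)
  fix R assume "R \<in> orb ` Y"
  then obtain x where x: "x \<in> Y" "R = orb x" by blast
  have "sum f R = (\<Sum>y\<in>orb x. f x)"
    unfolding x using inv x by (intro sum.cong) (auto simp: orb_def)
  then show "k dvd sum f R" using dvd[OF x(1)] x by simp
qed

lemma p_group_fixed_points:
  assumes p: "Factorial_Ring.prime p" and "order G = p ^ n"
  shows "int p dvd int (card Y) - int (card {x \<in> Y. \<forall>g\<in>carrier G. act g x = x})"
proof -
  let ?F = "{x \<in> Y. \<forall>g\<in>carrier G. act g x = x}"
  \<comment> \<open>The indicator of the points that are not fixed: its sum is the difference in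
    question, and its value 0 at fixed points removes the orbits of length 1.\<close>
  define f where "f x = (if x \<in> ?F then 0 else 1 :: int)" for x
  have *: "x \<in> ?F \<longleftrightarrow> orb x = {x}" if "x \<in> Y" for x
    using that orb_refl[of x] by (auto simp: orb_def)
  have "int p dvd sum f Y"
  proof (rule dvd_sum_invariant)
    fix g x assume gx: "g \<in> carrier G" "x \<in> Y"
    then have "orb (act g x) = orb x" by (intro orb_eq) (auto simp: orb_def)
    moreover have "act g x \<in> Y" using gx act_closed by blast
    moreover have "x \<in> orb x" "act g x \<in> orb x" using gx orb_refl by (auto simp: orb_def)
    ultimately have "orb (act g x) = {act g x} \<longleftrightarrow> orb x = {x}" by auto
    then have "act g x \<in> ?F \<longleftrightarrow> x \<in> ?F" using *[OF gx(2)] *[OF act_closed[OF gx]] by simp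
    then show "f (act g x) = f x" by (simp only: f_def)
  next
    fix x assume x: "x \<in> Y"
    show "int p dvd int (card (orb x)) * f x"
    proof (cases "x \<in> ?F")
      case False
      have "card (orb x) dvd p ^ n" using card_orb_stab[OF x] assms(2) by (metis dvd_triv_left)
      then obtain i where i: "card (orb x) = p ^ i" using divides_primepow_nat[OF p] by blast
      have "i \<noteq> 0"
      proof
        assume "i = 0"
        then have "card (orb x) = 1" using i by simp
        then obtain y where "orb x = {y}" by (rule card_1_singletonE)
        then have "orb x = {x}" using orb_refl[OF x] by simp
        then show False using False *[OF x] by simp
      qed
      then show ?thesis using i by simp
    qed (simp add: f_def)
  qed
  moreover have "sum f Y = int (card Y) - int (card ?F)"
  proof -
    have "sum f Y = sum f (Y - ?F)" by (rule sum.mono_neutral_right) (auto simp: f_def fin_Y)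
    also have "\<dots> = (\<Sum>x\<in>Y - ?F. 1)" by (intro sum.cong) (auto simp: f_def)
    also have "\<dots> = int (card (Y - ?F))" by simp
    also have "\<dots> = int (card Y) - int (card ?F)"
      using fin_Y by (subst card_Diff_subset) (auto intro: card_mono of_nat_diff)
    finally show ?thesis .
  qed
  ultimately show ?thesis by simp
qed

end

section \<open>Normalizers, cosets and Sylow arguments in finite groups\<close>

lemma (in group) inv_mult_cancel [simp]:
  "\<lbrakk>x \<in> carrier G; y \<in> carrier G\<rbrakk> \<Longrightarrow> inv x \<otimes> (x \<otimes> y) = y"
  "\<lbrakk>x \<in> carrier G; y \<in> carrier G\<rbrakk> \<Longrightarrow> x \<otimes> (inv x \<otimes> y) = y"
  by (simp_all add: m_assoc[symmetric])

lemma (in group) card_subgroup_pos: "\<lbrakk>subgroup H G; finite (carrier G)\<rbrakk> \<Longrightarrow> card H > 0"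
  by (rule subgroup.finite_imp_card_positive)

lemma (in group) card_subgroup_dvd: "subgroup H G \<Longrightarrow> card H dvd order G"
  using lagrange by (metis dvd_triv_right)

lemma (in group) card_subgroup_dvd': "\<lbrakk>subgroup H G; subgroup K G; H \<subseteq> K\<rbrakk> \<Longrightarrow> card H dvd card K"
  using group.card_subgroup_dvd[OF subgroup_imp_group subgroup_incl, of K H]
  by (simp add: order_def)

lemma (in group) conj_eq_subgroup:
  assumes "subgroup P G" "finite P" "g \<in> carrier G" "\<And>x. x \<in> P \<Longrightarrow> g \<otimes> x \<otimes> inv g \<in> P"
  shows "(\<lambda>x. g \<otimes> x \<otimes> inv g) ` P = P"
proof (rule card_subset_eq[OF assms(2)])
  have "P \<subseteq> carrier G" using assms(1) by (rule subgroup.subset)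
  then have "inj_on (\<lambda>x. g \<otimes> x \<otimes> inv g) P" using assms(3)
    by (auto simp: inj_on_def subset_eq)
  then show "card ((\<lambda>x. g \<otimes> x \<otimes> inv g) ` P) = card P" by (rule card_image)
qed (use assms in auto)

lemma (in group) normalizer_iff:
  assumes "subgroup P G" "finite P"
  shows "g \<in> normalizer G P \<longleftrightarrow> g \<in> carrier G \<and> (\<forall>x\<in>P. g \<otimes> x \<otimes> inv g \<in> P)"
proof -
  have sub: "P \<subseteq> carrier G" using assms(1) by (rule subgroup.subset)
  have eq: "g <# P #> inv g = (\<lambda>x. g \<otimes> x \<otimes> inv g) ` P" for g
    by (auto simp: l_coset_def r_coset_def)
  have "g \<in> normalizer G P \<longleftrightarrow> g \<in> carrier G \<and> (\<lambda>x. g \<otimes> x \<otimes> inv g) ` P = P"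
    using sub by (simp add: normalizer_def stabilizer_def eq)
  also have "\<dots> \<longleftrightarrow> g \<in> carrier G \<and> (\<forall>x\<in>P. g \<otimes> x \<otimes> inv g \<in> P)"
    using conj_eq_subgroup[OF assms] by blast
  finally show ?thesis .
qed

lemma (in group) subgroup_normalizer: "subgroup P G \<Longrightarrow> subgroup (normalizer G P) G"
  by (simp add: normalizer_imp_subgroup subgroup.subset)

lemma (in group) subset_normalizer:
  assumes "subgroup P G" "finite P" shows "P \<subseteq> normalizer G P"
  using assms by (auto simp: normalizer_iff subgroup.mem_carrier subgroup.m_closed subgroup.m_inv_closed)

lemma (in group) rcos_eq_iff:
  assumes "subgroup H G" "x \<in> carrier G" "y \<in> carrier G"
  shows "H #> x = H #> y \<longleftrightarrow> x \<otimes> inv y \<in> H"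
proof
  assume "H #> x = H #> y"
  then have "x \<in> H #> y" using rcos_self[OF assms(2) assms(1)] by simp
  then obtain h where "h \<in> H" "x = h \<otimes> y" by (auto simp: r_coset_def)
  then show "x \<otimes> inv y \<in> H" using assms by (simp add: m_assoc subgroup.mem_carrier)
next
  assume h: "x \<otimes> inv y \<in> H"
  have "x = x \<otimes> inv y \<otimes> y" using assms by (simp add: m_assoc)
  then have "x \<in> H #> y" using h by (auto simp: r_coset_def)
  then show "H #> x = H #> y" using repr_independence assms by metis
qed

text \<open>The inverse turns right multiplication into a left action. Acting through a homomorphism
  \<open>h\<close> rather than through a subgroup covers the case of N_S(P) acting on cosets in an
  automorphism group.\<close>

lemma (in group) rcoset_action:
  assumes Q: "group Q" "finite (carrier Q)" and h: "h \<in> hom Q G"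
    and H: "subgroup H G" and fin: "finite (carrier G)"
  shows "finite_action Q (rcosets H) (\<lambda>q C. C #> inv (h q))"
proof -
  interpret Q: group Q by fact
  interpret h: group_hom Q G h using h by (simp add: group_hom_def group_hom_axioms_def Q is_group)
  have sub: "C \<subseteq> carrier G" if "C \<in> rcosets H" for C
    using that H by (auto simp: RCOSETS_def r_coset_def subgroup.mem_carrier)
  show ?thesis
  proof (unfold_locales)
    show "finite (rcosets H)" using fin H by (auto simp: RCOSETS_def)
    fix g C assume *: "g \<in> carrier Q" "C \<in> rcosets H"
    then obtain x where x: "x \<in> carrier G" "C = H #> x" by (auto simp: RCOSETS_def)
    have "C #> inv h g = H #> (x \<otimes> inv h g)"
      using x * subgroup.subset[OF H] by (simp add: coset_mult_assoc)
    then show "C #> inv h g \<in> rcosets H" using x * by (auto simp: RCOSETS_def)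
  next
    fix C assume "C \<in> rcosets H" then show "C #> inv h \<one>\<^bsub>Q\<^esub> = C" using sub by simp
  next
    fix g k C assume "g \<in> carrier Q" "k \<in> carrier Q" "C \<in> rcosets H"
    then show "C #> inv h (g \<otimes>\<^bsub>Q\<^esub> k) = C #> inv h k #> inv h g"
      using sub by (simp add: coset_mult_assoc inv_mult_group)
  qed (use Q in auto)
qed

lemma (in group) fixed_rcoset_iff:
  assumes "subgroup H G" "x \<in> carrier G" "y \<in> carrier G"
  shows "H #> x #> inv y = H #> x \<longleftrightarrow> x \<otimes> y \<otimes> inv x \<in> H"
proof -
  have "H #> x #> inv y = H #> x \<longleftrightarrow> H #> x = H #> (x \<otimes> inv y)"
    using assms subgroup.subset[OF assms(1)] by (auto simp: coset_mult_assoc)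
  also have "\<dots> \<longleftrightarrow> x \<otimes> inv (x \<otimes> inv y) \<in> H" using assms by (intro rcos_eq_iff) auto
  also have "x \<otimes> inv (x \<otimes> inv y) = x \<otimes> y \<otimes> inv x" using assms by (simp add: inv_mult_group m_assoc)
  finally show ?thesis .
qed

lemma not_Suc_multiplicity_dvd:
  fixes n q :: nat
  assumes "Factorial_Ring.prime q" "n > 0"
  shows "\<not> q ^ Suc (multiplicity q n) dvd n"
proof -
  have "n \<noteq> 0" "\<not> is_unit q" using assms not_prime_unit by auto
  then show ?thesis by (simp add: power_dvd_iff_le_multiplicity del: power_Suc)
qed

text \<open>The p-group \<open>Q\<close> acts through \<open>h\<close> on the cosets of
  \<open>H\<close>, whose number is prime to \<open>p\<close>. It therefore fixes a coset
  \<open>H #> a\<close>, and this says that a h(Q) a^-1 lies in \<open>H\<close>.\<close>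

lemma (in group) sylow_absorbs_p_image:
  assumes p: "Factorial_Ring.prime p" and fin: "finite (carrier G)"
    and Q: "group Q" "order Q = p ^ n" and h: "h \<in> hom Q G" and syl: "sylow_subgroup p H G"
  obtains a where "a \<in> carrier G" "\<And>q. q \<in> carrier Q \<Longrightarrow> a \<otimes> h q \<otimes> inv a \<in> H"
proof -
  have H: "subgroup H G" and cH: "card H = p ^ multiplicity p (order G)"
    using syl by (auto simp: sylow_subgroup_def)
  have "p > 0" using p by (simp add: prime_gt_0_nat)
  then have finQ: "finite (carrier Q)" using Q by (metis order_def card_gt_0_iff zero_less_power)
  interpret A: finite_action Q "rcosets H" "\<lambda>q C. C #> inv (h q)"
    by (rule rcoset_action) (use Q finQ h H fin in auto)
  have pos: "order G > 0" using fin by (simp add: order_gt_0_iff_finite)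
  have "\<not> p dvd card (rcosets H)"
  proof
    assume "p dvd card (rcosets H)"
    then have "p * p ^ multiplicity p (order G) dvd order G"
      using lagrange[OF H] cH by (metis dvd_refl mult_dvd_mono)
    then have "p ^ Suc (multiplicity p (order G)) dvd order G" by simp
    then show False using not_Suc_multiplicity_dvd[OF p pos] by blast
  qed
  moreover have "int p dvd int (card (rcosets H)) -
      int (card {C \<in> rcosets H. \<forall>q\<in>carrier Q. C #> inv (h q) = C})"
    by (rule A.p_group_fixed_points[OF p Q(2)])
  ultimately have "{C \<in> rcosets H. \<forall>q\<in>carrier Q. C #> inv (h q) = C} \<noteq> {}" by force
  then obtain C where C: "C \<in> rcosets H" "\<And>q. q \<in> carrier Q \<Longrightarrow> C #> inv (h q) = C" by blast
  then obtain a where a: "a \<in> carrier G" "C = H #> a" by (auto simp: RCOSETS_def)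
  show thesis
  proof (rule that[OF a(1)])
    fix q assume q: "q \<in> carrier Q"
    then have "h q \<in> carrier G" using h by (auto simp: hom_def)
    then show "a \<otimes> h q \<otimes> inv a \<in> H" using fixed_rcoset_iff[OF H a(1)] C(2)[OF q] a(2) by simp
  qed
qed

lemma (in group) p_group_subgroup_card:
  assumes "Factorial_Ring.prime p" "order G = p ^ n" "subgroup H G"
  obtains k where "card H = p ^ k"
  using card_subgroup_dvd[OF assms(3)] assms(2) divides_primepow_nat[OF assms(1)] by auto

text \<open>\<open>P\<close> acts on its own cosets by right multiplication. The number of fixed
  cosets is divisible by \<open>p\<close> and \<open>P\<close> is one of them; a representative of
  any other one normalizes \<open>P\<close> without lying in it.\<close>

lemma (in group) normalizer_grows:
  assumes p: "Factorial_Ring.prime p" and fin: "finite (carrier G)" and ord: "order G = p ^ n"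
    and P: "subgroup P G" "P \<noteq> carrier G"
  shows "P \<subset> normalizer G P"
proof -
  have finP: "finite P" using P fin by (meson finite_subset subgroup.subset)
  have gP: "group (G\<lparr>carrier := P\<rparr>)" using P by (simp add: subgroup_imp_group)
  obtain k where k: "card P = p ^ k" using p_group_subgroup_card[OF p ord P(1)] .
  interpret A: finite_action "G\<lparr>carrier := P\<rparr>" "rcosets P" "\<lambda>q C. C #> inv q"
    by (rule rcoset_action[where h = "\<lambda>x. x"])
       (use gP finP P fin in \<open>auto simp: hom_def subgroup.mem_carrier\<close>)
  let ?F = "{C \<in> rcosets P. \<forall>q\<in>P. C #> inv q = C}"
  have "card (rcosets P) * card P = p ^ n" using lagrange[OF P(1)] ord by simp
  then obtain j where j: "card (rcosets P) = p ^ j" by (metis divides_primepow_nat[OF p] dvd_triv_left)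
  have "j \<noteq> 0"
  proof
    assume "j = 0"
    then have "card P = card (carrier G)" using j lagrange[OF P(1)] by (simp add: order_def)
    then show False using P card_subset_eq[OF fin subgroup.subset[OF P(1)]] by simp
  qed
  then have "int p dvd int (card (rcosets P))" using j by simp
  then have "int p dvd int (card ?F)"
    using A.p_group_fixed_points[OF p, of k] k by (simp add: order_def dvd_diff_right_iff)
  moreover have "finite ?F" using A.fin_Y by simp
  moreover have "P \<in> ?F"
    using subgroup.subgroup_in_rcosets[OF P(1) is_group] coset_join2[OF _ P(1)]
      subgroup.m_inv_closed[OF P(1)] subgroup.mem_carrier[OF P(1)] by simp
  ultimately obtain C where C: "C \<in> ?F" "C \<noteq> P"
    by (rule prime_dvd_card_imp_other[OF p])
  then obtain a where a: "a \<in> carrier G" "C = P #> a" by (auto simp: RCOSETS_def)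
  have "a \<in> normalizer G P"
    using a C fixed_rcoset_iff[OF P(1) a(1)] subgroup.mem_carrier[OF P(1)]
    by (auto simp: normalizer_iff[OF P(1) finP])
  moreover have "a \<notin> P" using a C coset_join2[OF a(1) P(1)] by blast
  ultimately show ?thesis using subset_normalizer[OF P(1) finP] by blast
qed

text \<open>\<open>G\<close> acts by conjugation on the cosets of \<open>N\<close> in
  \<open>T\<close>, whose number is a positive power of \<open>p\<close>. As \<open>N\<close> is a
  fixed point there is a second one, that is, a nontrivial element of T/N that is central in
  G/N.\<close>

lemma (in group) p_group_central_step:
  assumes p: "Factorial_Ring.prime p" and fin: "finite (carrier G)" and ord: "order G = p ^ n"
    and N: "subgroup N G" "\<And>g x. \<lbrakk>g \<in> carrier G; x \<in> N\<rbrakk> \<Longrightarrow> g \<otimes> x \<otimes> inv g \<in> N"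
    and T: "subgroup T G" "\<And>g x. \<lbrakk>g \<in> carrier G; x \<in> T\<rbrakk> \<Longrightarrow> g \<otimes> x \<otimes> inv g \<in> T"
    and NT: "N \<subset> T"
  obtains x where "x \<in> T" "x \<notin> N" "\<And>g. g \<in> carrier G \<Longrightarrow> g \<otimes> x \<otimes> inv g \<otimes> inv x \<in> N"
proof -
  have Tc: "\<And>x. x \<in> T \<Longrightarrow> x \<in> carrier G" using T by (simp add: subgroup.mem_carrier)
  have Nc: "\<And>x. x \<in> N \<Longrightarrow> x \<in> carrier G" using N by (simp add: subgroup.mem_carrier)
  define Y where "Y = (\<lambda>x. N #> x) ` T"
  define act where "act g C = (\<lambda>y. g \<otimes> y \<otimes> inv g) ` C" for g C
  have act: "act g (N #> x) = N #> (g \<otimes> x \<otimes> inv g)" if g: "g \<in> carrier G" and x: "x \<in> T" for g x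
  proof -
    have r: "N #> z = (\<lambda>y. y \<otimes> z) ` N" for z by (auto simp: r_coset_def)
    have "act g (N #> x) = (\<lambda>y. y \<otimes> (g \<otimes> x \<otimes> inv g)) ` (\<lambda>y. g \<otimes> y \<otimes> inv g) ` N"
      unfolding act_def r image_image
      by (rule image_cong[OF refl]) (use g Tc[OF x] Nc in \<open>simp add: m_assoc\<close>)
    also have "(\<lambda>y. g \<otimes> y \<otimes> inv g) ` N = N"
      using conj_eq_subgroup[OF N(1) _ g] N fin by (meson finite_subset g subgroup.subset)
    finally show ?thesis by (simp only: r)
  qed
  interpret A: finite_action G Y act
  proof (unfold_locales)
    show "finite Y" using finite_subset[OF subgroup.subset[OF T(1)] fin] by (simp add: Y_def)
  next
    fix g C assume "g \<in> carrier G" "C \<in> Y" then show "act g C \<in> Y" using act T by (auto simp: Y_def)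
  next
    fix C assume "C \<in> Y" then show "act \<one> C = C" using act Tc by (auto simp: Y_def)
  next
    fix g h C assume gh: "g \<in> carrier G" "h \<in> carrier G" "C \<in> Y"
    then obtain x where x: "x \<in> T" "C = N #> x" by (auto simp: Y_def)
    have "g \<otimes> h \<otimes> x \<otimes> inv (g \<otimes> h) = g \<otimes> (h \<otimes> x \<otimes> inv h) \<otimes> inv g"
      using gh x Tc by (simp add: inv_mult_group m_assoc)
    then show "act (g \<otimes> h) C = act g (act h C)" using gh x T act by simp
  qed (use fin in auto)
  have NX: "N \<in> Y" unfolding Y_def using T N coset_mult_one subgroup.one_closed
    by (metis image_eqI subgroup.subset)
  have gT: "group (G\<lparr>carrier := T\<rparr>)" using T by (simp add: subgroup_imp_group)
  have sNT: "subgroup N (G\<lparr>carrier := T\<rparr>)" using NT N T by (intro subgroup_incl) auto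
  have "Y = rcosets\<^bsub>G\<lparr>carrier := T\<rparr>\<^esub> N" by (auto simp: Y_def RCOSETS_def r_coset_def)
  then have lag: "card Y * card N = card T" using group.lagrange[OF gT sNT] by (simp add: order_def)
  obtain k where k: "card T = p ^ k" using p_group_subgroup_card[OF p ord T(1)] .
  then obtain j where j: "card Y = p ^ j" using lag by (metis divides_primepow_nat[OF p] dvd_triv_left)
  have "j \<noteq> 0"
  proof
    assume "j = 0"
    then have "card N = card T" using j lag by simp
    then show False using NT T fin by (metis card_subset_eq finite_subset psubset_imp_subset psubset_eq subgroup.subset)
  qed
  let ?F = "{C \<in> Y. \<forall>g\<in>carrier G. act g C = C}"
  have "int p dvd int (card ?F)"
    using A.p_group_fixed_points[OF p ord] j \<open>j \<noteq> 0\<close> by (simp add: dvd_diff_right_iff)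
  moreover have "finite ?F" using A.fin_Y by simp
  moreover have "N \<in> ?F"
  proof -
    have "act g N = N" if g: "g \<in> carrier G" for g
      using act[OF g, of \<one>] g subgroup.one_closed[OF T(1)] N by (simp add: subgroup.subset)
    then show ?thesis using NX by blast
  qed
  ultimately obtain C where C: "C \<in> ?F" "C \<noteq> N"
    by (rule prime_dvd_card_imp_other[OF p])
  then obtain x where x: "x \<in> T" "C = N #> x" by (auto simp: Y_def)
  show thesis
  proof (rule that[OF x(1)])
    show "x \<notin> N" using C x coset_join2[OF Tc[OF x(1)] N(1)] by blast
    fix g assume g: "g \<in> carrier G"
    then have "N #> (g \<otimes> x \<otimes> inv g) = N #> x" using C x act by auto
    then show "g \<otimes> x \<otimes> inv g \<otimes> inv x \<in> N"
      using rcos_eq_iff[OF N(1)] g x Tc by simp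
  qed
qed

lemma nat_prime_power_if:
  fixes p :: nat
  assumes p: "Factorial_Ring.prime p" and n: "n \<noteq> 0"
    and only: "\<And>q. \<lbrakk>Factorial_Ring.prime q; q dvd n\<rbrakk> \<Longrightarrow> q = p"
  obtains k where "n = p ^ k"
proof -
  obtain r where r: "n = p ^ multiplicity p n * r" "\<not> p dvd r"
    using multiplicity_decompose'[OF n] p by (metis not_prime_unit)
  have "r = 1"
  proof (rule ccontr)
    assume "r \<noteq> 1"
    then obtain q where "Factorial_Ring.prime q" "q dvd r" using prime_factor_nat by blast
    then show False using only[of q] r by (metis dvd_mult)
  qed
  then show ?thesis using r that by simp
qed

text \<open>The elements of order prime to \<open>p\<close> generate a normal subgroup. For every
  prime q other than \<open>p\<close> it contains a Sylow q-subgroup, so q does not divide its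
  index, and minimality of the residual applies.\<close>

lemma (in group) p_residual_subset_p'_generated:
  assumes p: "Factorial_Ring.prime p" and fin: "finite (carrier G)"
  shows "p_residual p G \<subseteq> generate G {a \<in> carrier G. \<exists>m. \<not> p dvd m \<and> a [^] (m::nat) = \<one>}"
    (is "_ \<subseteq> generate G ?E")
proof -
  let ?K = "generate G ?E"
  have K: "subgroup ?K G" by (rule generate_is_subgroup) auto
  have "?K \<lhd> G"
  proof (rule normal_generateI)
    fix h g assume h: "h \<in> ?E" and g: "g \<in> carrier G"
    then obtain m where m: "\<not> p dvd m" "h [^] m = \<one>" "h \<in> carrier G" by auto
    have "(g \<otimes> h \<otimes> inv g) [^] m = g \<otimes> h [^] m \<otimes> inv g" for m :: nat
      by (induction m) (use g m in \<open>auto simp: m_assoc inv_solve_left\<close>)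
    then have "(g \<otimes> h \<otimes> inv g) [^] m = \<one>" using g m by simp
    then show "g \<otimes> h \<otimes> inv g \<in> ?E" using m g by auto
  qed auto
  moreover have "\<exists>k. card (rcosets ?K) = p ^ k"
  proof -
    have pos: "order G > 0" using fin by (simp add: order_gt_0_iff_finite)
    have lag: "card (rcosets ?K) * card ?K = order G" using lagrange[OF K] .
    have *: "q = p" if q: "Factorial_Ring.prime q" "q dvd card (rcosets ?K)" for q
    proof (rule ccontr)
      assume qp: "q \<noteq> p"
      define a where "a = multiplicity q (order G)"
      obtain m where m: "order G = q ^ a * m" using multiplicity_dvd[of q "order G"] by (auto simp: a_def)
      obtain H where H: "subgroup H G" "card H = q ^ a"
        using sylow_thm[OF q(1) is_group m fin] by blast
      have "H \<subseteq> ?K"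
      proof
        fix x assume x: "x \<in> H"
        have "x [^] (q ^ a) = \<one>"
          using group.pow_order_eq_1[OF subgroup_imp_group[OF H(1)], of x] x H(2)
          by (simp add: order_def nat_pow_consistent[symmetric])
        moreover have "\<not> p dvd q ^ a" using p q qp by (metis prime_dvd_power primes_dvd_imp_eq)
        ultimately have "x \<in> ?E" using x H(1) by (auto simp: subgroup.mem_carrier)
        then show "x \<in> ?K" by (rule generate.incl)
      qed
      then have "q ^ a dvd card ?K" using card_subgroup_dvd'[OF H(1) K] H by simp
      then have "q * q ^ a dvd card (rcosets ?K) * card ?K" using q by (intro mult_dvd_mono)
      then have "q * q ^ a dvd order G" using lag by simp
      then have "q ^ Suc a dvd order G" by simp
      then show False using not_Suc_multiplicity_dvd[OF q(1) pos] unfolding a_def by blast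
    qed
    have "card (rcosets ?K) \<noteq> 0"
    proof
      assume "card (rcosets ?K) = 0"
      then show False using lag pos by (simp only: mult_0)
    qed
    then obtain k where "card (rcosets ?K) = p ^ k" using * by (rule nat_prime_power_if[OF p])
    then show ?thesis by blast
  qed
  ultimately have "normal_p_index p G ?K" by (simp add: normal_p_index_def)
  then show ?thesis using p_residual_least(2)[OF is_group fin p] by blast
qed

section \<open>Weights with stable fixed point numbers\<close>

definition conj_set :: "('a, 'b) monoid_scheme \<Rightarrow> 'a \<Rightarrow> 'a set \<Rightarrow> 'a set" where
  "conj_set G g D = (\<lambda>x. g \<otimes>\<^bsub>G\<^esub> x \<otimes>\<^bsub>G\<^esub> inv\<^bsub>G\<^esub> g) ` D"

context group
begin

lemma conj_set_one: "D \<subseteq> carrier G \<Longrightarrow> conj_set G \<one> D = D"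
  by (force simp: conj_set_def subset_eq)

lemma conj_set_mult:
  assumes "D \<subseteq> carrier G" "g \<in> carrier G" "h \<in> carrier G"
  shows "conj_set G (g \<otimes> h) D = conj_set G g (conj_set G h D)"
  unfolding conj_set_def image_image
  by (rule image_cong[OF refl]) (use assms in \<open>auto simp: inv_mult_group m_assoc subset_eq\<close>)

lemma inj_on_conj: "\<lbrakk>D \<subseteq> carrier G; g \<in> carrier G\<rbrakk> \<Longrightarrow> inj_on (\<lambda>x. g \<otimes> x \<otimes> inv g) D"
  by (auto simp: inj_on_def subset_eq)

lemma card_conj_set: "\<lbrakk>D \<subseteq> carrier G; g \<in> carrier G\<rbrakk> \<Longrightarrow> card (conj_set G g D) = card D"
  unfolding conj_set_def by (intro card_image inj_on_conj)

lemma conj_set_mono: "D \<subseteq> E \<Longrightarrow> conj_set G g D \<subseteq> conj_set G g E"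
  by (auto simp: conj_set_def)

lemma conj_set_inv:
  assumes "D \<subseteq> carrier G" "g \<in> carrier G"
  shows "conj_set G (inv g) (conj_set G g D) = D" "conj_set G g (conj_set G (inv g) D) = D"
  using assms by (simp_all flip: conj_set_mult add: conj_set_one)

lemma normalizer_conj_set:
  "\<lbrakk>subgroup D G; finite D\<rbrakk> \<Longrightarrow> g \<in> normalizer G D \<longleftrightarrow> g \<in> carrier G \<and> conj_set G g D = D"
  using conj_eq_subgroup[of D g] by (auto simp: normalizer_iff conj_set_def)

end

text \<open>
  A family \<open>DD\<close> of subgroups plays the role of the twisted diagonals, and \<open>w E\<close> the number of points
  with stabilizer \<open>E\<close> in a virtual \<open>G\<close>-set, so that \<open>mark D\<close> is its number of \<open>D\<close>-fixed points.
\<close>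

locale twisted_family = group G for G (structure) +
  fixes DD :: "'a set set" and rep :: "'a set \<Rightarrow> 'a set" and cls :: "'a set \<Rightarrow> 'c"
  assumes fin: "finite (carrier G)"
    and DD_subgroup: "D \<in> DD \<Longrightarrow> subgroup D G"
    and DD_conj: "\<lbrakk>D \<in> DD; g \<in> carrier G\<rbrakk> \<Longrightarrow> conj_set G g D \<in> DD"
    and DD_sub: "\<lbrakk>D \<in> DD; subgroup E G; E \<subseteq> D\<rbrakk> \<Longrightarrow> E \<in> DD"
    and cls_conj: "\<lbrakk>D \<in> DD; g \<in> carrier G\<rbrakk> \<Longrightarrow> cls (conj_set G g D) = cls D"
    and rep_DD: "D \<in> DD \<Longrightarrow> rep D \<in> DD"
    and rep_cong: "\<lbrakk>D \<in> DD; E \<in> DD; cls D = cls E\<rbrakk> \<Longrightarrow> rep D = rep E"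
    and card_rep: "D \<in> DD \<Longrightarrow> card (rep D) = card D"
    and transport: "D \<in> DD \<Longrightarrow> \<exists>\<rho>\<in>hom (G\<lparr>carrier := normalizer G D\<rparr>) G.
      inj_on \<rho> (normalizer G D) \<and> \<rho> ` D = rep D \<and>
      (\<forall>E. subgroup E G \<and> D \<subseteq> E \<and> E \<subseteq> normalizer G D \<longrightarrow>
        (E \<in> DD \<longleftrightarrow> \<rho> ` E \<in> DD) \<and> (E \<in> DD \<longrightarrow> cls (\<rho> ` E) = cls E))"
begin

lemma DD_carrier: "D \<in> DD \<Longrightarrow> D \<subseteq> carrier G"
  using DD_subgroup subgroup.subset by blast

lemma finite_DD: "finite DD"
  by (rule finite_subset[of _ "Pow (carrier G)"]) (use DD_carrier fin in auto)

lemma finite_member: "D \<in> DD \<Longrightarrow> finite D"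
  using DD_carrier fin finite_subset by blast

lemma card_less: "\<lbrakk>D \<in> DD; E \<in> DD; D \<subset> E\<rbrakk> \<Longrightarrow> card D < card E"
  using finite_member psubset_card_mono by blast

text \<open>The recursion runs downwards from the large subgroups, \<open>rep D\<close> having the
  size of \<open>D\<close>. It is solved for the requirement that \<open>mark D\<close> be |N(rep
  D)| / |D| plus \<open>upper (rep D)\<close>, an expression in \<open>rep D\<close> alone. Where D
  = rep D the weight is |N(D) : D|, which amounts to a single orbit of type G/D.\<close>

definition weight :: "'a set \<Rightarrow> int" where
  "weight = wfrec (measure (\<lambda>D. card (carrier G) - card D)) (\<lambda>w D.
     int (card (normalizer G (rep D)) div card D)
       + (\<Sum>E | E \<in> DD \<and> rep D \<subset> E. w E) - (\<Sum>E | E \<in> DD \<and> D \<subset> E. w E))"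

definition mark :: "'a set \<Rightarrow> int" where
  "mark A = (\<Sum>E | E \<in> DD \<and> A \<subseteq> E. weight E)"

definition upper :: "'a set \<Rightarrow> int" where
  "upper D = (\<Sum>E | E \<in> DD \<and> D \<subset> E. weight E)"

text \<open>The recursive calls are legitimate because members of \<open>DD\<close> strictly above
  \<open>D\<close> or \<open>rep D\<close> have larger cardinality.\<close>

lemma weight_eq:
  assumes D: "D \<in> DD"
  shows "weight D = int (card (normalizer G (rep D)) div card D) + upper (rep D) - upper D"
proof -
  let ?R = "measure (\<lambda>D. card (carrier G) - card D)"
  have R: "(E, D) \<in> ?R" if "E \<in> DD" "E' \<in> DD" "card E' = card D" "E' \<subset> E" for E E'
  proof -
    have "card D < card E" using card_less[OF that(2,1,4)] that(3) by simp
    moreover have "card E \<le> card (carrier G)" using that(1) by (simp add: DD_carrier card_mono fin)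
    ultimately show ?thesis by simp
  qed
  have cut: "(\<Sum>E | E \<in> DD \<and> E' \<subset> E. cut weight ?R D E) = upper E'"
    if "E' \<in> DD" "card E' = card D" for E'
    unfolding upper_def by (rule sum.cong) (use that R in \<open>auto simp: cut_apply\<close>)
  show ?thesis
    by (subst weight_def, subst wfrec[OF wf_measure], subst (1 2) weight_def[symmetric])
       (simp add: cut D rep_DD card_rep)
qed

lemma mark_eq_upper:
  assumes "D \<in> DD" shows "mark D = weight D + upper D"
proof -
  have "{E. E \<in> DD \<and> D \<subseteq> E} = insert D {E. E \<in> DD \<and> D \<subset> E}" using assms by auto
  then show ?thesis unfolding mark_def upper_def using finite_DD by simp
qed

lemma mark_stable: "\<lbrakk>D \<in> DD; E \<in> DD; cls D = cls E\<rbrakk> \<Longrightarrow> mark D = mark E"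
  using rep_cong[of D E] card_rep[of D] card_rep[of E]
  by (simp add: mark_eq_upper weight_eq)

lemma mark_outside:
  assumes "subgroup A G" "A \<notin> DD" shows "mark A = 0"
proof -
  have "{E. E \<in> DD \<and> A \<subseteq> E} = {}" using assms DD_sub by blast
  then show ?thesis unfolding mark_def by (simp only: sum.empty)
qed

lemma sum_conj:
  assumes g: "g \<in> carrier G" and A: "A \<subseteq> carrier G"
  shows "(\<Sum>E | E \<in> DD \<and> conj_set G g A \<subset> E. f E) =
    (\<Sum>E | E \<in> DD \<and> A \<subset> E. f (conj_set G g E))"
proof (rule sum.reindex_bij_witness[of _ "conj_set G g" "conj_set G (inv g)"])
  fix E assume E: "E \<in> {E. E \<in> DD \<and> conj_set G g A \<subset> E}"
  then have "A \<subseteq> conj_set G (inv g) E"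
    using conj_set_mono[of "conj_set G g A" E "inv g"] g A by (auto simp: conj_set_inv)
  moreover have "A \<noteq> conj_set G (inv g) E"
    using E g DD_carrier[of E] by (auto simp: conj_set_inv)
  ultimately show "conj_set G (inv g) E \<in> {E. E \<in> DD \<and> A \<subset> E}" using E g DD_conj by auto
next
  fix E assume E: "E \<in> {E. E \<in> DD \<and> A \<subset> E}"
  then have "conj_set G g A \<subseteq> conj_set G g E" by (intro conj_set_mono) auto
  moreover have "conj_set G g A \<noteq> conj_set G g E"
    using E g A DD_carrier[of E] conj_set_inv(1)[of _ g] by (metis (no_types, lifting) mem_Collect_eq order_less_irrefl)
  ultimately show "conj_set G g E \<in> {E. E \<in> DD \<and> conj_set G g A \<subset> E}"
    using E g DD_conj by (simp add: psubset_eq)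
qed (use g DD_carrier in \<open>auto simp: conj_set_inv\<close>)

text \<open>Induction from the large subgroups downwards: conjugation permutes the strict
  overgroups, so \<open>upper\<close> is unchanged, and the other terms depend only on class and
  size.\<close>

lemma weight_conj:
  "\<lbrakk>D \<in> DD; g \<in> carrier G\<rbrakk> \<Longrightarrow> weight (conj_set G g D) = weight D"
proof (induction "card (carrier G) - card D" arbitrary: D rule: less_induct)
  case less
  have "upper (conj_set G g D) = (\<Sum>E | E \<in> DD \<and> D \<subset> E. weight (conj_set G g E))"
    unfolding upper_def using less.prems DD_carrier by (intro sum_conj) auto
  also have "\<dots> = upper D"
    unfolding upper_def
  proof (rule sum.cong[OF refl])
    fix E assume E: "E \<in> {E. E \<in> DD \<and> D \<subset> E}"
    then have "card D < card E" using less.prems card_less by auto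
    moreover have "card E \<le> card (carrier G)" using E by (simp add: DD_carrier card_mono fin)
    ultimately show "weight (conj_set G g E) = weight E" using less.hyps[of E] less.prems E by auto
  qed
  finally show ?case
    using less.prems weight_eq[OF DD_conj, of D g] weight_eq[of D]
      rep_cong[OF DD_conj, of D g D] cls_conj card_conj_set[OF DD_carrier, of D g] by auto
qed

text \<open>Let M be the normalizer of \<open>E\<close> in \<open>N\<close>. Then E M is a subgroup
  of the normalizer of \<open>E\<close>, and E meets M in \<open>N \<inter> E\<close>; the claim
  follows from the product formula |E M| |E \<inter> M| = |E| |M|.\<close>

lemma card_normalizer_inter_dvd:
  assumes N: "subgroup N G" and E: "E \<in> DD"
  shows "card {g \<in> N. conj_set G g E = E} * card E dvd card (normalizer G E) * card (N \<inter> E)"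
proof -
  let ?M = "{g \<in> N. conj_set G g E = E}"
  have sE: "subgroup E G" and fE: "finite E" using E DD_subgroup finite_member by auto
  have M: "?M = N \<inter> normalizer G E"
    using normalizer_conj_set[OF sE fE] subgroup.mem_carrier[OF N] by auto
  have sN: "subgroup (normalizer G E) G" using sE by (rule subgroup_normalizer)
  have sM: "subgroup ?M G" unfolding M using N sN by (rule subgroups_Inter_pair)
  have gN: "group (G\<lparr>carrier := normalizer G E\<rparr>)" using sN by (rule subgroup_imp_group)
  interpret I: second_isomorphism_grp E "G\<lparr>carrier := normalizer G E\<rparr>" ?M
    unfolding second_isomorphism_grp_def second_isomorphism_grp_axioms_def
    using subgroup_in_normalizer[OF sE] subgroup_incl[OF sM sN] M by auto
  have sEM: "subgroup (E <#>\<^bsub>G\<lparr>carrier := normalizer G E\<rparr>\<^esub> ?M) (G\<lparr>carrier := normalizer G E\<rparr>)"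
    by (rule I.normal_set_mult_subgroup)
  have sEM': "subgroup (E <#> ?M) G"
    using sEM subgroup.subset[OF sEM] incl_subgroup[OF sN] by simp
  have "card (E <#> ?M) * card (E \<inter> ?M) = card E * card ?M"
  proof -
    have gM: "group (G\<lparr>carrier := ?M\<rparr>)" and gEM: "group (G\<lparr>carrier := E <#> ?M\<rparr>)"
      using sM sEM' by (simp_all add: subgroup_imp_group)
    have sI: "subgroup (E \<inter> ?M) (G\<lparr>carrier := ?M\<rparr>)"
      using subgroup_incl[OF subgroups_Inter_pair[OF sE sM] sM] by simp
    have sE': "subgroup E (G\<lparr>carrier := E <#> ?M\<rparr>)"
      using subgroup_incl[OF sE sEM'] I.H_contained_in_set_mult by simp
    have eq: "card (rcosets\<^bsub>G\<lparr>carrier := ?M\<rparr>\<^esub> (E \<inter> ?M)) = card (rcosets\<^bsub>G\<lparr>carrier := E <#> ?M\<rparr>\<^esub> E)"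
      using I.normal_intersection_quotient_isom bij_betw_same_card
      by (fastforce simp: iso_def FactGroup_def)
    have "card (rcosets\<^bsub>G\<lparr>carrier := ?M\<rparr>\<^esub> (E \<inter> ?M)) * card (E \<inter> ?M) = card ?M"
      and "card (rcosets\<^bsub>G\<lparr>carrier := E <#> ?M\<rparr>\<^esub> E) * card E = card (E <#> ?M)"
      using group.lagrange[OF gM sI] group.lagrange[OF gEM sE'] by (simp_all add: order_def)
    note this[symmetric]
    then show ?thesis unfolding eq by (simp only: mult_ac)
  qed
  moreover have "card (E <#> ?M) dvd card (normalizer G E)"
    using group.card_subgroup_dvd[OF gN sEM] by (simp add: order_def)
  moreover have "E \<inter> ?M = N \<inter> E"
    using M subset_normalizer[OF sE fE] by auto
  ultimately show ?thesis
    using mult_dvd_mono[of "card (E <#> ?M)" "card (normalizer G E)" "card (E \<inter> ?M)" "card (E \<inter> ?M)"]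
    by (simp add: mult.commute)
qed

text \<open>A virtual Cauchy-Frobenius count. \<open>N\<close> normalizes \<open>D\<close> and so
  acts on the points whose stabilizer strictly contains \<open>D\<close>; the sum counts pairs of
  such a point and an element of \<open>N\<close> fixing it, which for a genuine set is |N| times
  the number of orbits. Since the set is only virtual, the count is done on stabilizers: each orbit
  of \<open>N\<close> on the \<open>E\<close> contributes a multiple of |N|, by the preceding
  divisibility and the integrality assumed for \<open>E\<close>.\<close>

lemma burnside_dvd:
  assumes D: "D \<in> DD" and N: "subgroup N G" "N \<subseteq> normalizer G D"
    and IH: "\<And>E. \<lbrakk>E \<in> DD; D \<subset> E\<rbrakk> \<Longrightarrow> int (card (normalizer G E)) dvd int (card E) * weight E"
  shows "int (card N) dvd (\<Sum>E | E \<in> DD \<and> D \<subset> E. weight E * int (card (N \<inter> E)))"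
proof -
  have Nc: "\<And>g. g \<in> N \<Longrightarrow> g \<in> carrier G" using N subgroup.mem_carrier by metis
  have finN: "finite N" using N(1) fin by (meson finite_subset subgroup.subset)
  have ND: "conj_set G g D = D" if "g \<in> N" for g
    using that N(2) normalizer_conj_set[OF DD_subgroup[OF D] finite_member[OF D]] by auto
  interpret A: finite_action "G\<lparr>carrier := N\<rparr>" "{E. E \<in> DD \<and> D \<subset> E}" "conj_set G"
  proof -
    interpret N: group "G\<lparr>carrier := N\<rparr>" using N(1) by (rule subgroup_imp_group)
    show "finite_action (G\<lparr>carrier := N\<rparr>) {E. E \<in> DD \<and> D \<subset> E} (conj_set G)"
    proof (unfold_locales)
      fix g E assume "g \<in> carrier (G\<lparr>carrier := N\<rparr>)" "E \<in> {E. E \<in> DD \<and> D \<subset> E}"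
      then have gE: "g \<in> N" "E \<in> DD \<and> D \<subset> E" by auto
      have "D \<subseteq> conj_set G g E" using ND[OF gE(1)] gE(2) conj_set_mono[of D E g] by auto
      moreover have "D \<noteq> conj_set G g E"
        using card_less[of D E] card_conj_set[OF DD_carrier Nc, of E g] gE D by auto
      ultimately show "conj_set G g E \<in> {E. E \<in> DD \<and> D \<subset> E}"
        using gE Nc DD_conj by (simp add: psubset_eq)
    qed (use finN finite_DD DD_carrier Nc in \<open>auto simp: conj_set_one conj_set_mult\<close>)
  qed
  show ?thesis
  proof (rule A.dvd_sum_invariant)
    fix g E assume g: "g \<in> carrier (G\<lparr>carrier := N\<rparr>)" and E: "E \<in> {E. E \<in> DD \<and> D \<subset> E}"
    have "N \<inter> conj_set G g E = conj_set G g (N \<inter> E)"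
    proof safe
      fix x assume x: "x \<in> N" "x \<in> conj_set G g E"
      then obtain y where y: "y \<in> E" "x = g \<otimes> y \<otimes> inv g" by (auto simp: conj_set_def)
      have "y = inv g \<otimes> x \<otimes> g"
        using y g Nc DD_carrier E by (auto simp: m_assoc subset_eq)
      then have "y \<in> N" using x g N by (simp add: subgroup.m_closed subgroup.m_inv_closed)
      then show "x \<in> conj_set G g (N \<inter> E)" using y by (auto simp: conj_set_def)
    qed (use g N in \<open>auto simp: conj_set_def subgroup.m_closed subgroup.m_inv_closed\<close>)
    moreover have "card (conj_set G g (N \<inter> E)) = card (N \<inter> E)"
      by (rule card_conj_set) (use g Nc in auto)
    ultimately show "weight (conj_set G g E) * int (card (N \<inter> conj_set G g E)) =
        weight E * int (card (N \<inter> E))"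
      using weight_conj[of E g] E g Nc by simp
  next
    fix E assume E: "E \<in> {E. E \<in> DD \<and> D \<subset> E}"
    let ?o = "int (card (A.orb E))" and ?s = "int (card {g \<in> N. conj_set G g E = E})"
      and ?i = "int (card (N \<inter> E))" and ?n = "int (card (normalizer G E))" and ?e = "int (card E)"
    have os: "?o * ?s = int (card N)"
      using A.card_orb_stab[OF E] by (simp add: A.stab_def order_def flip: of_nat_mult)
    have "?s * ?e dvd ?n * ?i"
      using card_normalizer_inter_dvd[OF N(1), of E] E by (simp flip: of_nat_mult)
    also have "?n * ?i dvd ?e * weight E * ?i" using IH[of E] E by (intro mult_dvd_mono) auto
    finally have "?e * ?s dvd ?e * (weight E * ?i)" by (simp add: mult_ac)
    moreover have "?e \<noteq> 0" using card_subgroup_pos[OF DD_subgroup fin, of E] E by simp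
    ultimately have "?s dvd weight E * ?i" by simp
    then show "int (card N) dvd ?o * (weight E * ?i)" unfolding os[symmetric] by (rule mult_dvd_mono[OF dvd_refl])
  qed
qed

text \<open>Exchange of summation: an element of \<open>D\<close> lies in every \<open>E\<close> and
  contributes \<open>upper D\<close>, while for x outside \<open>D\<close> the condition on
  \<open>E\<close> is to contain the subgroup generated by x and \<open>D\<close>.\<close>

lemma sum_upper_swap:
  assumes D: "D \<in> DD" and N: "subgroup N G" and DN: "D \<subseteq> N"
  shows "(\<Sum>E | E \<in> DD \<and> D \<subset> E. weight E * int (card (N \<inter> E))) =
    int (card D) * upper D + (\<Sum>x\<in>N - D. mark (generate G (insert x D)))"
proof -
  have finN: "finite N" using N fin by (meson finite_subset subgroup.subset)
  let ?U = "{E. E \<in> DD \<and> D \<subset> E}"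
  have finU: "finite ?U" using finite_DD by simp
  have "(\<Sum>E\<in>?U. weight E * int (card (N \<inter> E))) = (\<Sum>E\<in>?U. \<Sum>x\<in>N. if x \<in> E then weight E else 0)"
  proof (rule sum.cong[OF refl])
    fix E
    have "(\<Sum>x\<in>N \<inter> E. weight E) = (\<Sum>x\<in>N. if x \<in> E then weight E else 0)"
      by (rule sum.inter_restrict[OF finN])
    then show "weight E * int (card (N \<inter> E)) = (\<Sum>x\<in>N. if x \<in> E then weight E else 0)"
      by (simp add: mult.commute)
  qed
  also have "\<dots> = (\<Sum>x\<in>N. \<Sum>E\<in>?U. if x \<in> E then weight E else 0)" by (rule sum.swap)
  also have "\<dots> = (\<Sum>x\<in>D. \<Sum>E\<in>?U. if x \<in> E then weight E else 0)
      + (\<Sum>x\<in>N - D. \<Sum>E\<in>?U. if x \<in> E then weight E else 0)"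
    using sum.subset_diff[OF DN finN] by (simp add: add.commute)
  also have "(\<Sum>x\<in>D. \<Sum>E\<in>?U. if x \<in> E then weight E else 0) = (\<Sum>x\<in>D. upper D)"
    unfolding upper_def by (intro sum.cong refl) auto
  also have "(\<Sum>x\<in>N - D. \<Sum>E\<in>?U. if x \<in> E then weight E else 0) =
      (\<Sum>x\<in>N - D. mark (generate G (insert x D)))"
  proof (rule sum.cong[OF refl])
    fix x assume x: "x \<in> N - D"
    have sub: "insert x D \<subseteq> carrier G" using x DN N by (auto simp: subgroup.mem_carrier)
    have "{E \<in> ?U. x \<in> E} = {E. E \<in> DD \<and> generate G (insert x D) \<subseteq> E}"
    proof (intro equalityI subsetI)
      fix E assume E: "E \<in> {E \<in> ?U. x \<in> E}"
      have "generate G (insert x D) \<subseteq> E"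
        by (rule generate_subgroup_incl[OF _ DD_subgroup]) (use E in auto)
      then show "E \<in> {E. E \<in> DD \<and> generate G (insert x D) \<subseteq> E}" using E by simp
    next
      fix E assume E: "E \<in> {E. E \<in> DD \<and> generate G (insert x D) \<subseteq> E}"
      have "insert x D \<subseteq> generate G (insert x D)" by (auto intro: generate.incl)
      then have "insert x D \<subseteq> E" using E by blast
      then show "E \<in> {E \<in> ?U. x \<in> E}" using E x by auto
    qed
    then show "(\<Sum>E\<in>?U. if x \<in> E then weight E else 0) = mark (generate G (insert x D))"
      unfolding mark_def using sum.inter_filter[OF finU, of weight "\<lambda>E. x \<in> E"] by simp
  qed
  finally show ?thesis by simp
qed

text \<open>The quotient of the two sides is the number of orbits of type G/D, so this is the
  integrality of the virtual set. The counts for \<open>D\<close> and \<open>rep D\<close> are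
  compared: \<open>transport\<close> embeds N(D) into N(rep D), and the marks of the overgroups
  generated by one more element correspond. The difference shows that |N(D)| divides |D| (upper (rep
  D) - upper D). What remains of |D| times the weight is |N(rep D)|, a multiple of |N(D)| by the
  same embedding.\<close>

lemma weight_dvd:
  "D \<in> DD \<Longrightarrow> int (card (normalizer G D)) dvd int (card D) * weight D"
proof (induction "card (carrier G) - card D" arbitrary: D rule: less_induct)
  case less
  note D = less.prems
  let ?D0 = "rep D" and ?N = "normalizer G D"
  have sD: "subgroup D G" and fD: "finite D" and D0: "?D0 \<in> DD" and sD0: "subgroup ?D0 G"
    using D DD_subgroup finite_member rep_DD by auto
  have sN: "subgroup ?N G" using sD by (rule subgroup_normalizer)
  have fN: "finite ?N" using sN fin by (meson finite_subset subgroup.subset)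
  have IH: "int (card (normalizer G E)) dvd int (card E) * weight E"
    if "E \<in> DD" "D' \<in> DD" "card D' = card D" "D' \<subset> E" for E D'
  proof -
    have "card D < card E" using card_less[of D' E] that by simp
    moreover have "card E \<le> card (carrier G)" using that by (simp add: DD_carrier card_mono fin)
    ultimately show ?thesis using less.hyps[of E] that by auto
  qed
  obtain \<rho> where \<rho>: "\<rho> \<in> hom (G\<lparr>carrier := ?N\<rparr>) G" "inj_on \<rho> ?N" "\<rho> ` D = ?D0"
    and tr: "\<And>E. \<lbrakk>subgroup E G; D \<subseteq> E; E \<subseteq> ?N\<rbrakk> \<Longrightarrow>
      (E \<in> DD \<longleftrightarrow> \<rho> ` E \<in> DD) \<and> (E \<in> DD \<longrightarrow> cls (\<rho> ` E) = cls E)"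
    using transport[OF D] by blast
  interpret h: group_hom "G\<lparr>carrier := ?N\<rparr>" G \<rho>
    using \<rho>(1) sN by (simp add: group_hom_def group_hom_axioms_def subgroup_imp_group)
  have DN: "D \<subseteq> ?N" by (rule subset_normalizer[OF sD fD])
  have sub_im: "subgroup (\<rho> ` E) G" if "subgroup E G" "E \<subseteq> ?N" for E
    using h.subgroup_img_is_subgroup[OF subgroup_incl[OF that(1) sN that(2)]] .
  let ?N' = "\<rho> ` ?N"
  have sN': "subgroup ?N' G" using sub_im[OF sN] by simp
  have cN': "card ?N' = card ?N" using \<rho>(2) by (rule card_image)
  have N'0: "?N' \<subseteq> normalizer G ?D0"
  proof
    fix y assume "y \<in> ?N'"
    then obtain g where g: "g \<in> ?N" "y = \<rho> g" by blast
    have gc: "g \<in> carrier G" using g sN subgroup.mem_carrier by metis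
    have "y \<otimes> z \<otimes> inv y \<in> ?D0" if "z \<in> ?D0" for z
    proof -
      have "z \<in> \<rho> ` D" unfolding \<rho>(3) by (rule that)
      then obtain d where d: "d \<in> D" "z = \<rho> d" by (elim imageE)
      have dN: "d \<in> ?N" using d DN by blast
      have "inv\<^bsub>G\<lparr>carrier := ?N\<rparr>\<^esub> g = inv g" using g sN by (simp add: m_inv_consistent)
      then have eq: "\<rho> (g \<otimes> d \<otimes> inv g) = y \<otimes> z \<otimes> inv y"
        using h.hom_mult[of "g \<otimes> d" "inv g"] h.hom_mult[of g d] h.hom_inv[of g] g d dN sN
        by (simp add: subgroup.m_closed subgroup.m_inv_closed)
      have "g \<otimes> d \<otimes> inv g \<in> D" using g d normalizer_iff[OF sD fD] by blast
      then have "\<rho> (g \<otimes> d \<otimes> inv g) \<in> \<rho> ` D" by (rule imageI)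
      then show ?thesis unfolding eq \<rho>(3) .
    qed
    moreover have "y \<in> carrier G" using g h.hom_closed by simp
    ultimately show "y \<in> normalizer G ?D0"
      using normalizer_iff[OF sD0 finite_member[OF D0]] by blast
  qed
  have D0N': "?D0 \<subseteq> ?N'" using \<rho>(3) DN by blast
  have 1: "int (card ?N) dvd
      int (card D) * upper D + (\<Sum>x\<in>?N - D. mark (generate G (insert x D)))"
    using burnside_dvd[OF D sN order_refl IH[OF _ D refl]] sum_upper_swap[OF D sN DN] by simp
  have 2: "int (card ?N) dvd
      int (card D) * upper ?D0 + (\<Sum>y\<in>?N' - ?D0. mark (generate G (insert y ?D0)))"
    using burnside_dvd[OF D0 sN' N'0 IH[OF _ D0 card_rep[OF D]]] sum_upper_swap[OF D0 sN' D0N']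
    by (simp add: card_rep[OF D] cN')
  have "(\<Sum>y\<in>?N' - ?D0. mark (generate G (insert y ?D0))) =
      (\<Sum>x\<in>?N - D. mark (generate G (insert (\<rho> x) ?D0)))"
  proof -
    have "?N' - ?D0 = \<rho> ` (?N - D)" using \<rho>(2,3) DN by (simp add: inj_on_image_set_diff)
    moreover have "inj_on \<rho> (?N - D)" using \<rho>(2) by (rule inj_on_subset) auto
    ultimately show ?thesis by (simp add: sum.reindex)
  qed
  also have "\<dots> = (\<Sum>x\<in>?N - D. mark (generate G (insert x D)))"
  proof (rule sum.cong[OF refl])
    fix x assume x: "x \<in> ?N - D"
    let ?E = "generate G (insert x D)"
    have sub: "insert x D \<subseteq> ?N" using x DN by auto
    have subc: "insert x D \<subseteq> carrier G" using sub sN subgroup.subset by blast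
    have sE: "subgroup ?E G" using subc by (rule generate_is_subgroup)
    have EN: "?E \<subseteq> ?N" using generate_subgroup_incl[OF sub sN] .
    have "\<rho> ` ?E = generate G (\<rho> ` insert x D)"
      using h.generate_img[of "insert x D"] sub generate_consistent[OF sub sN] by simp
    then have im: "\<rho> ` ?E = generate G (insert (\<rho> x) ?D0)" using \<rho>(3) by simp
    have DE: "D \<subseteq> ?E" by (auto intro: generate.incl)
    note t = tr[OF sE DE EN]
    \<comment> \<open>Inside \<open>DD\<close> stability of the marks applies; outside, both marks
      are 0, since \<open>transport\<close> reflects membership.\<close>
    show "mark (generate G (insert (\<rho> x) ?D0)) = mark ?E"
    proof (cases "?E \<in> DD")
      case True
      then show ?thesis using t mark_stable[of "\<rho> ` ?E" ?E] im by simp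
    next
      case False
      then show ?thesis using t mark_outside[OF sE] mark_outside[OF sub_im[OF sE EN]] im by simp
    qed
  qed
  finally have "int (card ?N) dvd int (card D) * (upper ?D0 - upper D)"
    using dvd_diff[OF 2 1] by (simp add: right_diff_distrib)
  moreover have "int (card ?N) dvd int (card (normalizer G ?D0))"
    using card_subgroup_dvd'[OF sN' subgroup_normalizer[OF sD0] N'0] cN' by simp
  moreover have "card D * (card (normalizer G ?D0) div card D) = card (normalizer G ?D0)"
    using card_subgroup_dvd'[OF sD0 subgroup_normalizer[OF sD0] subset_normalizer[OF sD0 finite_member[OF D0]]]
    by (simp add: card_rep[OF D])
  then have "int (card D) * int (card (normalizer G ?D0) div card D) = int (card (normalizer G ?D0))"
    by (simp only: flip: of_nat_mult)
  then have "int (card D) * weight D =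
      int (card (normalizer G ?D0)) + int (card D) * (upper ?D0 - upper D)"
    unfolding weight_eq[OF D] by (simp only: right_diff_distrib distrib_left)
  ultimately show ?case by simp
qed

end

lemma (in group) subgroup_pow_closed: "\<lbrakk>subgroup H G; x \<in> H\<rbrakk> \<Longrightarrow> x [^] (n::nat) \<in> H"
  by (induction n) (auto simp: subgroup.one_closed subgroup.m_closed)

section \<open>Fusion systems\<close>

locale fusion_cat = group S for S (structure) +
  fixes F :: "'a hom_family"
  assumes fin: "finite (carrier S)" and fus: "fusion_system S F"
begin

abbreviation hom_S :: "'a set \<Rightarrow> ('a \<Rightarrow> 'a) set" where "hom_S P \<equiv> F P (carrier S)"

lemma finite_subgroup: "subgroup P S \<Longrightarrow> finite P"
  using fin by (meson finite_subset subgroup.subset)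

lemma F_inj_homs: "\<lbrakk>subgroup P S; subgroup Q S; \<phi> \<in> F P Q\<rbrakk> \<Longrightarrow> \<phi> \<in> inj_homs S P Q"
  using fus by (auto simp: fusion_system_def)

lemma F_props:
  assumes "subgroup P S" "subgroup Q S" "\<phi> \<in> F P Q"
  shows "\<phi> \<in> extensional P" "inj_on \<phi> P" "\<phi> ` P \<subseteq> Q"
    "\<lbrakk>x \<in> P; y \<in> P\<rbrakk> \<Longrightarrow> \<phi> (x \<otimes> y) = \<phi> x \<otimes> \<phi> y"
  using F_inj_homs[OF assms] by (auto simp: inj_homs_def mon_def hom_def)

lemma F_compose:
  "\<lbrakk>subgroup P S; subgroup Q S; subgroup R S; \<phi> \<in> F P Q; \<psi> \<in> F Q R\<rbrakk> \<Longrightarrow> compose P \<psi> \<phi> \<in> F P R"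
  using fus unfolding fusion_system_def by blast

lemma F_conj_hom: "\<lbrakk>subgroup P S; subgroup Q S; \<phi> \<in> conj_hom S P Q\<rbrakk> \<Longrightarrow> \<phi> \<in> F P Q"
  using fus unfolding fusion_system_def by blast

lemma conj_map_one: "subgroup P S \<Longrightarrow> conj_map S \<one> P = (\<lambda>x\<in>P. x)"
  by (auto simp: conj_map_def restrict_def subgroup.mem_carrier)

lemma F_incl: "\<lbrakk>subgroup P S; subgroup Q S; P \<subseteq> Q\<rbrakk> \<Longrightarrow> (\<lambda>x\<in>P. x) \<in> F P Q"
  using F_conj_hom[of P Q "conj_map S \<one> P"] by (force simp: conj_hom_def conj_map_one)

text \<open>The factorization axiom provides an isomorphism onto some \<open>R\<close>. Following it
  by an inclusion changes no value of an extensional map, so it is \<phi> itself and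
  \<open>R\<close> is the image.\<close>

lemma F_image:
  assumes P: "subgroup P S" and Q: "subgroup Q S" and \<phi>: "\<phi> \<in> F P Q"
  shows "subgroup (\<phi> ` P) S" "\<phi> \<in> F P (\<phi> ` P)" "(\<lambda>y\<in>\<phi> ` P. inv_into P \<phi> y) \<in> F (\<phi> ` P) P"
proof -
  obtain R \<psi> where R: "subgroup R S" "R \<subseteq> Q" "\<psi> \<in> fus_iso F P R" "\<phi> = compose P (\<lambda>x\<in>R. x) \<psi>"
    using fus P Q \<phi> unfolding fusion_system_def by blast
  have \<psi>: "\<psi> \<in> F P R" using R by (simp add: fus_iso_def)
  obtain \<theta> where \<theta>: "\<theta> \<in> F R P" "compose P \<theta> \<psi> = (\<lambda>x\<in>P. x)" "compose R \<psi> \<theta> = (\<lambda>x\<in>R. x)"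
    using R(3) by (auto simp: fus_iso_def)
  have "\<phi> = \<psi>"
  proof
    fix x show "\<phi> x = \<psi> x"
      using R(4) F_props(1,3)[OF P R(1) \<psi>] by (auto simp: compose_def extensional_def)
  qed
  have \<theta>1: "\<theta> (\<psi> x) = x" if "x \<in> P" for x using fun_cong[OF \<theta>(2), of x] that by (simp add: compose_def)
  have \<theta>2: "\<psi> (\<theta> y) = y" if "y \<in> R" for y using fun_cong[OF \<theta>(3), of y] that by (simp add: compose_def)
  have im: "\<phi> ` P = R"
    using F_props(3)[OF P R(1) \<psi>] F_props(3)[OF R(1) P \<theta>(1)] \<theta>2 unfolding \<open>\<phi> = \<psi>\<close>
    by (metis image_subset_iff subsetI subset_antisym image_eqI)
  have "(\<lambda>y\<in>\<phi> ` P. inv_into P \<phi> y) = \<theta>"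
  proof
    fix y show "(\<lambda>y\<in>\<phi> ` P. inv_into P \<phi> y) y = \<theta> y"
    proof (cases "y \<in> R")
      case True
      then have "\<theta> y \<in> P" using F_props(3)[OF R(1) P \<theta>(1)] by auto
      then have "inv_into P \<phi> (\<phi> (\<theta> y)) = \<theta> y"
        using F_props(2)[OF P R(1) \<psi>] \<open>\<phi> = \<psi>\<close> by (simp add: inv_into_f_f)
      then show ?thesis using True \<theta>2 im \<open>\<phi> = \<psi>\<close> by simp
    next
      case False
      then show ?thesis using im F_props(1)[OF R(1) P \<theta>(1)] by (simp add: extensional_def)
    qed
  qed
  then show "(\<lambda>y\<in>\<phi> ` P. inv_into P \<phi> y) \<in> F (\<phi> ` P) P" using im \<theta>(1) by simp
  show "subgroup (\<phi> ` P) S" "\<phi> \<in> F P (\<phi> ` P)" using im R(1) \<psi> \<open>\<phi> = \<psi>\<close> by auto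
qed

lemma F_widen:
  assumes P: "subgroup P S" and Q: "subgroup Q S" and \<phi>: "\<phi> \<in> F P Q"
    and Q': "subgroup Q' S" "\<phi> ` P \<subseteq> Q'"
  shows "\<phi> \<in> F P Q'"
proof -
  have "compose P (\<lambda>x\<in>\<phi> ` P. x) \<phi> \<in> F P Q'"
    using F_compose[OF P F_image(1)[OF P Q \<phi>] Q'(1) F_image(2)[OF P Q \<phi>]
        F_incl[OF F_image(1)[OF P Q \<phi>] Q'(1) Q'(2)]] .
  moreover have "compose P (\<lambda>x\<in>\<phi> ` P. x) \<phi> = \<phi>"
    using F_props(1)[OF P Q \<phi>] by (auto simp: compose_def extensional_def)
  ultimately show ?thesis by simp
qed

lemma F_to_S: "\<lbrakk>subgroup P S; subgroup Q S; \<phi> \<in> F P Q\<rbrakk> \<Longrightarrow> \<phi> \<in> hom_S P"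
  by (rule F_widen[of P Q]) (auto simp: subgroup_self dest: F_props(3) subgroup.subset)

context
  fixes P \<phi> assumes P: "subgroup P S" and \<phi>: "\<phi> \<in> hom_S P"
begin

lemma hom_S_inj: "inj_on \<phi> P" and hom_S_ext: "\<phi> \<in> extensional P"
  and hom_S_closed: "x \<in> P \<Longrightarrow> \<phi> x \<in> carrier S"
  and hom_S_mult: "\<lbrakk>x \<in> P; y \<in> P\<rbrakk> \<Longrightarrow> \<phi> (x \<otimes> y) = \<phi> x \<otimes> \<phi> y"
  using F_props[OF P subgroup_self \<phi>] by auto

lemma hom_S_group_hom: "group_hom (S\<lparr>carrier := P\<rparr>) S \<phi>"
  using P hom_S_closed hom_S_mult
  by (auto simp: group_hom_def group_hom_axioms_def hom_def subgroup_imp_group)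

lemma hom_S_inv: "x \<in> P \<Longrightarrow> \<phi> (inv x) = inv (\<phi> x)"
  using group_hom.hom_inv[OF hom_S_group_hom, of x] P by (simp add: m_inv_consistent)

lemma hom_S_pow: "x \<in> P \<Longrightarrow> \<phi> (x [^] (n::nat)) = \<phi> x [^] n"
  using group_hom.hom_nat_pow[OF hom_S_group_hom, of x n] by (simp add: nat_pow_consistent[symmetric])

lemma hom_S_image: "subgroup (\<phi> ` P) S"
  by (rule F_image(1)[OF P subgroup_self \<phi>])

lemma hom_S_inverse: "(\<lambda>y\<in>\<phi> ` P. inv_into P \<phi> y) \<in> hom_S (\<phi> ` P)"
  by (rule F_to_S[OF hom_S_image P F_image(3)[OF P subgroup_self \<phi>]])

lemma hom_S_to: "\<lbrakk>subgroup Q S; \<phi> ` P \<subseteq> Q\<rbrakk> \<Longrightarrow> \<phi> \<in> F P Q"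
  by (rule F_widen[OF P subgroup_self \<phi>])

lemma hom_S_restrict:
  assumes "subgroup Q S" "Q \<subseteq> P" shows "restrict \<phi> Q \<in> hom_S Q"
proof -
  have "compose Q \<phi> (\<lambda>x\<in>Q. x) \<in> hom_S Q"
    by (rule F_compose[OF assms(1) P subgroup_self F_incl[OF assms(1) P assms(2)] \<phi>])
  moreover have "compose Q \<phi> (\<lambda>x\<in>Q. x) = restrict \<phi> Q" by (auto simp: compose_def)
  ultimately show ?thesis by simp
qed

lemma hom_S_compose:
  assumes "subgroup Q S" "\<psi> \<in> hom_S Q" "\<phi> ` P \<subseteq> Q"
  shows "compose P \<psi> \<phi> \<in> hom_S P"
  by (rule F_compose[OF P assms(1) subgroup_self hom_S_to[OF assms(1,3)] assms(2)])

end

lemma conj_map_hom: "\<lbrakk>subgroup P S; g \<in> carrier S\<rbrakk> \<Longrightarrow> conj_map S g P \<in> hom_S P"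
  by (rule F_conj_hom) (auto simp: subgroup_self conj_hom_def conj_map_def subgroup.mem_carrier)

lemma fus_conjugate_iff:
  assumes "subgroup P S" "subgroup Q S"
  shows "fus_conjugate F P Q \<longleftrightarrow> (\<exists>\<phi>\<in>hom_S P. \<phi> ` P = Q)"
proof
  assume "fus_conjugate F P Q"
  then obtain \<phi> \<psi> where *: "\<phi> \<in> F P Q" "\<psi> \<in> F Q P" "compose Q \<phi> \<psi> = (\<lambda>x\<in>Q. x)"
    by (auto simp: fus_conjugate_def fus_iso_def)
  have "\<phi> (\<psi> y) = y" if "y \<in> Q" for y using fun_cong[OF *(3), of y] that by (simp add: compose_def)
  then have "\<phi> ` P = Q"
    using F_props(3)[OF assms *(1)] F_props(3)[OF assms(2,1) *(2)]
    by (metis image_subset_iff subsetI subset_antisym image_eqI)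
  then show "\<exists>\<phi>\<in>hom_S P. \<phi> ` P = Q" using F_to_S[OF assms *(1)] by blast
next
  assume "\<exists>\<phi>\<in>hom_S P. \<phi> ` P = Q"
  then obtain \<phi> where \<phi>: "\<phi> \<in> hom_S P" "\<phi> ` P = Q" by blast
  let ?\<psi> = "\<lambda>y\<in>\<phi> ` P. inv_into P \<phi> y"
  have "\<phi> \<in> F P Q" using hom_S_to[OF assms(1) \<phi>(1) assms(2)] \<phi>(2) by simp
  moreover have "?\<psi> \<in> F Q P" using F_image(3)[OF assms(1) subgroup_self \<phi>(1)] \<phi>(2) by simp
  moreover have "compose P ?\<psi> \<phi> = (\<lambda>x\<in>P. x)" "compose Q \<phi> ?\<psi> = (\<lambda>x\<in>Q. x)"
    using hom_S_inj[OF assms(1) \<phi>(1)] \<phi>(2) by (auto simp: compose_def f_inv_into_f)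
  ultimately show "fus_conjugate F P Q" by (auto simp: fus_conjugate_def fus_iso_def)
qed

text \<open>Equality of these sets is the invariant by which fixed point numbers of the biset are
  compared.\<close>

definition fcls :: "'a set \<Rightarrow> 'a set set" where
  "fcls P = {Q. \<exists>\<phi>\<in>hom_S P. \<phi> ` P = Q}"

lemma fcls_image:
  assumes P: "subgroup P S" and \<phi>: "\<phi> \<in> hom_S P"
  shows "fcls (\<phi> ` P) = fcls P"
proof -
  have *: "fcls (\<phi> ` P) \<subseteq> fcls P" if "subgroup P S" "\<phi> \<in> hom_S P" for P \<phi>
  proof
    fix Q assume "Q \<in> fcls (\<phi> ` P)"
    then obtain \<psi> where \<psi>: "\<psi> \<in> hom_S (\<phi> ` P)" "\<psi> ` \<phi> ` P = Q" by (auto simp: fcls_def)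
    have "compose P \<psi> \<phi> \<in> hom_S P"
      by (rule hom_S_compose[OF that hom_S_image[OF that] \<psi>(1)]) simp
    moreover have "compose P \<psi> \<phi> ` P = Q" using \<psi>(2) by (auto simp: compose_def)
    ultimately show "Q \<in> fcls P" by (auto simp: fcls_def)
  qed
  let ?\<psi> = "\<lambda>y\<in>\<phi> ` P. inv_into P \<phi> y"
  have "?\<psi> ` \<phi> ` P = P" using hom_S_inj[OF P \<phi>] by (auto simp: image_image)
  then show ?thesis
    using *[OF P \<phi>] *[OF hom_S_image[OF P \<phi>] hom_S_inverse[OF P \<phi>]] by simp
qed

lemma fcls_refl: "subgroup P S \<Longrightarrow> P \<in> fcls P"
  using F_incl[OF _ subgroup_self, of P] subgroup.subset[of P S]
  by (auto simp: fcls_def intro!: bexI[of _ "\<lambda>x\<in>P. x"])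

lemma ex_fully_normalized:
  assumes P: "subgroup P S"
  shows "\<exists>\<phi>\<in>hom_S P. fully_normalized S F (\<phi> ` P)"
proof -
  let ?M = "(\<lambda>Q. card (normalizer S Q)) ` fcls P"
  have sub: "\<And>Q. Q \<in> fcls P \<Longrightarrow> subgroup Q S" using hom_S_image[OF P] by (auto simp: fcls_def)
  have "fcls P \<subseteq> Pow (carrier S)" using subgroup.subset[OF sub] by auto
  then have finM: "finite ?M" using fin by (simp add: finite_subset)
  moreover have "?M \<noteq> {}" using fcls_refl[OF P] by blast
  ultimately have "Max ?M \<in> ?M" by (rule Max_in)
  then obtain Q where Q: "Q \<in> fcls P" "card (normalizer S Q) = Max ?M" by (elim imageE) simp
  then obtain \<phi> where \<phi>: "\<phi> \<in> hom_S P" "\<phi> ` P = Q" by (auto simp: fcls_def)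
  have "fully_normalized S F Q"
    unfolding fully_normalized_def
  proof (intro allI impI)
    fix R assume R: "subgroup R S \<and> fus_conjugate F Q R"
    then have "R \<in> fcls Q" using fus_conjugate_iff[OF sub[OF Q(1)], of R] by (simp add: fcls_def)
    then have "R \<in> fcls P" using fcls_image[OF P \<phi>(1)] \<phi>(2) by simp
    then show "card (normalizer S Q) \<ge> card (normalizer S R)" using Q(2) finM by simp
  qed
  then show ?thesis using \<phi> by blast
qed

subsection \<open>Automorphism groups\<close>

lemma aut_Bij:
  assumes P: "subgroup P S" and \<alpha>: "\<alpha> \<in> F P P" shows "\<alpha> \<in> Bij P" "\<alpha> ` P = P"
proof -
  show im: "\<alpha> ` P = P"
    using F_props(2,3)[OF P P \<alpha>] finite_subgroup[OF P] by (simp add: endo_inj_surj)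
  show "\<alpha> \<in> Bij P" using F_props(1,2)[OF P P \<alpha>] im by (auto simp: Bij_def bij_betw_def)
qed

lemma aut_group_mult:
  assumes "subgroup P S" "\<alpha> \<in> F P P" "\<beta> \<in> F P P"
  shows "\<alpha> \<otimes>\<^bsub>aut_group F P\<^esub> \<beta> = compose P \<alpha> \<beta>"
  using aut_Bij assms by (simp add: aut_group_def BijGroup_def)

lemma aut_subgroup: "subgroup P S \<Longrightarrow> subgroup (F P P) (BijGroup P)"
proof (rule group.subgroupI[OF group_BijGroup])
  assume P: "subgroup P S"
  show "F P P \<subseteq> carrier (BijGroup P)" using aut_Bij[OF P] by (auto simp: BijGroup_def)
  show "F P P \<noteq> {}" using F_incl[OF P P] by auto
  fix \<alpha> \<beta> assume \<alpha>: "\<alpha> \<in> F P P"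
  show "inv\<^bsub>BijGroup P\<^esub> \<alpha> \<in> F P P"
    using F_image(3)[OF P P \<alpha>] aut_Bij[OF P \<alpha>] by (simp add: inv_BijGroup)
  assume \<beta>: "\<beta> \<in> F P P"
  show "\<alpha> \<otimes>\<^bsub>BijGroup P\<^esub> \<beta> \<in> F P P"
    using F_compose[OF P P P \<beta> \<alpha>] aut_Bij[OF P \<alpha>] aut_Bij[OF P \<beta>] by (simp add: BijGroup_def)
qed

lemma group_aut: "subgroup P S \<Longrightarrow> group (aut_group F P)"
  unfolding aut_group_def by (rule group.subgroup_imp_group[OF group_BijGroup aut_subgroup])

lemma carrier_aut [simp]: "carrier (aut_group F P) = F P P"
  by (simp add: aut_group_def)

lemma one_aut: "\<one>\<^bsub>aut_group F P\<^esub> = (\<lambda>x\<in>P. x)"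
  by (simp add: aut_group_def BijGroup_def)

lemma finite_aut: "subgroup P S \<Longrightarrow> finite (F P P)"
proof -
  assume P: "subgroup P S"
  have "F P P \<subseteq> (P \<rightarrow>\<^sub>E P)"
  proof
    fix \<alpha> assume "\<alpha> \<in> F P P"
    then have "\<alpha> \<in> extensional P" "\<alpha> ` P \<subseteq> P" using F_props(1,3)[OF P P] by auto
    then show "\<alpha> \<in> P \<rightarrow>\<^sub>E P" by (auto simp: PiE_iff)
  qed
  then show ?thesis using finite_subgroup[OF P] by (meson finite_PiE finite_subset)
qed

lemma aut_pow:
  assumes P: "subgroup P S" and \<alpha>: "\<alpha> \<in> F P P" and x: "x \<in> P"
  shows "(\<alpha> [^]\<^bsub>aut_group F P\<^esub> (n::nat)) x = (\<alpha> ^^ n) x"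
  using x
proof (induction n arbitrary: x)
  case 0
  then show ?case by (simp add: one_aut)
next
  case (Suc n)
  interpret A: group "aut_group F P" by (rule group_aut[OF P])
  have "\<alpha> [^]\<^bsub>aut_group F P\<^esub> n \<in> F P P" using A.nat_pow_closed[of \<alpha> n] \<alpha> by simp
  then have "(\<alpha> [^]\<^bsub>aut_group F P\<^esub> Suc n) x = (\<alpha> [^]\<^bsub>aut_group F P\<^esub> n) (\<alpha> x)"
    using aut_group_mult[OF P _ \<alpha>] Suc.prems by (simp add: compose_def)
  moreover have "\<alpha> x \<in> P" using aut_Bij(2)[OF P \<alpha>] Suc.prems by auto
  ultimately show ?case using Suc.IH by (simp add: funpow_swap1)
qed

lemma aut_pow_one_iff:
  assumes P: "subgroup P S" and \<alpha>: "\<alpha> \<in> F P P"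
  shows "\<alpha> [^]\<^bsub>aut_group F P\<^esub> (n::nat) = \<one>\<^bsub>aut_group F P\<^esub> \<longleftrightarrow> (\<forall>x\<in>P. (\<alpha> ^^ n) x = x)"
proof -
  interpret A: group "aut_group F P" by (rule group_aut[OF P])
  have "\<alpha> [^]\<^bsub>aut_group F P\<^esub> n \<in> F P P" using A.nat_pow_closed[of \<alpha> n] \<alpha> by simp
  then have "\<alpha> [^]\<^bsub>aut_group F P\<^esub> n \<in> extensional P" by (rule F_props(1)[OF P P])
  then have "\<alpha> [^]\<^bsub>aut_group F P\<^esub> n = (\<lambda>x\<in>P. x) \<longleftrightarrow> (\<forall>x\<in>P. (\<alpha> [^]\<^bsub>aut_group F P\<^esub> n) x = x)"
    by (auto intro: extensionalityI)
  then show ?thesis by (simp add: aut_pow[OF P \<alpha>] one_aut)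
qed

subsection \<open>The hyperfocal subgroup\<close>

text \<open>A substitute for the commutators of the residuals. It generates the same subgroup, is
  visibly monotone in the fusion system, and the finite order prime to \<open>p\<close> allows a
  telescoping product. The order is expressed by iterates, without the group structure on
  \<open>F P P\<close>.\<close>

definition p'_commutators :: "nat \<Rightarrow> 'a set" where
  "p'_commutators p = {inv x \<otimes> \<alpha> x | P x \<alpha>. subgroup P S \<and> x \<in> P \<and> \<alpha> \<in> F P P \<and>
     (\<exists>m. \<not> p dvd m \<and> (\<forall>y\<in>P. (\<alpha> ^^ m) y = y))}"

text \<open>In the quotient by the residual the class of \<alpha> is killed by a power of
  \<open>p\<close>. As \<alpha> itself is killed by \<open>m\<close>, Bezout makes it a power of an
  element of the residual.\<close>

lemma p'_in_p_residual:
  assumes p: "Factorial_Ring.prime p" and P: "subgroup P S" and \<alpha>: "\<alpha> \<in> F P P"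
    and m: "\<not> p dvd m" "\<forall>y\<in>P. (\<alpha> ^^ m) y = y"
  shows "\<alpha> \<in> p_residual p (aut_group F P)"
proof -
  let ?A = "aut_group F P"
  interpret A: group ?A by (rule group_aut[OF P])
  have finA: "finite (carrier ?A)" using finite_aut[OF P] by simp
  let ?N = "p_residual p ?A"
  have "normal_p_index p ?A ?N" by (rule p_residual_least(1)[OF A.is_group finA p])
  then obtain k where N: "?N \<lhd> ?A" and k: "card (rcosets\<^bsub>?A\<^esub> ?N) = p ^ k"
    by (auto simp: normal_p_index_def)
  interpret N: normal ?N ?A by (rule N)
  have \<alpha>c: "\<alpha> \<in> carrier ?A" using \<alpha> by simp
  have "?N #>\<^bsub>?A\<^esub> \<alpha> \<in> carrier (?A Mod ?N)" "order (?A Mod ?N) = p ^ k"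
    using A.rcosetsI[OF N.subset \<alpha>c] k by (simp_all add: order_def FactGroup_def)
  then have "(?N #>\<^bsub>?A\<^esub> \<alpha>) [^]\<^bsub>?A Mod ?N\<^esub> (p ^ k) = \<one>\<^bsub>?A Mod ?N\<^esub>"
    using group.pow_order_eq_1[OF N.factorgroup_is_group] by metis
  then have "?N #>\<^bsub>?A\<^esub> (\<alpha> [^]\<^bsub>?A\<^esub> (p ^ k)) = ?N" using N.FactGroup_pow[OF \<alpha>c] by simp
  then have inN: "\<alpha> [^]\<^bsub>?A\<^esub> (p ^ k) \<in> ?N"
    using A.rcos_self[OF A.nat_pow_closed[OF \<alpha>c] N.is_subgroup] by blast
  have one: "\<alpha> [^]\<^bsub>?A\<^esub> m = \<one>\<^bsub>?A\<^esub>" using aut_pow_one_iff[OF P \<alpha>] m(2) by simp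
  show ?thesis
  proof (cases "m = 1")
    case True
    then have "\<alpha> = \<one>\<^bsub>?A\<^esub>" using one \<alpha>c by simp
    then show ?thesis using subgroup.one_closed[OF N.is_subgroup] by simp
  next
    case False
    have "coprime (p ^ k) m" using p m(1) by (simp add: prime_imp_coprime)
    then obtain u v where uv: "p ^ k * u = m * v + 1"
      using bezout_nat[of "p ^ k" m] p by (auto simp: prime_gt_0_nat)
    have "(\<alpha> [^]\<^bsub>?A\<^esub> (p ^ k)) [^]\<^bsub>?A\<^esub> u = (\<alpha> [^]\<^bsub>?A\<^esub> m) [^]\<^bsub>?A\<^esub> v \<otimes>\<^bsub>?A\<^esub> \<alpha>"
      using \<alpha>c by (simp add: A.nat_pow_pow uv)
    also have "\<dots> = \<alpha>" using one \<alpha>c by simp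
    finally show ?thesis using A.subgroup_pow_closed[OF N.is_subgroup inN, of u] by simp
  qed
qed

end

lemma restrict_inv_into_image:
  assumes "inj_on f A" shows "(\<lambda>y\<in>f ` A. inv_into A f y) ` f ` A = A"
proof -
  have "(\<lambda>y\<in>f ` A. inv_into A f y) ` f ` A = inv_into A f ` f ` A" by (rule image_cong) auto
  then show ?thesis using inv_into_image_cancel[OF assms order_refl] by simp
qed

lemma (in group) conj_cancel:
  "\<lbrakk>u \<in> carrier G; x \<in> carrier G; y \<in> carrier G; u \<otimes> x \<otimes> inv u = u \<otimes> y \<otimes> inv u\<rbrakk> \<Longrightarrow> x = y"
  by simp

lemma (in group) generate_conj_closed:
  assumes A: "A \<subseteq> carrier G" and g: "g \<in> carrier G"
    and conj: "\<And>a. a \<in> A \<Longrightarrow> g \<otimes> a \<otimes> inv g \<in> generate G A"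
    and x: "x \<in> generate G A"
  shows "g \<otimes> x \<otimes> inv g \<in> generate G A"
  using x
proof (induction rule: generate.induct)
  case one
  then show ?case using g by (simp add: generate.one)
next
  case (incl a)
  then show ?case by (rule conj)
next
  case (inv a)
  then have "g \<otimes> inv a \<otimes> inv g = inv (g \<otimes> a \<otimes> inv g)"
    using A g by (auto simp: inv_mult_group m_assoc subset_eq)
  then show ?case using generate_m_inv_closed[OF A conj[OF inv]] by simp
next
  case (eng x y)
  have c: "x \<in> carrier G" "y \<in> carrier G" using eng A generate_in_carrier by auto
  have "g \<otimes> (x \<otimes> y) \<otimes> inv g = (g \<otimes> x \<otimes> inv g) \<otimes> (g \<otimes> y \<otimes> inv g)"
    using c g by (simp add: m_assoc)
  then show ?case using eng.IH by (simp add: generate.eng)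
qed

section \<open>The hyperfocal subgroup through automorphisms of order prime to p; extension
  domains\<close>

context fusion_cat
begin

lemma p'_commutators_carrier: "p'_commutators p \<subseteq> carrier S"
proof
  fix u assume "u \<in> p'_commutators p"
  then obtain P x \<alpha> where *: "subgroup P S" "x \<in> P" "\<alpha> \<in> F P P" "u = inv x \<otimes> \<alpha> x"
    by (auto simp: p'_commutators_def)
  then have "\<alpha> x \<in> P" using aut_Bij(2)[of P \<alpha>] by auto
  then show "u \<in> carrier S" using * by (simp add: subgroup.mem_carrier)
qed

lemma p_residual_subset:
  assumes p: "Factorial_Ring.prime p" and P: "subgroup P S"
  shows "p_residual p (aut_group F P) \<subseteq> F P P"
proof -
  interpret A: group "aut_group F P" by (rule group_aut[OF P])
  have "normal_p_index p (aut_group F P) (p_residual p (aut_group F P))"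
    by (rule p_residual_least(1)[OF A.is_group _ p]) (simp add: finite_aut[OF P])
  then show ?thesis
    using subgroup.subset[OF normal_imp_subgroup] by (fastforce simp: normal_p_index_def)
qed

text \<open>For the inclusion from left to right: the \<beta> in \<open>F P P\<close> with x^-1
  \<beta>(x) in \<open>?T\<close> for all x in \<open>P\<close> form a subgroup. It contains the
  automorphisms of order prime to \<open>p\<close>, hence the residual, which lies in the group they
  generate.\<close>

lemma hyperfocal_eq_p':
  assumes p: "Factorial_Ring.prime p"
  shows "hyperfocal p S F = generate S (p'_commutators p)"
proof
  let ?T = "generate S (p'_commutators p)"
  have T: "subgroup ?T S" by (rule generate_is_subgroup[OF p'_commutators_carrier])
  have gen: "inv x \<otimes> \<alpha> x \<in> ?T"
    if P: "subgroup P S" and \<alpha>: "\<alpha> \<in> p_residual p (aut_group F P)" and x: "x \<in> P" for P \<alpha> x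
  proof -
    interpret A: group "aut_group F P" by (rule group_aut[OF P])
    let ?E = "{a \<in> carrier (aut_group F P).
      \<exists>m. \<not> p dvd m \<and> a [^]\<^bsub>aut_group F P\<^esub> (m::nat) = \<one>\<^bsub>aut_group F P\<^esub>}"
    let ?B = "{\<beta> \<in> F P P. \<forall>x\<in>P. inv x \<otimes> \<beta> x \<in> ?T}"
    have Pc: "\<And>x. x \<in> P \<Longrightarrow> x \<in> carrier S" using P by (rule subgroup.mem_carrier)
    have cl: "\<And>\<beta> x. \<lbrakk>\<beta> \<in> F P P; x \<in> P\<rbrakk> \<Longrightarrow> \<beta> x \<in> P" using aut_Bij(2)[OF P] by blast
    have "subgroup ?B (aut_group F P)"
    proof (rule A.subgroupI)
      show "?B \<noteq> {}"
      proof -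
        have "(\<lambda>x\<in>P. x) \<in> ?B" using F_incl[OF P P] Pc by (simp add: generate.one)
        then show ?thesis by blast
      qed
      fix \<beta> \<gamma> assume \<beta>: "\<beta> \<in> ?B"
      have i: "inv\<^bsub>aut_group F P\<^esub> \<beta> \<in> F P P" using A.inv_closed[of \<beta>] \<beta> by simp
      have "inv x \<otimes> (inv\<^bsub>aut_group F P\<^esub> \<beta>) x \<in> ?T" if x: "x \<in> P" for x
      proof -
        let ?y = "(inv\<^bsub>aut_group F P\<^esub> \<beta>) x"
        have "\<beta> \<otimes>\<^bsub>aut_group F P\<^esub> inv\<^bsub>aut_group F P\<^esub> \<beta> = (\<lambda>x\<in>P. x)"
          using A.r_inv[of \<beta>] \<beta> by (simp add: one_aut)
        then have "\<beta> ?y = x"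
          using aut_group_mult[OF P, of \<beta> "inv\<^bsub>aut_group F P\<^esub> \<beta>"] i \<beta> x
          by (metis (no_types, lifting) compose_eq mem_Collect_eq restrict_apply')
        moreover have y: "?y \<in> P" using cl[OF i x] .
        ultimately have "inv ?y \<otimes> x \<in> ?T" using \<beta> by auto
        then have "inv (inv ?y \<otimes> x) \<in> ?T" by (rule subgroup.m_inv_closed[OF T])
        then show ?thesis using Pc x y by (simp add: inv_mult_group)
      qed
      then show "inv\<^bsub>aut_group F P\<^esub> \<beta> \<in> ?B" using i by simp
      assume \<gamma>: "\<gamma> \<in> ?B"
      have "inv x \<otimes> compose P \<beta> \<gamma> x \<in> ?T" if x: "x \<in> P" for x
      proof -
        have y: "\<gamma> x \<in> P" using cl x \<gamma> by simp
        have "inv x \<otimes> \<beta> (\<gamma> x) = (inv x \<otimes> \<gamma> x) \<otimes> (inv (\<gamma> x) \<otimes> \<beta> (\<gamma> x))"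
          using x y cl[of \<beta>] \<beta> Pc by (simp add: m_assoc)
        then show ?thesis using \<beta> \<gamma> x y T by (simp add: compose_def subgroup.m_closed)
      qed
      then show "\<beta> \<otimes>\<^bsub>aut_group F P\<^esub> \<gamma> \<in> ?B"
        using F_compose[OF P P P, of \<gamma> \<beta>] aut_group_mult[OF P] \<beta> \<gamma> by simp
    qed auto
    moreover have "?E \<subseteq> ?B"
    proof
      fix a assume a: "a \<in> ?E"
      then obtain m where m: "\<not> p dvd m" "\<forall>y\<in>P. (a ^^ m) y = y"
        using aut_pow_one_iff[OF P] by auto
      then have "\<And>x. x \<in> P \<Longrightarrow> inv x \<otimes> a x \<in> p'_commutators p"
        using P a by (auto simp: p'_commutators_def)
      then show "a \<in> ?B" using a by (auto intro: generate.incl)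
    qed
    ultimately have "generate (aut_group F P) ?E \<subseteq> ?B" by (intro A.generate_subgroup_incl)
    moreover have "\<alpha> \<in> generate (aut_group F P) ?E"
      using A.p_residual_subset_p'_generated[OF p] \<alpha> finite_aut[OF P] by auto
    ultimately show ?thesis using x by auto
  qed
  have "aut_commutator S P (p_residual p (aut_group F P)) \<subseteq> ?T" if P: "subgroup P S" for P
    unfolding aut_commutator_def by (rule generate_subgroup_incl[OF _ T]) (use gen[OF P] in auto)
  then show "hyperfocal p S F \<subseteq> ?T"
    unfolding hyperfocal_def by (intro generate_subgroup_incl[OF _ T]) auto
  have sub: "p'_commutators p \<subseteq> (\<Union>P\<in>{P. subgroup P S}. aut_commutator S P (p_residual p (aut_group F P)))"
  proof
    fix u assume "u \<in> p'_commutators p"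
    then obtain P x \<alpha> where *: "subgroup P S" "x \<in> P" "\<alpha> \<in> p_residual p (aut_group F P)"
      "u = inv x \<otimes> \<alpha> x"
      using p'_in_p_residual[OF p] unfolding p'_commutators_def by blast
    then have "u \<in> aut_commutator S P (p_residual p (aut_group F P))"
      unfolding aut_commutator_def by (intro generate.incl) blast
    then show "u \<in> (\<Union>P\<in>{P. subgroup P S}. aut_commutator S P (p_residual p (aut_group F P)))"
      using *(1) by blast
  qed
  then show "?T \<subseteq> hyperfocal p S F"
    unfolding hyperfocal_def by (rule mono_generate)
qed

lemma hyperfocal_subgroup: "Factorial_Ring.prime p \<Longrightarrow> subgroup (hyperfocal p S F) S"
  by (simp add: hyperfocal_eq_p' generate_is_subgroup[OF p'_commutators_carrier])

lemma hyperfocal_residual: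
  assumes p: "Factorial_Ring.prime p" and P: "subgroup P S"
    and \<alpha>: "\<alpha> \<in> p_residual p (aut_group F P)" and x: "x \<in> P"
  shows "inv x \<otimes> \<alpha> x \<in> hyperfocal p S F"
proof -
  have "inv x \<otimes> \<alpha> x \<in> aut_commutator S P (p_residual p (aut_group F P))"
    unfolding aut_commutator_def by (rule generate.incl) (use \<alpha> x in auto)
  then show ?thesis unfolding hyperfocal_def using P by (auto intro: generate.incl)
qed

text \<open>Conjugation by g carries an automorphism of \<open>P\<close> of order prime to
  \<open>p\<close> to one of g P g^-1 with the same property, so it maps generators to
  generators.\<close>

lemma hyperfocal_conj:
  assumes p: "Factorial_Ring.prime p" and g: "g \<in> carrier S" and t: "t \<in> hyperfocal p S F"
  shows "g \<otimes> t \<otimes> inv g \<in> hyperfocal p S F"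
  using t unfolding hyperfocal_eq_p'[OF p]
proof (rule generate_conj_closed[OF p'_commutators_carrier g, rotated])
  fix u assume "u \<in> p'_commutators p"
  then obtain P x \<alpha> m where P: "subgroup P S" and x: "x \<in> P" and \<alpha>: "\<alpha> \<in> F P P"
    and u: "u = inv x \<otimes> \<alpha> x" and m: "\<not> p dvd m" "\<forall>y\<in>P. (\<alpha> ^^ m) y = y"
    by (auto simp: p'_commutators_def)
  let ?c = "conj_map S g P" and ?d = "conj_map S (inv g) (conj_map S g P ` P)"
  let ?Q = "?c ` P"
  have Pc: "\<And>x. x \<in> P \<Longrightarrow> x \<in> carrier S" using P by (rule subgroup.mem_carrier)
  have cl: "\<And>x. x \<in> P \<Longrightarrow> \<alpha> x \<in> P" using aut_Bij(2)[OF P \<alpha>] by blast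
  have c: "?c \<in> hom_S P" by (rule conj_map_hom[OF P g])
  have Q: "subgroup ?Q S" by (rule hom_S_image[OF P c])
  have d: "?d \<in> hom_S ?Q" using conj_map_hom[OF Q] g by simp
  have dc: "?d (?c y) = y" if "y \<in> P" for y
  proof -
    have "?c y \<in> ?Q" using that by blast
    then have "?d (?c y) = inv g \<otimes> ?c y \<otimes> inv (inv g)" by (simp add: conj_map_def[of S "inv g"])
    moreover have "?c y = g \<otimes> y \<otimes> inv g" using that by (simp add: conj_map_def)
    ultimately show ?thesis using g Pc[OF that] by (simp only: m_assoc) (simp add: m_assoc)
  qed
  have dQ: "?d ` ?Q = P" using dc by (force simp: image_image)
  have \<alpha>': "\<alpha> \<in> hom_S P" by (rule F_to_S[OF P P \<alpha>])
  let ?\<beta> = "compose ?Q ?c (compose ?Q \<alpha> ?d)"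
  have ad: "compose ?Q \<alpha> ?d \<in> hom_S ?Q" by (rule hom_S_compose[OF Q d P \<alpha>']) (simp add: dQ)
  have adP: "compose ?Q \<alpha> ?d ` ?Q \<subseteq> P" using dQ cl by (auto simp: compose_def)
  have \<beta>S: "?\<beta> \<in> hom_S ?Q" by (rule hom_S_compose[OF Q ad P c adP])
  have "?\<beta> ` ?Q \<subseteq> ?Q" using adP by (auto simp: compose_def)
  then have \<beta>: "?\<beta> \<in> F ?Q ?Q" by (rule hom_S_to[OF Q \<beta>S Q])
  have \<beta>c: "?\<beta> (?c y) = ?c (\<alpha> y)" if "y \<in> P" for y
    using that dc[OF that] by (simp add: compose_def)
  have "(?\<beta> ^^ n) (?c y) = ?c ((\<alpha> ^^ n) y) \<and> (\<alpha> ^^ n) y \<in> P" if "y \<in> P" for y n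
    by (induction n) (use that \<beta>c cl in auto)
  then have "\<forall>y\<in>?Q. (?\<beta> ^^ m) y = y" using m(2) by auto
  moreover have "g \<otimes> u \<otimes> inv g = inv (?c x) \<otimes> ?\<beta> (?c x)"
    using \<beta>c[OF x] x cl[OF x] Pc g by (simp add: u conj_map_def inv_mult_group m_assoc)
  ultimately have "g \<otimes> u \<otimes> inv g \<in> p'_commutators p"
    using Q \<beta> x m(1) unfolding p'_commutators_def by blast
  then show "g \<otimes> u \<otimes> inv g \<in> generate S (p'_commutators p)" by (rule generate.incl)
qed

lemma fully_normalized_carrier: "fully_normalized S F (carrier S)"
proof -
  have "R = carrier S" if R: "subgroup R S" "fus_conjugate F (carrier S) R" for R
  proof -
    obtain \<psi> where \<psi>: "\<psi> \<in> hom_S (carrier S)" "\<psi> ` carrier S = R"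
      using R(2) fus_conjugate_iff[OF subgroup_self R(1)] by blast
    then have "card R = card (carrier S)" using hom_S_inj[OF subgroup_self \<psi>(1)] card_image by metis
    then show ?thesis using subgroup.subset[OF R(1)] fin by (simp add: card_subset_eq)
  qed
  then show ?thesis unfolding fully_normalized_def by auto
qed

text \<open>The condition on \<phi> c_g \<phi>^-1 without the inverse map: under \<phi>, conjugation
  by g on \<open>P\<close> must become conjugation by some h in \<open>S\<close>.\<close>

lemma extension_domain_iff:
  assumes P: "subgroup P S" and \<phi>: "\<phi> \<in> hom_S P"
  shows "g \<in> extension_domain S P \<phi> \<longleftrightarrow>
    g \<in> normalizer S P \<and> (\<exists>h\<in>carrier S. \<forall>x\<in>P. \<phi> (g \<otimes> x \<otimes> inv g) = h \<otimes> \<phi> x \<otimes> inv h)"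
proof (cases "g \<in> normalizer S P")
  case True
  then have gP: "\<And>x. x \<in> P \<Longrightarrow> g \<otimes> x \<otimes> inv g \<in> P"
    using normalizer_iff[OF P finite_subgroup[OF P]] by blast
  let ?f = "\<lambda>y\<in>\<phi> ` P. \<phi> (conj_map S g P (inv_into P \<phi> y))"
  have f: "?f (\<phi> x) = \<phi> (g \<otimes> x \<otimes> inv g)" if "x \<in> P" for x
    using that hom_S_inj[OF P \<phi>] by (simp add: conj_map_def)
  have "?f \<in> conj_hom S (\<phi> ` P) (\<phi> ` P) \<longleftrightarrow>
      (\<exists>h\<in>carrier S. \<forall>x\<in>P. \<phi> (g \<otimes> x \<otimes> inv g) = h \<otimes> \<phi> x \<otimes> inv h)"
  proof
    assume "?f \<in> conj_hom S (\<phi> ` P) (\<phi> ` P)"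
    then obtain h where h: "h \<in> carrier S" "?f = conj_map S h (\<phi> ` P)"
      by (auto simp: conj_hom_def)
    have "\<phi> (g \<otimes> x \<otimes> inv g) = h \<otimes> \<phi> x \<otimes> inv h" if "x \<in> P" for x
      using f[OF that] fun_cong[OF h(2), of "\<phi> x"] that by (simp add: conj_map_def)
    then show "\<exists>h\<in>carrier S. \<forall>x\<in>P. \<phi> (g \<otimes> x \<otimes> inv g) = h \<otimes> \<phi> x \<otimes> inv h" using h(1) by blast
  next
    assume "\<exists>h\<in>carrier S. \<forall>x\<in>P. \<phi> (g \<otimes> x \<otimes> inv g) = h \<otimes> \<phi> x \<otimes> inv h"
    then obtain h where h: "h \<in> carrier S" "\<forall>x\<in>P. \<phi> (g \<otimes> x \<otimes> inv g) = h \<otimes> \<phi> x \<otimes> inv h" by blast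
    have eq: "?f = conj_map S h (\<phi> ` P)"
    proof
      fix y show "?f y = conj_map S h (\<phi> ` P) y"
      proof (cases "y \<in> \<phi> ` P")
        case True
        then obtain x where x: "x \<in> P" "y = \<phi> x" by blast
        have "conj_map S h (\<phi> ` P) y = h \<otimes> \<phi> x \<otimes> inv h" using x by (simp add: conj_map_def)
        then show ?thesis using f[OF x(1)] h(2) x by simp
      qed (simp add: conj_map_def)
    qed
    have "conj_map S h (\<phi> ` P) ` \<phi> ` P \<subseteq> \<phi> ` P"
      using h(2) gP by (auto simp: conj_map_def) (metis imageI)
    then show "?f \<in> conj_hom S (\<phi> ` P) (\<phi> ` P)" using eq h(1) unfolding conj_hom_def by blast
  qed
  then show ?thesis using True by (simp add: extension_domain_def)
qed (simp add: extension_domain_def)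

lemma subgroup_extension_domain:
  assumes P: "subgroup P S" and \<phi>: "\<phi> \<in> hom_S P"
  shows "subgroup (extension_domain S P \<phi>) S" "P \<subseteq> extension_domain S P \<phi>"
proof -
  let ?N = "extension_domain S P \<phi>"
  have N: "subgroup (normalizer S P) S" by (rule subgroup_normalizer[OF P])
  have Nc: "\<And>g. g \<in> normalizer S P \<Longrightarrow> g \<in> carrier S" using N by (rule subgroup.mem_carrier)
  have gP: "\<And>g x. \<lbrakk>g \<in> normalizer S P; x \<in> P\<rbrakk> \<Longrightarrow> g \<otimes> x \<otimes> inv g \<in> P"
    using normalizer_iff[OF P finite_subgroup[OF P]] by blast
  have Pc: "\<And>x. x \<in> P \<Longrightarrow> x \<in> carrier S" using P by (rule subgroup.mem_carrier)
  show PN: "P \<subseteq> ?N"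
  proof
    fix g assume g: "g \<in> P"
    have "\<phi> (g \<otimes> x \<otimes> inv g) = \<phi> g \<otimes> \<phi> x \<otimes> inv (\<phi> g)" if "x \<in> P" for x
      using g that P by (simp add: hom_S_mult[OF P \<phi>] hom_S_inv[OF P \<phi>] subgroup.m_closed subgroup.m_inv_closed)
    then show "g \<in> ?N"
      using g subset_normalizer[OF P finite_subgroup[OF P]] hom_S_closed[OF P \<phi> g]
      by (auto simp: extension_domain_iff[OF P \<phi>])
  qed
  show "subgroup ?N S"
  proof (rule subgroupI)
    show "?N \<subseteq> carrier S" using Nc by (auto simp: extension_domain_iff[OF P \<phi>])
    show "?N \<noteq> {}" using PN subgroup.one_closed[OF P] by blast
    fix a b assume "a \<in> ?N"
    then obtain h where a: "a \<in> normalizer S P" and h: "h \<in> carrier S"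
      "\<And>x. x \<in> P \<Longrightarrow> \<phi> (a \<otimes> x \<otimes> inv a) = h \<otimes> \<phi> x \<otimes> inv h"
      by (auto simp: extension_domain_iff[OF P \<phi>])
    have ia: "inv a \<in> normalizer S P" using N a by (rule subgroup.m_inv_closed)
    have "\<phi> (inv a \<otimes> x \<otimes> inv (inv a)) = inv h \<otimes> \<phi> x \<otimes> inv (inv h)" if x: "x \<in> P" for x
    proof -
      let ?z = "inv a \<otimes> x \<otimes> inv (inv a)"
      have z: "?z \<in> P" using gP[OF ia x] .
      have "a \<otimes> ?z \<otimes> inv a = x" using a Nc Pc[OF x] by (simp add: m_assoc)
      then have "\<phi> x = h \<otimes> \<phi> ?z \<otimes> inv h" using h(2)[OF z] by simp
      then show ?thesis using h(1) hom_S_closed[OF P \<phi> z] by (simp add: m_assoc)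
    qed
    then show "inv a \<in> ?N" using ia h(1) unfolding extension_domain_iff[OF P \<phi>] by blast
    assume "b \<in> ?N"
    then obtain k where b: "b \<in> normalizer S P" and k: "k \<in> carrier S"
      "\<And>x. x \<in> P \<Longrightarrow> \<phi> (b \<otimes> x \<otimes> inv b) = k \<otimes> \<phi> x \<otimes> inv k"
      by (auto simp: extension_domain_iff[OF P \<phi>])
    have "\<phi> ((a \<otimes> b) \<otimes> x \<otimes> inv (a \<otimes> b)) = (h \<otimes> k) \<otimes> \<phi> x \<otimes> inv (h \<otimes> k)" if x: "x \<in> P" for x
    proof -
      have "(a \<otimes> b) \<otimes> x \<otimes> inv (a \<otimes> b) = a \<otimes> (b \<otimes> x \<otimes> inv b) \<otimes> inv a"
        using a b Nc Pc[OF x] by (simp add: inv_mult_group m_assoc)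
      then show ?thesis
        using h(2)[OF gP[OF b x]] k(2)[OF x] h(1) k(1) hom_S_closed[OF P \<phi> x]
        by (simp add: inv_mult_group m_assoc)
    qed
    moreover have "a \<otimes> b \<in> normalizer S P" using N a b by (rule subgroup.m_closed)
    ultimately show "a \<otimes> b \<in> ?N"
      unfolding extension_domain_iff[OF P \<phi>] using h(1) k(1) by (metis m_closed)
  qed
qed

end

section \<open>Saturated fusion systems modulo the hyperfocal subgroup\<close>

locale saturated_fusion = fusion_cat +
  fixes p n :: nat
  assumes p: "Factorial_Ring.prime p" and ord: "order S = p ^ n" and sat: "saturated p S F"
begin

lemma fully_normalized_sylow:
  "\<lbrakk>subgroup P S; fully_normalized S F P\<rbrakk> \<Longrightarrow>
    fully_centralized S F P \<and> sylow_subgroup p (conj_hom S P P) (aut_group F P)"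
  using sat unfolding saturated_def by blast

lemma extend:
  assumes "subgroup P S" "\<phi> \<in> hom_S P" "fully_normalized S F (\<phi> ` P)"
  obtains \<psi> where "\<psi> \<in> hom_S (extension_domain S P \<phi>)" "\<And>x. x \<in> P \<Longrightarrow> \<psi> x = \<phi> x"
proof -
  have "fully_centralized S F (\<phi> ` P)"
    using fully_normalized_sylow[OF hom_S_image[OF assms(1,2)] assms(3)] by blast
  then obtain \<psi> where \<psi>: "\<psi> \<in> hom_S (extension_domain S P \<phi>)" "restrict \<psi> P = \<phi>"
    using sat assms(1,2) unfolding saturated_def by blast
  show thesis using that[OF \<psi>(1)] \<psi>(2) by auto
qed

text \<open>The new morphism need not agree with \<phi> on \<open>P\<close>; only the image is kept.
  N_S(P) acts on R = \<phi>(P) through \<phi> c_g \<phi>^-1, a p-group of automorphisms which some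
  \<open>a\<close> in Aut_F(R) conjugates into the Sylow subgroup Aut_S(R). After this correction
  the extension domain of a \<circ> \<phi> is all of N_S(P).\<close>

lemma extend_normalizer:
  assumes P: "subgroup P S" and \<phi>: "\<phi> \<in> hom_S P" and fn: "fully_normalized S F (\<phi> ` P)"
  obtains \<gamma> where "\<gamma> \<in> hom_S (normalizer S P)" "\<gamma> ` P = \<phi> ` P"
proof -
  let ?R = "\<phi> ` P" and ?N = "normalizer S P"
  have R: "subgroup ?R S" by (rule hom_S_image[OF P \<phi>])
  have N: "subgroup ?N S" by (rule subgroup_normalizer[OF P])
  have Nc: "\<And>g. g \<in> ?N \<Longrightarrow> g \<in> carrier S" using N by (rule subgroup.mem_carrier)
  have gP: "\<And>g x. \<lbrakk>g \<in> ?N; x \<in> P\<rbrakk> \<Longrightarrow> g \<otimes> x \<otimes> inv g \<in> P"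
    using normalizer_iff[OF P finite_subgroup[OF P]] by blast
  have Pc: "\<And>x. x \<in> P \<Longrightarrow> x \<in> carrier S" using P by (rule subgroup.mem_carrier)
  interpret A: group "aut_group F ?R" by (rule group_aut[OF R])
  let ?i = "\<lambda>y\<in>?R. inv_into P \<phi> y"
  have i: "?i \<in> hom_S ?R" by (rule hom_S_inverse[OF P \<phi>])
  have iR: "?i ` ?R = P" by (rule restrict_inv_into_image[OF hom_S_inj[OF P \<phi>]])
  define h where "h g = compose ?R \<phi> (compose ?R (conj_map S g P) ?i)" for g
  have h\<phi>: "h g (\<phi> x) = \<phi> (g \<otimes> x \<otimes> inv g)" if "x \<in> P" for g x
    using that hom_S_inj[OF P \<phi>] by (simp add: h_def compose_def conj_map_def)
  have hF: "h g \<in> F ?R ?R" if g: "g \<in> ?N" for g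
  proof -
    have 1: "compose ?R (conj_map S g P) ?i \<in> hom_S ?R"
      by (rule hom_S_compose[OF R i P conj_map_hom[OF P Nc[OF g]]]) (simp only: iR order_refl)
    have 2: "compose ?R (conj_map S g P) ?i ` ?R \<subseteq> P"
      using iR gP[OF g] by (auto simp: compose_def conj_map_def)
    have "h g \<in> hom_S ?R" unfolding h_def by (rule hom_S_compose[OF R 1 P \<phi> 2])
    moreover have "h g ` ?R \<subseteq> ?R" using gP[OF g] by (auto simp: h\<phi>)
    ultimately show ?thesis by (intro hom_S_to[OF R _ R])
  qed
  have gN: "group (S\<lparr>carrier := ?N\<rparr>)" using N by (rule subgroup_imp_group)
  obtain k where k: "card ?N = p ^ k" using p_group_subgroup_card[OF p ord N] .
  have hh: "h \<in> hom (S\<lparr>carrier := ?N\<rparr>) (aut_group F ?R)"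
  proof (rule homI)
    fix g assume "g \<in> carrier (S\<lparr>carrier := ?N\<rparr>)"
    then show "h g \<in> carrier (aut_group F ?R)" using hF by simp
  next
    fix g g' assume "g \<in> carrier (S\<lparr>carrier := ?N\<rparr>)" "g' \<in> carrier (S\<lparr>carrier := ?N\<rparr>)"
    then have g: "g \<in> ?N" "g' \<in> ?N" by auto
    have gg: "g \<otimes> g' \<in> ?N" using subgroup.m_closed[OF N g] .
    have "h (g \<otimes> g') = compose ?R (h g) (h g')"
    proof (rule extensionalityI[of _ ?R])
      show "h (g \<otimes> g') \<in> extensional ?R" "compose ?R (h g) (h g') \<in> extensional ?R"
        by (auto simp: h_def compose_def)
      fix y assume "y \<in> ?R"
      then obtain x where x: "x \<in> P" "y = \<phi> x" by blast
      have "g \<otimes> g' \<otimes> x \<otimes> inv (g \<otimes> g') = g \<otimes> (g' \<otimes> x \<otimes> inv g') \<otimes> inv g"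
        using g Nc Pc[OF x(1)] by (simp add: inv_mult_group m_assoc)
      then show "h (g \<otimes> g') y = compose ?R (h g) (h g') y"
        using x gP[OF g(2) x(1)] by (simp add: compose_def h\<phi>)
    qed
    then show "h (g \<otimes>\<^bsub>S\<lparr>carrier := ?N\<rparr>\<^esub> g') = h g \<otimes>\<^bsub>aut_group F ?R\<^esub> h g'"
      using aut_group_mult[OF R hF[OF g(1)] hF[OF g(2)]] by simp
  qed
  have "order (S\<lparr>carrier := ?N\<rparr>) = p ^ k" using k by (simp add: order_def)
  moreover have "sylow_subgroup p (conj_hom S ?R ?R) (aut_group F ?R)"
    using fully_normalized_sylow[OF R fn] by blast
  moreover have "finite (carrier (aut_group F ?R))" using finite_aut[OF R] by simp
  ultimately obtain a where a: "a \<in> F ?R ?R"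
    and ac: "\<And>g. g \<in> ?N \<Longrightarrow> a \<otimes>\<^bsub>aut_group F ?R\<^esub> h g \<otimes>\<^bsub>aut_group F ?R\<^esub> inv\<^bsub>aut_group F ?R\<^esub> a \<in> conj_hom S ?R ?R"
    using A.sylow_absorbs_p_image[OF p _ gN _ hh] by auto
  have aS: "a \<in> hom_S ?R" by (rule F_to_S[OF R R a])
  have aR: "a ` ?R = ?R" by (rule aut_Bij(2)[OF R a])
  let ?\<psi> = "compose P a \<phi>"
  have \<psi>: "?\<psi> \<in> hom_S P" by (rule hom_S_compose[OF P \<phi> R aS]) simp
  have \<psi>P: "?\<psi> ` P = ?R" using aR by (auto simp: compose_def)
  have ext: "extension_domain S P ?\<psi> = ?N"
  proof -
    have "\<exists>k\<in>carrier S. \<forall>x\<in>P. ?\<psi> (g \<otimes> x \<otimes> inv g) = k \<otimes> ?\<psi> x \<otimes> inv k" if g: "g \<in> ?N" for g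
    proof -
      obtain k where k: "k \<in> carrier S"
        "a \<otimes>\<^bsub>aut_group F ?R\<^esub> h g \<otimes>\<^bsub>aut_group F ?R\<^esub> inv\<^bsub>aut_group F ?R\<^esub> a = conj_map S k ?R"
        using ac[OF g] by (auto simp: conj_hom_def)
      have cF: "conj_map S k ?R \<in> F ?R ?R"
        using F_conj_hom[OF R R] ac[OF g] k(2) by simp
      have "a \<otimes>\<^bsub>aut_group F ?R\<^esub> h g = conj_map S k ?R \<otimes>\<^bsub>aut_group F ?R\<^esub> a"
        using a hF[OF g] unfolding k(2)[symmetric] carrier_aut[symmetric]
        by (simp add: A.m_assoc del: carrier_aut)
      then have "compose ?R a (h g) = compose ?R (conj_map S k ?R) a"
        using aut_group_mult[OF R] a hF[OF g] cF by simp
      then have *: "a (h g y) = conj_map S k ?R (a y)" if "y \<in> ?R" for y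
        using that by (metis compose_eq)
      have "?\<psi> (g \<otimes> x \<otimes> inv g) = k \<otimes> ?\<psi> x \<otimes> inv k" if x: "x \<in> P" for x
      proof -
        have "a (\<phi> x) \<in> ?R" using aR x by blast
        then show ?thesis using *[of "\<phi> x"] x gP[OF g x] by (simp add: compose_def h\<phi> conj_map_def)
      qed
      then show ?thesis using k(1) by blast
    qed
    then show ?thesis using extension_domain_iff[OF P \<psi>] by blast
  qed
  obtain \<gamma> where \<gamma>: "\<gamma> \<in> hom_S (extension_domain S P ?\<psi>)" "\<And>x. x \<in> P \<Longrightarrow> \<gamma> x = ?\<psi> x"
    using extend[OF P \<psi>] fn \<psi>P by metis
  show thesis
  proof (rule that)
    show "\<gamma> \<in> hom_S ?N" using \<gamma>(1) unfolding ext .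
    show "\<gamma> ` P = ?R" using \<gamma>(2) \<psi>P by (metis image_cong)
  qed
qed

abbreviation T :: "'a set" where "T \<equiv> hyperfocal p S F"

lemma T_subgroup: "subgroup T S" by (rule hyperfocal_subgroup[OF p])

lemma T_conj: "\<lbrakk>g \<in> carrier S; t \<in> T\<rbrakk> \<Longrightarrow> g \<otimes> t \<otimes> inv g \<in> T" by (rule hyperfocal_conj[OF p])

lemma T_normal: "T \<lhd> S" using T_subgroup T_conj by (simp add: normal_inv_iff)

definition inner_mod_T :: "'a set \<Rightarrow> ('a \<Rightarrow> 'a) \<Rightarrow> bool" where
  "inner_mod_T P \<phi> \<longleftrightarrow> (\<exists>g\<in>carrier S. \<forall>x\<in>P. T #> \<phi> x = T #> (g \<otimes> x \<otimes> inv g))"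

text \<open>Aut_F(P) is the product of its residual and the Sylow subgroup Aut_S(P). The first
  factor moves elements only within cosets of \<open>T\<close>, the second acts by
  conjugation.\<close>

lemma aut_inner_mod_T:
  assumes P: "subgroup P S" and fn: "fully_normalized S F P" and \<alpha>: "\<alpha> \<in> F P P"
  shows "inner_mod_T P \<alpha>"
proof -
  let ?A = "aut_group F P" and ?C = "conj_hom S P P"
  let ?O = "p_residual p ?A"
  interpret A: group ?A by (rule group_aut[OF P])
  have finA: "finite (carrier ?A)" using finite_aut[OF P] by simp
  have syl: "subgroup ?C ?A" "card ?C = p ^ multiplicity p (order ?A)"
    using fully_normalized_sylow[OF P fn] by (auto simp: sylow_subgroup_def)
  obtain k where O: "?O \<lhd> ?A" and k: "card (rcosets\<^bsub>?A\<^esub> ?O) = p ^ k"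
    using p_residual_least(1)[OF A.is_group finA p] by (auto simp: normal_p_index_def)
  have sO: "subgroup ?O ?A" using O by (rule normal_imp_subgroup)
  interpret I: second_isomorphism_grp ?O ?A ?C
    using O syl by (simp add: second_isomorphism_grp_def second_isomorphism_grp_axioms_def)
  have sOC: "subgroup (?O <#>\<^bsub>?A\<^esub> ?C) ?A" by (rule I.normal_set_mult_subgroup)
  \<comment> \<open>The prime-to-p part of the order divides |?O| because \<open>?O\<close> has
    p-power index; the p-part is the order of the Sylow subgroup.\<close>
  have "order ?A dvd card (?O <#>\<^bsub>?A\<^esub> ?C)"
  proof -
    have pos: "order ?A > 0" using finA by (simp add: A.order_gt_0_iff_finite)
    have lag: "p ^ k * card ?O = order ?A" using A.lagrange[OF sO] k by simp
    have 1: "card ?O dvd card (?O <#>\<^bsub>?A\<^esub> ?C)"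
      by (rule A.card_subgroup_dvd'[OF sO sOC I.H_contained_in_set_mult])
    have 2: "p ^ multiplicity p (order ?A) dvd card (?O <#>\<^bsub>?A\<^esub> ?C)"
      using A.card_subgroup_dvd'[OF syl(1) sOC I.S_contained_in_set_mult] syl(2) by simp
    obtain r where r: "order ?A = p ^ multiplicity p (order ?A) * r" "\<not> p dvd r"
      using multiplicity_decompose'[of "order ?A" p] pos p not_prime_unit by blast
    have "coprime (p ^ k) r" using r(2) p by (simp add: prime_imp_coprime)
    moreover have "r dvd p ^ k * card ?O" using lag r(1) by (metis dvd_triv_right)
    ultimately have "r dvd card ?O"
      by (metis coprime_commute coprime_dvd_mult_right_iff)
    then have "r dvd card (?O <#>\<^bsub>?A\<^esub> ?C)" using 1 dvd_trans by blast
    moreover have "coprime (p ^ multiplicity p (order ?A)) r" using r(2) p by (simp add: prime_imp_coprime)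
    ultimately show ?thesis using 2 r(1) divides_mult by metis
  qed
  then have "card (carrier ?A) \<le> card (?O <#>\<^bsub>?A\<^esub> ?C)"
    using A.card_subgroup_pos[OF sOC finA] by (simp add: order_def dvd_imp_le)
  then have "?O <#>\<^bsub>?A\<^esub> ?C = carrier ?A"
    using subgroup.subset[OF sOC] finA by (simp add: card_seteq)
  then have "\<alpha> \<in> ?O <#>\<^bsub>?A\<^esub> ?C" using \<alpha> by simp
  then obtain o' c where oc: "o' \<in> ?O" "c \<in> ?C" "\<alpha> = o' \<otimes>\<^bsub>?A\<^esub> c" by (auto simp: set_mult_def)
  obtain g where g: "g \<in> carrier S" "c = conj_map S g P" "conj_map S g P ` P \<subseteq> P"
    using oc(2) by (auto simp: conj_hom_def)
  have "c \<in> F P P" "o' \<in> F P P"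
    using F_conj_hom[OF P P oc(2)] oc(1) p_residual_subset[OF p P] by auto
  then have \<alpha>eq: "\<alpha> = compose P o' c" using aut_group_mult[OF P] oc(3) by simp
  have "T #> \<alpha> x = T #> (g \<otimes> x \<otimes> inv g)" if x: "x \<in> P" for x
  proof -
    let ?y = "g \<otimes> x \<otimes> inv g"
    have y: "?y \<in> P" using g(3) x by (auto simp: conj_map_def)
    have o'y: "o' ?y \<in> P" using y aut_Bij(2)[OF P \<open>o' \<in> F P P\<close>] by blast
    have yc: "?y \<in> carrier S" "o' ?y \<in> carrier S" using y o'y subgroup.mem_carrier[OF P] by auto
    have "inv ?y \<otimes> o' ?y \<in> T" by (rule hyperfocal_residual[OF p P oc(1) y])
    \<comment> \<open>Turns the left quotient y^-1 o'(y) into the right quotient that right cosets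
      require.\<close>
    then have "?y \<otimes> (inv ?y \<otimes> o' ?y) \<otimes> inv ?y \<in> T" by (rule T_conj[OF yc(1)])
    then have "o' ?y \<otimes> inv ?y \<in> T" using yc by (simp only: inv_mult_cancel inv_closed)
    then have "T #> o' ?y = T #> ?y" using rcos_eq_iff[OF T_subgroup yc(2,1)] by blast
    then show ?thesis using x by (simp add: \<alpha>eq compose_def g(2) conj_map_def)
  qed
  then show ?thesis using g(1) unfolding inner_mod_T_def by blast
qed

text \<open>Induction from large to small subgroups, in the manner of Alperin's fusion theorem.
  \<open>P\<close> and \<phi>(P) are both sent to a fully normalized R by morphisms defined on their
  normalizers, which are strictly larger unless P = S. What is left of \<phi> is an automorphism of
  R, and the conjugating elements of the three pieces combine.\<close>

lemma hom_inner_mod_T: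
  "\<lbrakk>subgroup P S; \<phi> \<in> hom_S P\<rbrakk> \<Longrightarrow> inner_mod_T P \<phi>"
proof (induction "card (carrier S) - card P" arbitrary: P \<phi> rule: less_induct)
  case less
  note P = less.prems(1) and \<phi> = less.prems(2)
  interpret T: normal T S by (rule T_normal)
  interpret R: group "S Mod T" by (rule T.factorgroup_is_group)
  interpret \<pi>: group_hom S "S Mod T" "\<lambda>x. T #> x"
    using T.r_coset_hom_Mod by (simp add: group_hom_def group_hom_axioms_def is_group R.is_group)
  have bigger: "inner_mod_T (normalizer S Q) \<psi>"
    if Q: "subgroup Q S" "card Q = card P" "Q \<noteq> carrier S" and \<psi>: "\<psi> \<in> hom_S (normalizer S Q)" for Q \<psi>
  proof (rule less.hyps[OF _ subgroup_normalizer[OF Q(1)] \<psi>])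
    have N: "normalizer S Q \<subseteq> carrier S" using subgroup_normalizer[OF Q(1)] by (rule subgroup.subset)
    have "Q \<subset> normalizer S Q" by (rule normalizer_grows[OF p fin ord Q(1,3)])
    then have "card P < card (normalizer S Q)"
      using Q(2) N fin by (metis finite_subset psubset_card_mono)
    moreover have "card (normalizer S Q) \<le> card (carrier S)" using N fin by (rule card_mono[rotated])
    ultimately show "card (carrier S) - card (normalizer S Q) < card (carrier S) - card P" by simp
  qed
  let ?Q = "\<phi> ` P"
  have Q: "subgroup ?Q S" by (rule hom_S_image[OF P \<phi>])
  have cQ: "card ?Q = card P" using hom_S_inj[OF P \<phi>] by (rule card_image)
  have Pc: "\<And>x. x \<in> P \<Longrightarrow> x \<in> carrier S" using P by (rule subgroup.mem_carrier)
  have Qc: "\<And>x. x \<in> P \<Longrightarrow> \<phi> x \<in> carrier S" by (rule hom_S_closed[OF P \<phi>])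
  show ?case
  proof (cases "P = carrier S")
    case True
    show ?thesis using aut_inner_mod_T[OF subgroup_self fully_normalized_carrier] \<phi> True by simp
  next
    case False
    have Qn: "?Q \<noteq> carrier S" using cQ False subgroup.subset[OF P] fin by (metis card_subset_eq)
    obtain \<theta> where \<theta>: "\<theta> \<in> hom_S P" and fn: "fully_normalized S F (\<theta> ` P)"
      using ex_fully_normalized[OF P] by blast
    let ?R = "\<theta> ` P"
    have R: "subgroup ?R S" by (rule hom_S_image[OF P \<theta>])
    have "?R \<in> fcls ?Q" using fcls_image[OF P \<phi>] \<theta> by (auto simp: fcls_def)
    then obtain \<theta>' where \<theta>': "\<theta>' \<in> hom_S ?Q" "\<theta>' ` ?Q = ?R" by (auto simp: fcls_def)
    obtain \<gamma> where \<gamma>: "\<gamma> \<in> hom_S (normalizer S P)" "\<gamma> ` P = ?R"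
      using extend_normalizer[OF P \<theta> fn] .
    obtain \<gamma>' where \<gamma>': "\<gamma>' \<in> hom_S (normalizer S ?Q)" "\<gamma>' ` ?Q = ?R"
      using extend_normalizer[OF Q \<theta>'(1)] fn \<theta>'(2) by metis
    have PN: "P \<subseteq> normalizer S P" and QN: "?Q \<subseteq> normalizer S ?Q"
      using subset_normalizer P Q finite_subgroup by auto
    let ?g = "restrict \<gamma> P" and ?g' = "restrict \<gamma>' ?Q"
    have rg: "?g \<in> hom_S P"
      by (rule hom_S_restrict[OF subgroup_normalizer[OF P] \<gamma>(1) P PN])
    have rg': "?g' \<in> hom_S ?Q"
      by (rule hom_S_restrict[OF subgroup_normalizer[OF Q] \<gamma>'(1) Q QN])
    have gim: "?g ` P = ?R" using \<gamma>(2) by simp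
    let ?i = "\<lambda>y\<in>?g ` P. inv_into P ?g y"
    have i: "?i \<in> hom_S ?R" using hom_S_inverse[OF P rg] gim by simp
    have iR: "?i ` ?R = P" using restrict_inv_into_image[OF hom_S_inj[OF P rg]] by (simp only: gim)
    have a1: "compose ?R \<phi> ?i \<in> hom_S ?R" by (rule hom_S_compose[OF R i P \<phi>]) (simp only: iR order_refl)
    have "compose ?R \<phi> ?i ` ?R = \<phi> ` ?i ` ?R"
      unfolding image_image by (rule image_cong) (auto simp: compose_def)
    then have a1Q: "compose ?R \<phi> ?i ` ?R = ?Q" by (simp only: iR)
    \<comment> \<open>This is \<gamma>' \<phi> \<gamma>^-1 on \<open>?R\<close>, so that \<phi> =
      \<gamma>'^-1 \<alpha> \<gamma> on \<open>P\<close>.\<close>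
    let ?\<alpha> = "compose ?R ?g' (compose ?R \<phi> ?i)"
    have "?\<alpha> \<in> hom_S ?R" by (rule hom_S_compose[OF R a1 Q rg']) (simp only: a1Q order_refl)
    moreover have "?\<alpha> ` ?R \<subseteq> ?R"
    proof -
      have e: "?\<alpha> ` ?R = ?g' ` compose ?R \<phi> ?i ` ?R"
        unfolding image_image by (rule image_cong) (auto simp: compose_def)
      show ?thesis unfolding e a1Q using \<gamma>'(2) by simp
    qed
    ultimately have \<alpha>: "?\<alpha> \<in> F ?R ?R" by (rule hom_S_to[OF R _ R])
    have \<alpha>\<gamma>: "?\<alpha> (\<gamma> x) = \<gamma>' (\<phi> x)" if "x \<in> P" for x
    proof -
      have "\<gamma> x \<in> ?R" using \<gamma>(2) that by blast
      moreover have "inv_into P ?g (?g x) = x" by (rule inv_into_f_f[OF hom_S_inj[OF P rg] that])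
      ultimately show ?thesis using that gim by (simp add: compose_def)
    qed
    obtain a where a: "a \<in> carrier S" "\<And>x. x \<in> ?R \<Longrightarrow> T #> ?\<alpha> x = T #> (a \<otimes> x \<otimes> inv a)"
      using aut_inner_mod_T[OF R fn \<alpha>] unfolding inner_mod_T_def by blast
    obtain g where g: "g \<in> carrier S" "\<And>x. x \<in> normalizer S P \<Longrightarrow> T #> \<gamma> x = T #> (g \<otimes> x \<otimes> inv g)"
      using bigger[OF P refl False \<gamma>(1)] unfolding inner_mod_T_def by blast
    obtain g' where g': "g' \<in> carrier S"
      "\<And>x. x \<in> normalizer S ?Q \<Longrightarrow> T #> \<gamma>' x = T #> (g' \<otimes> x \<otimes> inv g')"
      using bigger[OF Q cQ Qn \<gamma>'(1)] unfolding inner_mod_T_def by blast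
    let ?\<pi> = "\<lambda>x. T #> x" and ?R' = "S Mod T"
    have conj: "?\<pi> (u \<otimes> x \<otimes> inv u) = ?\<pi> u \<otimes>\<^bsub>?R'\<^esub> ?\<pi> x \<otimes>\<^bsub>?R'\<^esub> inv\<^bsub>?R'\<^esub> ?\<pi> u"
      if "u \<in> carrier S" "x \<in> carrier S" for u x
      using that \<pi>.hom_mult[of "u \<otimes> x" "inv u"] \<pi>.hom_mult[of u x] \<pi>.hom_inv[of u] by simp
    \<comment> \<open>The element belonging to \<gamma>'^-1 \<alpha> \<gamma>: conjugation by g,
      then by a, then by the inverse of g'.\<close>
    let ?b = "inv g' \<otimes> (a \<otimes> g)"
    have b: "?b \<in> carrier S" using a g g' by simp
    have "?\<pi> (\<phi> x) = ?\<pi> (?b \<otimes> x \<otimes> inv ?b)" if x: "x \<in> P" for x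
    proof -
      have "\<gamma> x \<in> \<gamma> ` P" using x by (rule imageI)
      then have \<gamma>x: "\<gamma> x \<in> ?R" "\<gamma> x \<in> carrier S" using subgroup.mem_carrier[OF R] by (simp_all add: \<gamma>(2))
      have \<gamma>g: "?\<pi> (\<gamma> x) = ?\<pi> (g \<otimes> x \<otimes> inv g)" using g(2) PN x by blast
      have "?\<pi> (g' \<otimes> \<phi> x \<otimes> inv g') = ?\<pi> (\<gamma>' (\<phi> x))" using g'(2)[of "\<phi> x"] QN x by auto
      also have "\<dots> = ?\<pi> (a \<otimes> \<gamma> x \<otimes> inv a)" using a(2)[OF \<gamma>x(1)] \<alpha>\<gamma>[OF x] by simp
      also have "\<dots> = ?\<pi> (a \<otimes> (g \<otimes> x \<otimes> inv g) \<otimes> inv a)"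
        using conj[OF a(1) \<gamma>x(2)] conj[OF a(1), of "g \<otimes> x \<otimes> inv g"] \<gamma>g g(1) Pc[OF x] by simp
      also have "a \<otimes> (g \<otimes> x \<otimes> inv g) \<otimes> inv a = g' \<otimes> (?b \<otimes> x \<otimes> inv ?b) \<otimes> inv g'"
        using a(1) g(1) g'(1) Pc[OF x] by (simp add: inv_mult_group m_assoc)
      finally have "?\<pi> g' \<otimes>\<^bsub>?R'\<^esub> ?\<pi> (\<phi> x) \<otimes>\<^bsub>?R'\<^esub> inv\<^bsub>?R'\<^esub> ?\<pi> g' =
          ?\<pi> g' \<otimes>\<^bsub>?R'\<^esub> ?\<pi> (?b \<otimes> x \<otimes> inv ?b) \<otimes>\<^bsub>?R'\<^esub> inv\<^bsub>?R'\<^esub> ?\<pi> g'"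
        using conj[OF g'(1) Qc[OF x]] conj[OF g'(1), of "?b \<otimes> x \<otimes> inv ?b"] b Pc[OF x]
        by (metis inv_closed m_closed)
      then show ?thesis
        using b Pc[OF x]
        by (intro R.conj_cancel[OF \<pi>.hom_closed[OF g'(1)] \<pi>.hom_closed[OF Qc[OF x]] \<pi>.hom_closed]) auto
    qed
    then show ?thesis using b unfolding inner_mod_T_def by blast
  qed
qed

end

section \<open>Twisted diagonals\<close>

context saturated_fusion
begin

text \<open>The stabilizer in S \<times> S of a point of the transitive biset attached to (P,
  \<phi>). The image stands in the first coordinate and the source in the second, so the transfer
  from \<open>P\<close> to \<open>S\<close> takes place in the second.\<close>

definition diag :: "'a set \<Rightarrow> ('a \<Rightarrow> 'a) \<Rightarrow> ('a \<times> 'a) set" where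
  "diag P \<phi> = (\<lambda>x. (\<phi> x, x)) ` P"

definition diags :: "('a \<times> 'a) set set" where
  "diags = {diag P \<phi> | P \<phi>. subgroup P S \<and> \<phi> \<in> hom_S P}"

text \<open>The second projection suffices: as \<phi> is an isomorphism in F onto its image,
  applying its inverse to the first coordinate gives the untwisted diagonal of the source. Hence
  this is the class of \<open>D\<close> under morphisms of F in both coordinates.\<close>

definition dcls :: "('a \<times> 'a) set \<Rightarrow> 'a set set" where
  "dcls D = fcls (snd ` D)"

text \<open>One choice per class: the untwisted diagonal of a fully normalized subgroup, where the
  Sylow and extension properties are available.\<close>

definition drep :: "('a \<times> 'a) set \<Rightarrow> ('a \<times> 'a) set" where
  "drep D = (\<lambda>x. (x, x)) ` (SOME Q. Q \<in> dcls D \<and> fully_normalized S F Q)"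

lemma diag_proj [simp]: "snd ` diag P \<phi> = P" "fst ` diag P \<phi> = \<phi> ` P"
  by (auto simp: diag_def image_image)

lemma card_diag: "card (diag P \<phi>) = card P"
  unfolding diag_def by (rule card_image) (auto simp: inj_on_def)

lemma diagsI: "\<lbrakk>subgroup P S; \<phi> \<in> hom_S P\<rbrakk> \<Longrightarrow> diag P \<phi> \<in> diags"
  by (auto simp: diags_def)

lemma diagsE:
  assumes "D \<in> diags" obtains P \<phi> where "D = diag P \<phi>" "subgroup P S" "\<phi> \<in> hom_S P"
  using assms by (auto simp: diags_def)

text \<open>The image is the twisted diagonal of \<beta> \<phi> \<alpha>^-1 on \<alpha>(P), and its
  source is F-conjugate to \<open>P\<close>.\<close>

lemma diags_map:
  assumes D: "D \<in> diags"
    and Q: "subgroup Q S" "fst ` D \<subseteq> Q" "\<beta> \<in> hom_S Q"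
    and R: "subgroup R S" "snd ` D \<subseteq> R" "\<alpha> \<in> hom_S R"
  shows "map_prod \<beta> \<alpha> ` D \<in> diags" "dcls (map_prod \<beta> \<alpha> ` D) = dcls D"
proof -
  obtain P \<phi> where D_eq: "D = diag P \<phi>" and P: "subgroup P S" and \<phi>: "\<phi> \<in> hom_S P"
    using D by (rule diagsE)
  have PR: "P \<subseteq> R" and PQ: "\<phi> ` P \<subseteq> Q" using Q(2) R(2) D_eq by auto
  let ?a = "restrict \<alpha> P"
  have a: "?a \<in> hom_S P" by (rule hom_S_restrict[OF R(1,3) P PR])
  let ?i = "\<lambda>y\<in>?a ` P. inv_into P ?a y"
  have i: "?i \<in> hom_S (?a ` P)" by (rule hom_S_inverse[OF P a])
  have aP: "subgroup (?a ` P) S" by (rule hom_S_image[OF P a])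
  have i_im: "?i ` ?a ` P = P" by (rule restrict_inv_into_image[OF hom_S_inj[OF P a]])
  have \<beta>\<phi>: "compose P \<beta> \<phi> \<in> hom_S P" by (rule hom_S_compose[OF P \<phi> Q(1,3) PQ])
  let ?\<psi> = "compose (?a ` P) (compose P \<beta> \<phi>) ?i"
  have \<psi>: "?\<psi> \<in> hom_S (?a ` P)"
    by (rule hom_S_compose[OF aP i P \<beta>\<phi>]) (simp only: i_im order_refl)
  have "map_prod \<beta> \<alpha> ` D = (\<lambda>x. (\<beta> (\<phi> x), \<alpha> x)) ` P" by (auto simp: D_eq diag_def)
  also have "\<dots> = (\<lambda>x. (?\<psi> (?a x), ?a x)) ` P"
  proof (rule image_cong[OF refl])
    fix x assume x: "x \<in> P"
    have "inv_into P ?a (?a x) = x" by (rule inv_into_f_f[OF hom_S_inj[OF P a] x])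
    then show "(\<beta> (\<phi> x), \<alpha> x) = (?\<psi> (?a x), ?a x)" using x by (simp add: compose_def)
  qed
  also have "\<dots> = diag (?a ` P) ?\<psi>" unfolding diag_def image_image ..
  finally have eq: "map_prod \<beta> \<alpha> ` D = diag (?a ` P) ?\<psi>" .
  show "map_prod \<beta> \<alpha> ` D \<in> diags" unfolding eq by (rule diagsI[OF aP \<psi>])
  show "dcls (map_prod \<beta> \<alpha> ` D) = dcls D"
    unfolding eq dcls_def diag_proj(1) using fcls_image[OF P a] by (simp add: D_eq)
qed

lemma diag_subgroup:
  assumes P: "subgroup P S" and \<phi>: "\<phi> \<in> hom_S P" shows "subgroup (diag P \<phi>) (S \<times>\<times> S)"
proof (rule group.subgroupI[OF DirProd_group[OF is_group is_group]])
  show "diag P \<phi> \<subseteq> carrier (S \<times>\<times> S)"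
    using hom_S_closed[OF P \<phi>] subgroup.mem_carrier[OF P] by (auto simp: diag_def)
  show "diag P \<phi> \<noteq> {}" using subgroup.one_closed[OF P] by (auto simp: diag_def)
  fix a b assume a: "a \<in> diag P \<phi>"
  then obtain x where x: "x \<in> P" "a = (\<phi> x, x)" by (auto simp: diag_def)
  show "inv\<^bsub>S \<times>\<times> S\<^esub> a \<in> diag P \<phi>"
    using x hom_S_inv[OF P \<phi> x(1)] hom_S_closed[OF P \<phi> x(1)] P
    by (auto simp: diag_def inv_DirProd is_group subgroup.mem_carrier subgroup.m_inv_closed
        intro!: image_eqI[of _ _ "inv x"])
  assume b: "b \<in> diag P \<phi>"
  then obtain y where y: "y \<in> P" "b = (\<phi> y, y)" by (auto simp: diag_def)
  show "a \<otimes>\<^bsub>S \<times>\<times> S\<^esub> b \<in> diag P \<phi>"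
    using x y hom_S_mult[OF P \<phi> x(1) y(1)] P by (auto simp: diag_def subgroup.m_closed
        intro!: image_eqI[of _ _ "x \<otimes> y"])
qed

lemma diags_subgroup: "D \<in> diags \<Longrightarrow> subgroup D (S \<times>\<times> S)"
  by (auto elim!: diagsE intro: diag_subgroup)

lemma conj_set_DirProd:
  assumes "a \<in> carrier S" "b \<in> carrier S"
  shows "conj_set (S \<times>\<times> S) (a, b) D = (\<lambda>(x, y). (a \<otimes> x \<otimes> inv a, b \<otimes> y \<otimes> inv b)) ` D"
  unfolding conj_set_def
  by (rule image_cong[OF refl]) (use assms in \<open>auto simp: inv_DirProd is_group split: prod.split\<close>)

lemma diags_conj:
  assumes D: "D \<in> diags" and g: "g \<in> carrier (S \<times>\<times> S)"
  shows "conj_set (S \<times>\<times> S) g D \<in> diags" "dcls (conj_set (S \<times>\<times> S) g D) = dcls D"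
proof -
  obtain a b where ab: "g = (a, b)" "a \<in> carrier S" "b \<in> carrier S" using g by auto
  have sub: "D \<subseteq> carrier S \<times> carrier S" using diags_subgroup[OF D] subgroup.subset by fastforce
  have "conj_set (S \<times>\<times> S) g D = map_prod (conj_map S a (carrier S)) (conj_map S b (carrier S)) ` D"
    unfolding ab(1) conj_set_DirProd[OF ab(2,3)]
    by (rule image_cong[OF refl]) (use sub in \<open>auto simp: conj_map_def\<close>)
  then show "conj_set (S \<times>\<times> S) g D \<in> diags" "dcls (conj_set (S \<times>\<times> S) g D) = dcls D"
    using diags_map[OF D subgroup_self _ conj_map_hom[OF subgroup_self ab(2)]
        subgroup_self _ conj_map_hom[OF subgroup_self ab(3)]] sub by fastforce+
qed

lemma diags_sub:
  assumes D: "D \<in> diags" and E: "subgroup E (S \<times>\<times> S)" "E \<subseteq> D" shows "E \<in> diags"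
proof -
  obtain P \<phi> where D_eq: "D = diag P \<phi>" and P: "subgroup P S" and \<phi>: "\<phi> \<in> hom_S P"
    using D by (rule diagsE)
  have EP: "snd ` E \<subseteq> P" using E(2) D_eq diag_proj(1)[of P \<phi>] by blast
  have SE: "subgroup (snd ` E) S"
  proof -
    interpret s: group_hom "S \<times>\<times> S" S snd
      using DirProd_group[OF is_group is_group]
      by (auto simp: group_hom_def group_hom_axioms_def is_group hom_def)
    show ?thesis by (rule s.subgroup_img_is_subgroup[OF E(1)])
  qed
  have "E = diag (snd ` E) (restrict \<phi> (snd ` E))"
    using E(2) unfolding D_eq diag_def by (force simp: image_iff)
  then show ?thesis using diagsI[OF SE hom_S_restrict[OF P \<phi> SE EP]] by simp
qed

lemma drep_props:
  assumes P: "subgroup P S"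
  obtains Q \<theta> where "fully_normalized S F Q" "\<theta> \<in> hom_S P" "\<theta> ` P = Q"
    "\<And>\<phi>. drep (diag P \<phi>) = (\<lambda>x. (x, x)) ` Q"
proof -
  define Q where "Q = (SOME Q. Q \<in> fcls P \<and> fully_normalized S F Q)"
  have "\<exists>Q. Q \<in> fcls P \<and> fully_normalized S F Q"
    using ex_fully_normalized[OF P] by (auto simp: fcls_def)
  then have "Q \<in> fcls P \<and> fully_normalized S F Q" unfolding Q_def by (rule someI_ex)
  then obtain \<theta> where "fully_normalized S F Q" "\<theta> \<in> hom_S P" "\<theta> ` P = Q" by (auto simp: fcls_def)
  then show thesis by (rule that) (simp add: drep_def dcls_def Q_def)
qed

lemma diag_id: "subgroup Q S \<Longrightarrow> (\<lambda>x. (x, x)) ` Q \<in> diags"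
  using diagsI[OF _ F_incl[OF _ subgroup_self], of Q] subgroup.subset[of Q S]
  by (simp add: diag_def cong: image_cong)

text \<open>Normalizing the twisted diagonal forces \<phi> c_b = c_a \<phi> on \<open>P\<close>,
  which is the shape of the condition in an extension domain.\<close>

lemma diags_normalizer:
  assumes P: "subgroup P S" and \<phi>: "\<phi> \<in> hom_S P" and g: "(a, b) \<in> normalizer (S \<times>\<times> S) (diag P \<phi>)"
  shows "a \<in> normalizer S (\<phi> ` P)" "b \<in> normalizer S P"
    "x \<in> P \<Longrightarrow> \<phi> (b \<otimes> x \<otimes> inv b) = a \<otimes> \<phi> x \<otimes> inv a"
proof -
  interpret G: group "S \<times>\<times> S" by (rule DirProd_group[OF is_group is_group])
  have sD: "subgroup (diag P \<phi>) (S \<times>\<times> S)" by (rule diag_subgroup[OF P \<phi>])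
  have fD: "finite (diag P \<phi>)" by (simp add: diag_def finite_subgroup[OF P])
  have N: "(a, b) \<in> carrier (S \<times>\<times> S)"
    "\<And>z. z \<in> diag P \<phi> \<Longrightarrow> (a, b) \<otimes>\<^bsub>S \<times>\<times> S\<^esub> z \<otimes>\<^bsub>S \<times>\<times> S\<^esub> inv\<^bsub>S \<times>\<times> S\<^esub> (a, b) \<in> diag P \<phi>"
    using g G.normalizer_iff[OF sD fD] by auto
  have ab: "a \<in> carrier S" "b \<in> carrier S" using N(1) by auto
  have *: "(a \<otimes> \<phi> x \<otimes> inv a, b \<otimes> x \<otimes> inv b) \<in> diag P \<phi>" if "x \<in> P" for x
  proof -
    have "(\<phi> x, x) \<in> diag P \<phi>" using that by (auto simp: diag_def)
    from N(2)[OF this] show ?thesis using ab by (simp add: inv_DirProd is_group)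
  qed
  then have **: "b \<otimes> x \<otimes> inv b \<in> P \<and> \<phi> (b \<otimes> x \<otimes> inv b) = a \<otimes> \<phi> x \<otimes> inv a" if "x \<in> P" for x
    using that by (fastforce simp: diag_def)
  show "b \<in> normalizer S P" using ** ab(2) by (simp add: normalizer_iff[OF P finite_subgroup[OF P]])
  have "a \<otimes> y \<otimes> inv a \<in> \<phi> ` P" if y: "y \<in> \<phi> ` P" for y
  proof -
    obtain x where x: "x \<in> P" "y = \<phi> x" using y by blast
    then have "a \<otimes> y \<otimes> inv a = \<phi> (b \<otimes> x \<otimes> inv b)" "b \<otimes> x \<otimes> inv b \<in> P" using **[OF x(1)] by auto
    then show ?thesis by simp
  qed
  then show "a \<in> normalizer S (\<phi> ` P)"
    using ab(1) by (simp add: normalizer_iff[OF hom_S_image[OF P \<phi>] finite_subgroup[OF hom_S_image[OF P \<phi>]]])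
  show "x \<in> P \<Longrightarrow> \<phi> (b \<otimes> x \<otimes> inv b) = a \<otimes> \<phi> x \<otimes> inv a" using ** by blast
qed

text \<open>The map is the pair (\<gamma>, \<epsilon>). A morphism \<gamma> on N_S(\<phi>(P))
  carries \<phi>(P) to the fully normalized R. Then e = \<gamma> \<phi> turns conjugation by b into
  conjugation by \<gamma>(a) whenever (a, b) normalizes \<open>D\<close>, so every such b lies in
  the extension domain of e, and \<epsilon> extends e to it. On \<open>D\<close> both coordinates
  become e(x). Twisted diagonals are preserved and reflected because \<gamma> and \<epsilon> are
  morphisms of F with inverses on their images.\<close>

lemma diags_transport:
  assumes D: "D \<in> diags"
  shows "\<exists>\<rho>\<in>hom ((S \<times>\<times> S)\<lparr>carrier := normalizer (S \<times>\<times> S) D\<rparr>) (S \<times>\<times> S).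
      inj_on \<rho> (normalizer (S \<times>\<times> S) D) \<and> \<rho> ` D = drep D \<and>
      (\<forall>E. subgroup E (S \<times>\<times> S) \<and> D \<subseteq> E \<and> E \<subseteq> normalizer (S \<times>\<times> S) D \<longrightarrow>
        (E \<in> diags \<longleftrightarrow> \<rho> ` E \<in> diags) \<and> (E \<in> diags \<longrightarrow> dcls (\<rho> ` E) = dcls E))"
proof -
  obtain P \<phi> where D_eq: "D = diag P \<phi>" and P: "subgroup P S" and \<phi>: "\<phi> \<in> hom_S P"
    using D by (rule diagsE)
  let ?Q = "\<phi> ` P" and ?M = "normalizer (S \<times>\<times> S) D"
  have Q: "subgroup ?Q S" by (rule hom_S_image[OF P \<phi>])
  obtain R \<theta> where R: "fully_normalized S F R" "\<theta> \<in> hom_S P" "\<theta> ` P = R"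
    and rep: "drep (diag P \<phi>) = (\<lambda>x. (x, x)) ` R"
    using drep_props[OF P] by metis
  have "R \<in> fcls ?Q" using fcls_image[OF P \<phi>] R by (auto simp: fcls_def)
  then obtain \<theta>' where \<theta>': "\<theta>' \<in> hom_S ?Q" "\<theta>' ` ?Q = R" by (auto simp: fcls_def)
  obtain \<gamma> where \<gamma>: "\<gamma> \<in> hom_S (normalizer S ?Q)" "\<gamma> ` ?Q = R"
    using extend_normalizer[OF Q \<theta>'(1)] R(1) \<theta>'(2) by metis
  have NQ: "subgroup (normalizer S ?Q) S" by (rule subgroup_normalizer[OF Q])
  have QN: "?Q \<subseteq> normalizer S ?Q" by (rule subset_normalizer[OF Q finite_subgroup[OF Q]])
  let ?e = "compose P \<gamma> \<phi>"
  have e: "?e \<in> hom_S P" by (rule hom_S_compose[OF P \<phi> NQ \<gamma>(1) QN])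
  have eR: "?e ` P = R" using \<gamma>(2) by (auto simp: compose_def)
  let ?X = "extension_domain S P ?e"
  have X: "subgroup ?X S" by (rule subgroup_extension_domain(1)[OF P e])
  obtain \<epsilon> where \<epsilon>: "\<epsilon> \<in> hom_S ?X" "\<And>x. x \<in> P \<Longrightarrow> \<epsilon> x = ?e x"
    using extend[OF P e] R(1) eR by metis
  have N1: "a \<in> normalizer S ?Q" and N2: "b \<in> ?X" if ab: "(a, b) \<in> ?M" for a b
  proof -
    note n = diags_normalizer[OF P \<phi> ab[unfolded D_eq]]
    show a: "a \<in> normalizer S ?Q" by (rule n(1))
    have "?e (b \<otimes> x \<otimes> inv b) = \<gamma> a \<otimes> ?e x \<otimes> inv (\<gamma> a)" if x: "x \<in> P" for x
    proof -
      have "b \<otimes> x \<otimes> inv b \<in> P" using n(2) x normalizer_iff[OF P finite_subgroup[OF P]] by blast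
      moreover have "\<phi> x \<in> normalizer S ?Q" using QN x by blast
      ultimately show ?thesis
        using x a n(3)[OF x] NQ
        by (simp add: compose_def hom_S_mult[OF NQ \<gamma>(1)] hom_S_inv[OF NQ \<gamma>(1)] subgroup.m_closed subgroup.m_inv_closed)
    qed
    then show "b \<in> ?X"
      using n(2) hom_S_closed[OF NQ \<gamma>(1) a] extension_domain_iff[OF P e] by blast
  qed
  let ?\<rho> = "map_prod \<gamma> \<epsilon>"
  show ?thesis
  proof (intro bexI conjI allI impI)
    show "?\<rho> \<in> hom ((S \<times>\<times> S)\<lparr>carrier := ?M\<rparr>) (S \<times>\<times> S)"
    proof (rule homI)
      fix x assume "x \<in> carrier ((S \<times>\<times> S)\<lparr>carrier := ?M\<rparr>)"
      then show "?\<rho> x \<in> carrier (S \<times>\<times> S)"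
        using N1 N2 hom_S_closed[OF NQ \<gamma>(1)] hom_S_closed[OF X \<epsilon>(1)] by (cases x) auto
    next
      fix x y assume "x \<in> carrier ((S \<times>\<times> S)\<lparr>carrier := ?M\<rparr>)" "y \<in> carrier ((S \<times>\<times> S)\<lparr>carrier := ?M\<rparr>)"
      then show "?\<rho> (x \<otimes>\<^bsub>(S \<times>\<times> S)\<lparr>carrier := ?M\<rparr>\<^esub> y) = ?\<rho> x \<otimes>\<^bsub>S \<times>\<times> S\<^esub> ?\<rho> y"
        using N1 N2 hom_S_mult[OF NQ \<gamma>(1)] hom_S_mult[OF X \<epsilon>(1)] by (cases x; cases y) auto
    qed
    show "inj_on ?\<rho> ?M"
    proof (rule inj_onI)
      fix x y assume "x \<in> ?M" "y \<in> ?M" "?\<rho> x = ?\<rho> y"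
      then show "x = y"
        using N1 N2 hom_S_inj[OF NQ \<gamma>(1)] hom_S_inj[OF X \<epsilon>(1)]
        by (cases x; cases y) (auto dest: inj_onD)
    qed
    have "?\<rho> ` D = (\<lambda>x. (?e x, ?e x)) ` P"
      unfolding D_eq diag_def image_image
      by (rule image_cong[OF refl]) (simp add: \<epsilon>(2) compose_def)
    also have "\<dots> = (\<lambda>x. (x, x)) ` ?e ` P" by (simp add: image_image)
    finally show "?\<rho> ` D = drep D" unfolding eR rep[symmetric] D_eq .
    fix E assume E: "subgroup E (S \<times>\<times> S) \<and> D \<subseteq> E \<and> E \<subseteq> ?M"
    have EQ: "fst ` E \<subseteq> normalizer S ?Q" and EX: "snd ` E \<subseteq> ?X" using E N1 N2 by fastforce+
    have fwd: "?\<rho> ` E \<in> diags" "dcls (?\<rho> ` E) = dcls E" if "E \<in> diags"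
      using diags_map[OF that NQ EQ \<gamma>(1) X EX \<epsilon>(1)] by auto
    then show "E \<in> diags \<Longrightarrow> dcls (?\<rho> ` E) = dcls E" by blast
    have "E \<in> diags" if E': "?\<rho> ` E \<in> diags"
    proof -
      let ?ig = "\<lambda>y\<in>\<gamma> ` normalizer S ?Q. inv_into (normalizer S ?Q) \<gamma> y"
        and ?ie = "\<lambda>y\<in>\<epsilon> ` ?X. inv_into ?X \<epsilon> y"
      have "map_prod ?ig ?ie ` ?\<rho> ` E \<in> diags"
      proof (rule diags_map(1)[OF E' hom_S_image[OF NQ \<gamma>(1)] _ hom_S_inverse[OF NQ \<gamma>(1)]
            hom_S_image[OF X \<epsilon>(1)] _ hom_S_inverse[OF X \<epsilon>(1)]])
        show "fst ` ?\<rho> ` E \<subseteq> \<gamma> ` normalizer S ?Q" using EQ by (auto simp: image_subset_iff)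
        show "snd ` ?\<rho> ` E \<subseteq> \<epsilon> ` ?X" using EX by (auto simp: image_subset_iff)
      qed
      moreover have "map_prod ?ig ?ie ` ?\<rho> ` E = E"
      proof -
        have "map_prod ?ig ?ie (?\<rho> z) = z" if "z \<in> E" for z
        proof (cases z)
          case (Pair a b)
          then have "a \<in> normalizer S ?Q" "b \<in> ?X" using that E N1 N2 by auto
          then show ?thesis
            using Pair hom_S_inj[OF NQ \<gamma>(1)] hom_S_inj[OF X \<epsilon>(1)] by simp
        qed
        then show ?thesis by (force simp: image_image)
      qed
      ultimately show ?thesis by simp
    qed
    then show "E \<in> diags \<longleftrightarrow> ?\<rho> ` E \<in> diags" using fwd by blast
  qed
qed

sublocale fam: twisted_family "S \<times>\<times> S" diags drep dcls
proof -
  interpret G: group "S \<times>\<times> S" by (rule DirProd_group[OF is_group is_group])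
  show "twisted_family (S \<times>\<times> S) diags drep dcls"
  proof (rule twisted_family.intro[OF G.is_group twisted_family_axioms.intro])
    show "finite (carrier (S \<times>\<times> S))" using fin by simp
    fix D assume D: "D \<in> diags"
    then obtain P \<phi> where D_eq: "D = diag P \<phi>" and P: "subgroup P S" and \<phi>: "\<phi> \<in> hom_S P"
      by (rule diagsE)
    obtain R \<theta> where R: "\<theta> \<in> hom_S P" "\<theta> ` P = R" "drep (diag P \<phi>) = (\<lambda>x. (x, x)) ` R"
      using drep_props[OF P] by metis
    show "drep D \<in> diags" using diag_id[OF hom_S_image[OF P R(1)]] R D_eq by simp
    have "card (drep D) = card R" unfolding D_eq R(3) by (rule card_image) (auto simp: inj_on_def)
    then show "card (drep D) = card D"
      using card_image[OF hom_S_inj[OF P R(1)]] R(2) D_eq card_diag by simp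
    show "subgroup D (S \<times>\<times> S)" using D by (rule diags_subgroup)
    show "\<exists>\<rho>\<in>hom ((S \<times>\<times> S)\<lparr>carrier := normalizer (S \<times>\<times> S) D\<rparr>) (S \<times>\<times> S).
      inj_on \<rho> (normalizer (S \<times>\<times> S) D) \<and> \<rho> ` D = drep D \<and>
      (\<forall>E. subgroup E (S \<times>\<times> S) \<and> D \<subseteq> E \<and> E \<subseteq> normalizer (S \<times>\<times> S) D \<longrightarrow>
        (E \<in> diags \<longleftrightarrow> \<rho> ` E \<in> diags) \<and> (E \<in> diags \<longrightarrow> dcls (\<rho> ` E) = dcls E))"
      using D by (rule diags_transport)
  next
    fix D E assume "D \<in> diags" "subgroup E (S \<times>\<times> S)" "E \<subseteq> D"
    then show "E \<in> diags" by (rule diags_sub)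
  next
    fix D E :: "('a \<times> 'a) set" assume "dcls D = dcls E"
    then show "drep D = drep E" by (simp add: drep_def)
  next
    fix D g assume Dg: "D \<in> diags" "g \<in> carrier (S \<times>\<times> S)"
    show "conj_set (S \<times>\<times> S) g D \<in> diags" by (rule diags_conj(1)[OF Dg])
    show "dcls (conj_set (S \<times>\<times> S) g D) = dcls D" by (rule diags_conj(2)[OF Dg])
  qed
qed

end

section \<open>Transfer\<close>

text \<open>Characters with values in the integers modulo m, kept as integer functions: only
  additivity is a congruence, so sums over orbits of the biset stay exact and factors divisible by
  \<open>p\<close> can be cancelled in them.\<close>

definition mod_hom :: "('a, 'b) monoid_scheme \<Rightarrow> int \<Rightarrow> 'a set \<Rightarrow> ('a \<Rightarrow> int) \<Rightarrow> bool" where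
  "mod_hom G m P d \<longleftrightarrow> (\<forall>x\<in>P. \<forall>y\<in>P. [d (x \<otimes>\<^bsub>G\<^esub> y) = d x + d y] (mod m))"

text \<open>The transversal behind the transfer is chosen by \<open>SOME\<close>; cosets are nonempty.\<close>

definition coset_rep :: "'a set \<Rightarrow> 'a" where "coset_rep B = (SOME b. b \<in> B)"

definition left_cosets :: "('a, 'b) monoid_scheme \<Rightarrow> 'a set \<Rightarrow> 'a set set" where
  "left_cosets G P = (\<lambda>b. b <#\<^bsub>G\<^esub> P) ` carrier G"

text \<open>If b and b' represent the cosets \<open>B\<close> and s B, this is b'^-1 s b, an element
  of \<open>P\<close> and a cocycle in s.\<close>

definition transfer_arg :: "('a, 'b) monoid_scheme \<Rightarrow> 'a \<Rightarrow> 'a set \<Rightarrow> 'a" where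
  "transfer_arg G s B = inv\<^bsub>G\<^esub> (coset_rep (s <#\<^bsub>G\<^esub> B)) \<otimes>\<^bsub>G\<^esub> s \<otimes>\<^bsub>G\<^esub> coset_rep B"

definition transfer_map :: "('a, 'b) monoid_scheme \<Rightarrow> 'a set \<Rightarrow> ('a \<Rightarrow> int) \<Rightarrow> 'a \<Rightarrow> int" where
  "transfer_map G P d s = (\<Sum>B\<in>left_cosets G P. d (transfer_arg G s B))"

text \<open>For the conjugate b P b^-1 this is the length of the orbit of the coset b P under the
  powers of t.\<close>

definition least_pow :: "('a, 'b) monoid_scheme \<Rightarrow> 'a set \<Rightarrow> 'a \<Rightarrow> nat" where
  "least_pow G P t = (LEAST k. 0 < k \<and> t [^]\<^bsub>G\<^esub> k \<in> P)"

section \<open>Characters modulo m and the evaluation of the transfer on t-orbits of cosets\<close>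

context group
begin

lemma mod_hom_one:
  assumes "mod_hom G m P d" "subgroup P G" shows "[d \<one> = 0] (mod m)"
proof -
  have "[d \<one> = d \<one> + d \<one>] (mod m)"
    using assms subgroup.one_closed[OF assms(2)] by (metis mod_hom_def l_one one_closed)
  then show ?thesis by (simp add: cong_iff_dvd_diff)
qed

lemma mod_hom_inv:
  assumes "mod_hom G m P d" "subgroup P G" "x \<in> P" shows "[d (inv x) = - d x] (mod m)"
proof -
  have x: "x \<in> carrier G" using assms subgroup.mem_carrier by metis
  have "[d (inv x \<otimes> x) = d (inv x) + d x] (mod m)"
    using assms subgroup.m_inv_closed[OF assms(2,3)] by (simp add: mod_hom_def)
  then have "[d (inv x) + d x = 0] (mod m)"
    using mod_hom_one[OF assms(1,2)] x by (metis cong_sym cong_trans l_inv)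
  then show ?thesis by (simp add: cong_iff_dvd_diff)
qed

lemma mod_hom_pow:
  assumes "mod_hom G m P d" "subgroup P G" "x \<in> P"
  shows "[d (x [^] (n::nat)) = int n * d x] (mod m)"
proof (induction n)
  case 0
  then show ?case using mod_hom_one[OF assms(1,2)] by simp
next
  case (Suc n)
  have "[d (x [^] n \<otimes> x) = d (x [^] n) + d x] (mod m)"
    using assms subgroup_pow_closed[OF assms(2,3)] by (simp add: mod_hom_def)
  also have "[d (x [^] n) + d x = int n * d x + d x] (mod m)" using Suc by (intro cong_add) auto
  finally show ?case by (simp add: algebra_simps)
qed

context
  assumes fin: "finite (carrier G)"
begin

lemma pow_order_closed:
  assumes "subgroup P G" "t \<in> carrier G" shows "t [^] order G \<in> P"
  using pow_order_eq_1[OF assms(2)] subgroup.one_closed[OF assms(1)] by simp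

lemma least_pow_props:
  assumes P: "subgroup P G" and t: "t \<in> carrier G"
  shows "0 < least_pow G P t" "t [^] least_pow G P t \<in> P"
    "t [^] j \<in> P \<longleftrightarrow> least_pow G P t dvd j" "least_pow G P t dvd order G"
proof -
  let ?k = "least_pow G P t"
  have "order G > 0" using fin by (simp add: order_gt_0_iff_finite)
  then have "\<exists>k>0. t [^] (k::nat) \<in> P" using pow_order_closed[OF P t] by blast
  then have k: "0 < ?k \<and> t [^] ?k \<in> P" unfolding least_pow_def by (rule LeastI_ex)
  then show k0: "0 < ?k" and kP: "t [^] ?k \<in> P" by auto
  have *: "t [^] j \<in> P \<longleftrightarrow> ?k dvd j" for j
  proof
    assume "?k dvd j"
    then obtain i where "j = ?k * i" by blast
    then show "t [^] j \<in> P" using subgroup_pow_closed[OF P kP, of i] t by (simp add: nat_pow_pow)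
  next
    assume j: "t [^] j \<in> P"
    have "t [^] (j mod ?k) = inv (t [^] (?k * (j div ?k))) \<otimes> t [^] j"
    proof -
      have "t [^] j = t [^] (?k * (j div ?k)) \<otimes> t [^] (j mod ?k)"
        using t by (simp add: nat_pow_mult)
      then show ?thesis using t by simp
    qed
    moreover have "t [^] (?k * (j div ?k)) \<in> P"
      using subgroup_pow_closed[OF P kP, of "j div ?k"] t by (simp add: nat_pow_pow)
    ultimately have "t [^] (j mod ?k) \<in> P"
      using j P by (simp add: subgroup.m_closed subgroup.m_inv_closed)
    moreover have "j mod ?k < ?k" using k0 by simp
    ultimately have "j mod ?k = 0"
      using not_less_Least[of "j mod ?k" "\<lambda>k. 0 < k \<and> t [^] k \<in> P"] unfolding least_pow_def by auto
    then show "?k dvd j" by (rule mod_0_imp_dvd)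
  qed
  show "t [^] j \<in> P \<longleftrightarrow> ?k dvd j" by (rule *)
  show "?k dvd order G" using * pow_order_closed[OF P t] by blast
qed

lemma generate_eq_pow:
  assumes t: "t \<in> carrier G"
  shows "generate G {t} = range (\<lambda>n::nat. t [^] n)"
proof
  have "subgroup (range (\<lambda>n::nat. t [^] n)) G"
  proof (rule subgroupI)
    fix a b assume "a \<in> range (\<lambda>n::nat. t [^] n)" "b \<in> range (\<lambda>n::nat. t [^] n)"
    then obtain i j :: nat where "a = t [^] i" "b = t [^] j" by blast
    then have "a \<otimes> b = t [^] (i + j)" using t by (simp add: nat_pow_mult)
    then show "a \<otimes> b \<in> range (\<lambda>n::nat. t [^] n)" by blast
  next
    fix a assume "a \<in> range (\<lambda>n::nat. t [^] n)"
    then obtain i :: nat where i: "a = t [^] i" by blast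
    have "order G > 0" using fin by (simp add: order_gt_0_iff_finite)
    then have "a \<otimes> a [^] (order G - 1) = a [^] order G"
      using i t nat_pow_mult[of a 1 "order G - 1"] by simp
    also have "\<dots> = \<one>" using i t by (simp add: pow_order_eq_1)
    finally have "inv a = a [^] (order G - 1)"
      using i t by (metis inv_char inv_comm nat_pow_closed)
    also have "\<dots> = t [^] (i * (order G - 1))" using i t by (simp add: nat_pow_pow)
    finally show "inv a \<in> range (\<lambda>n::nat. t [^] n)" by blast
  qed (use t in auto)
  moreover have "t [^] (1::nat) \<in> range (\<lambda>n::nat. t [^] n)" by blast
  ultimately show "generate G {t} \<subseteq> range (\<lambda>n::nat. t [^] n)"
    using t by (intro generate_subgroup_incl) auto
  have "subgroup (generate G {t}) G" using t by (intro generate_is_subgroup) auto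
  moreover have "t \<in> generate G {t}" by (auto intro: generate.incl)
  ultimately show "range (\<lambda>n::nat. t [^] n) \<subseteq> generate G {t}" by (auto intro: subgroup_pow_closed)
qed

context
  fixes P assumes P: "subgroup P G"
begin

lemma left_coset_rep:
  assumes "B \<in> left_cosets G P"
  shows "coset_rep B \<in> B" "coset_rep B \<in> carrier G" "coset_rep B <# P = B"
proof -
  obtain b where b: "b \<in> carrier G" "B = b <# P" using assms by (auto simp: left_cosets_def)
  have "b \<otimes> \<one> \<in> B" unfolding b(2) l_coset_def using subgroup.one_closed[OF P] by blast
  then show *: "coset_rep B \<in> B" unfolding coset_rep_def by (rule someI)
  show "coset_rep B \<in> carrier G" using l_coset_carrier * b P by metis
  show "coset_rep B <# P = B" using l_repr_independence[of "coset_rep B" b P] * b P by simp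
qed

lemma left_cosets_action: "finite_action G (left_cosets G P) (l_coset G)"
proof (unfold_locales)
  have sub: "P \<subseteq> carrier G" using P by (rule subgroup.subset)
  show "finite (carrier G)" "finite (left_cosets G P)" using fin by (auto simp: left_cosets_def)
  fix g h B assume g: "g \<in> carrier G" and B: "B \<in> left_cosets G P"
  then obtain b where b: "b \<in> carrier G" "B = b <# P" by (auto simp: left_cosets_def)
  show "g <# B \<in> left_cosets G P" using g b sub by (auto simp: left_cosets_def lcos_m_assoc)
  assume "h \<in> carrier G"
  then show "g \<otimes> h <# B = g <# (h <# B)"
    using g b sub l_coset_subset_G by (simp add: lcos_m_assoc m_assoc)
next
  fix B assume B: "B \<in> left_cosets G P"
  then show "\<one> <# B = B"
    using l_coset_subset_G[OF subgroup.subset[OF P]] by (auto simp: left_cosets_def lcos_mult_one)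
qed

interpretation A: finite_action G "left_cosets G P" "l_coset G"
  by (rule left_cosets_action)

lemma left_coset_mem_iff:
  assumes "b \<in> carrier G" "g \<in> carrier G"
  shows "g \<in> b <# P \<longleftrightarrow> inv b \<otimes> g \<in> P"
proof
  assume "g \<in> b <# P"
  then obtain x where "x \<in> P" "g = b \<otimes> x" by (auto simp: l_coset_def)
  then show "inv b \<otimes> g \<in> P" using assms subgroup.mem_carrier[OF P] by simp
next
  assume "inv b \<otimes> g \<in> P"
  moreover have "g = b \<otimes> (inv b \<otimes> g)" using assms by simp
  ultimately show "g \<in> b <# P" by (auto simp: l_coset_def)
qed

lemma transfer_arg_closed:
  assumes "s \<in> carrier G" "B \<in> left_cosets G P" shows "transfer_arg G s B \<in> P"
proof -
  let ?b = "coset_rep B" and ?c = "coset_rep (s <# B)"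
  have sB: "s <# B \<in> left_cosets G P" using A.act_closed assms by blast
  have "?b \<in> B" using left_coset_rep[OF assms(2)] by simp
  then have "s \<otimes> ?b \<in> s <# B" by (auto simp: l_coset_def)
  then have "s \<otimes> ?b \<in> ?c <# P" using left_coset_rep[OF sB] by simp
  then show ?thesis
    using left_coset_mem_iff[of ?c "s \<otimes> ?b"] left_coset_rep[OF sB] left_coset_rep[OF assms(2)] assms(1)
    by (simp add: transfer_arg_def m_assoc)
qed

lemma transfer_arg_mult:
  assumes "s \<in> carrier G" "t \<in> carrier G" "B \<in> left_cosets G P"
  shows "transfer_arg G (s \<otimes> t) B = transfer_arg G s (t <# B) \<otimes> transfer_arg G t B"
proof -
  have tB: "t <# B \<in> left_cosets G P" using A.act_closed assms by blast
  have stB: "s <# (t <# B) \<in> left_cosets G P" using A.act_closed assms(1) tB by blast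
  have "(s \<otimes> t) <# B = s <# (t <# B)" using A.act_mult assms by blast
  then show ?thesis
    using assms left_coset_rep(2)[OF assms(3)] left_coset_rep(2)[OF tB] left_coset_rep(2)[OF stB]
    by (simp add: transfer_arg_def m_assoc)
qed

lemma sum_left_translate:
  fixes f :: "'a set \<Rightarrow> int"
  assumes "t \<in> carrier G"
  shows "(\<Sum>B\<in>left_cosets G P. f (t <# B)) = sum f (left_cosets G P)"
proof (rule sum.reindex_bij_witness[of _ "\<lambda>B. inv t <# B" "\<lambda>B. t <# B"])
  fix B assume B: "B \<in> left_cosets G P"
  then show "inv t <# (t <# B) = B" "t <# (inv t <# B) = B"
    using assms by (simp_all flip: A.act_mult add: A.act_one)
qed (use assms A.act_closed in auto)

text \<open>The cocycle identity, summed over cosets; t merely permutes the cosets in the first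
  summand.\<close>

lemma transfer_mod_hom:
  assumes d: "mod_hom G m P d" shows "mod_hom G m (carrier G) (transfer_map G P d)"
  unfolding mod_hom_def
proof (intro ballI)
  fix s t assume s: "s \<in> carrier G" and t: "t \<in> carrier G"
  have "[transfer_map G P d (s \<otimes> t) =
      (\<Sum>B\<in>left_cosets G P. d (transfer_arg G s (t <# B)) + d (transfer_arg G t B))] (mod m)"
    unfolding transfer_map_def
  proof (rule cong_sum)
    fix B assume B: "B \<in> left_cosets G P"
    then show "[d (transfer_arg G (s \<otimes> t) B) =
        d (transfer_arg G s (t <# B)) + d (transfer_arg G t B)] (mod m)"
      using d transfer_arg_closed[OF t B] transfer_arg_closed[OF s A.act_closed[OF t B]]
      by (simp add: transfer_arg_mult[OF s t B] mod_hom_def)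
  qed
  also have "(\<Sum>B\<in>left_cosets G P. d (transfer_arg G s (t <# B)) + d (transfer_arg G t B)) =
      transfer_map G P d s + transfer_map G P d t"
    using sum_left_translate[OF t, of "\<lambda>B. d (transfer_arg G s B)"]
    by (simp add: sum.distrib transfer_map_def)
  finally show "[transfer_map G P d (s \<otimes> t) = transfer_map G P d s + transfer_map G P d t] (mod m)" .
qed

lemma left_coset_fixed_iff:
  assumes "g \<in> carrier G" "B \<in> left_cosets G P"
  shows "g <# B = B \<longleftrightarrow> g \<in> conj_set G (coset_rep B) P"
proof -
  let ?b = "coset_rep B"
  have b: "?b \<in> carrier G" "?b <# P = B" using left_coset_rep[OF assms(2)] by auto
  have gB: "g <# B = (g \<otimes> ?b) <# P"
    using b assms(1) subgroup.subset[OF P] by (simp flip: lcos_m_assoc)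
  have "g <# B = B \<longleftrightarrow> g \<otimes> ?b \<in> ?b <# P"
  proof
    assume "g <# B = B"
    then have "coset_rep B <# P = (g \<otimes> ?b) <# P" using gB b by simp
    moreover have "g \<otimes> ?b \<in> (g \<otimes> ?b) <# P"
      using left_coset_mem_iff[of "g \<otimes> ?b" "g \<otimes> ?b"] assms(1) b subgroup.one_closed[OF P] by simp
    ultimately show "g \<otimes> ?b \<in> ?b <# P" by simp
  next
    assume "g \<otimes> ?b \<in> ?b <# P"
    then show "g <# B = B" using l_repr_independence[of "g \<otimes> ?b" ?b P] b P gB by simp
  qed
  also have "\<dots> \<longleftrightarrow> inv ?b \<otimes> (g \<otimes> ?b) \<in> P" by (rule left_coset_mem_iff) (use b assms(1) in auto)
  also have "\<dots> \<longleftrightarrow> g \<in> conj_set G ?b P"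
  proof
    assume "inv ?b \<otimes> (g \<otimes> ?b) \<in> P"
    moreover have "g = ?b \<otimes> (inv ?b \<otimes> (g \<otimes> ?b)) \<otimes> inv ?b" using b assms(1) by (simp add: m_assoc)
    ultimately show "g \<in> conj_set G ?b P" unfolding conj_set_def by blast
  next
    assume "g \<in> conj_set G ?b P"
    then obtain x where "x \<in> P" "g = ?b \<otimes> x \<otimes> inv ?b" by (auto simp: conj_set_def)
    then show "inv ?b \<otimes> (g \<otimes> ?b) \<in> P" using b subgroup.mem_carrier[OF P] by (simp add: m_assoc)
  qed
  finally show ?thesis .
qed

lemma subgroup_conj_set: "\<lbrakk>subgroup H G; b \<in> carrier G\<rbrakk> \<Longrightarrow> subgroup (conj_set G b H) G"
proof (rule subgroupI)
  assume H: "subgroup H G" and b: "b \<in> carrier G"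
  note Hc = subgroup.mem_carrier[OF H]
  show "conj_set G b H \<subseteq> carrier G" using Hc b by (auto simp: conj_set_def)
  show "conj_set G b H \<noteq> {}" using subgroup.one_closed[OF H] by (auto simp: conj_set_def)
  fix x y assume "x \<in> conj_set G b H"
  then obtain h where h: "h \<in> H" "x = b \<otimes> h \<otimes> inv b" by (auto simp: conj_set_def)
  then have "inv x = b \<otimes> inv h \<otimes> inv b" using b Hc by (simp add: inv_mult_group m_assoc)
  then show "inv x \<in> conj_set G b H" using subgroup.m_inv_closed[OF H h(1)] by (auto simp: conj_set_def)
  assume "y \<in> conj_set G b H"
  then obtain k where k: "k \<in> H" "y = b \<otimes> k \<otimes> inv b" by (auto simp: conj_set_def)
  then have "x \<otimes> y = b \<otimes> (h \<otimes> k) \<otimes> inv b" using h b Hc by (simp add: m_assoc)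
  then show "x \<otimes> y \<in> conj_set G b H" using subgroup.m_closed[OF H h(1) k(1)] by (auto simp: conj_set_def)
qed

text \<open>Iterating the cocycle identity telescopes: the terms over the first n translates of
  \<open>B\<close> combine into the single term of t^n.\<close>

lemma transfer_arg_pow:
  assumes d: "mod_hom G m P d" and t: "t \<in> carrier G" and B: "B \<in> left_cosets G P"
  shows "[(\<Sum>i<n. d (transfer_arg G t (t [^] i <# B))) = d (transfer_arg G (t [^] (n::nat)) B)] (mod m)"
proof (induction n)
  case 0
  have "transfer_arg G \<one> B = \<one>"
    using A.act_one[OF B] left_coset_rep[OF B] by (simp add: transfer_arg_def)
  then show ?case using mod_hom_one[OF d P] by (simp add: cong_sym)
next
  case (Suc n)
  have tn: "t [^] n \<in> carrier G" using t by simp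
  have e: "t [^] Suc n = t \<otimes> t [^] n" by (rule nat_pow_Suc2[OF t])
  have "[d (transfer_arg G (t [^] Suc n) B) =
      d (transfer_arg G t (t [^] n <# B)) + d (transfer_arg G (t [^] n) B)] (mod m)"
    unfolding e using d transfer_arg_closed[OF tn B] transfer_arg_closed[OF t A.act_closed[OF tn B]]
    by (simp add: transfer_arg_mult[OF t tn B] mod_hom_def)
  also have "[d (transfer_arg G t (t [^] n <# B)) + d (transfer_arg G (t [^] n) B) =
      d (transfer_arg G t (t [^] n <# B)) + (\<Sum>i<n. d (transfer_arg G t (t [^] i <# B)))] (mod m)"
    using Suc by (intro cong_add) (auto simp: cong_sym)
  finally show ?case by (simp add: cong_sym add.commute)
qed

text \<open>The value of the transfer at \<open>t\<close>, as a sum over the \<open>t\<close>-orbits of cosets; the orbit of \<open>B\<close>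
  has \<open>least_pow\<close> many elements, and weighting by \<open>|G| / least_pow\<close> avoids choosing representatives
  of the orbits.\<close>

lemma transfer_eval:
  assumes d: "mod_hom G m P d" and t: "t \<in> carrier G"
    and v_inv: "\<And>B. B \<in> left_cosets G P \<Longrightarrow> v (t <# B) = v B"
    and v: "\<And>B k. \<lbrakk>B \<in> left_cosets G P; k = least_pow G (conj_set G (coset_rep B) P) t\<rbrakk> \<Longrightarrow>
      [d (inv (coset_rep B) \<otimes> t [^] k \<otimes> coset_rep B) = v B] (mod m)"
  obtains V where "[transfer_map G P d t = V] (mod m)"
    "int (order G) * V = (\<Sum>B\<in>left_cosets G P.
      int (order G div least_pow G (conj_set G (coset_rep B) P) t) * v B)"
proof -
  let ?Y = "left_cosets G P" and ?C = "generate G {t}"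
  define k where "k B = least_pow G (conj_set G (coset_rep B) P) t" for B
  have sC: "subgroup ?C G" using t by (intro generate_is_subgroup) auto
  have kB: "0 < k B" "t [^] j <# B = B \<longleftrightarrow> k B dvd j" "k B dvd order G" if "B \<in> ?Y" for B j
  proof -
    have s: "subgroup (conj_set G (coset_rep B) P) G"
      using subgroup_conj_set[OF P] left_coset_rep[OF that] by simp
    show "0 < k B" "k B dvd order G" using least_pow_props[OF s t] by (simp_all add: k_def)
    show "t [^] j <# B = B \<longleftrightarrow> k B dvd j"
      using left_coset_fixed_iff[OF nat_pow_closed[OF t] that] least_pow_props(3)[OF s t]
      by (simp add: k_def)
  qed
  have gC: "group (G\<lparr>carrier := ?C\<rparr>)" using sC by (rule subgroup_imp_group)
  interpret C: finite_action "G\<lparr>carrier := ?C\<rparr>" ?Y "l_coset G"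
  proof -
    interpret C: group "G\<lparr>carrier := ?C\<rparr>" by (rule gC)
    have Cc: "\<And>g. g \<in> ?C \<Longrightarrow> g \<in> carrier G" using sC by (rule subgroup.mem_carrier)
    show "finite_action (G\<lparr>carrier := ?C\<rparr>) ?Y (l_coset G)"
    proof (unfold_locales)
      show "finite (carrier (G\<lparr>carrier := ?C\<rparr>))"
        using fin sC by (simp add: finite_subset[OF subgroup.subset])
    qed (use A.fin_Y A.act_closed A.act_one A.act_mult Cc in auto)
  qed
  have pow_inj: "inj_on (\<lambda>i. t [^] i <# B) {..<k B}" if B: "B \<in> ?Y" for B
  proof -
    have "i = j" if ij: "i \<le> j" "j < k B" "t [^] i <# B = t [^] j <# B" for i j
    proof -
      have "t [^] j = t [^] i \<otimes> t [^] (j - i)" using ij(1) t by (simp add: nat_pow_mult)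
      then have "t [^] i <# (t [^] (j - i) <# B) = t [^] i <# B"
        using ij(3) A.act_mult[of "t [^] i" "t [^] (j - i)" B] t B by simp
      then have "inv (t [^] i) <# (t [^] i <# (t [^] (j - i) <# B)) = inv (t [^] i) <# (t [^] i <# B)" by simp
      then have "t [^] (j - i) <# B = B"
        using t B A.act_closed by (simp flip: A.act_mult add: A.act_one)
      then have "k B dvd j - i" using kB[OF B] by blast
      then show "i = j" using ij by (metis diff_le_self dvd_imp_le le_antisym linorder_not_less nat_less_le
        order.strict_trans1 zero_less_diff)
    qed
    then show ?thesis by (intro inj_onI) (metis lessThan_iff nat_le_linear)
  qed
  have orb: "C.orb B = (\<lambda>i. t [^] i <# B) ` {..<k B}" if B: "B \<in> ?Y" for B
  proof -
    have "C.orb B = (\<lambda>i::nat. t [^] i <# B) ` UNIV"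
      unfolding C.orb_def using generate_eq_pow[OF t] by (auto simp: image_iff)
    also have "\<dots> = (\<lambda>i. t [^] i <# B) ` {..<k B}"
    proof
      show "range (\<lambda>i::nat. t [^] i <# B) \<subseteq> (\<lambda>i. t [^] i <# B) ` {..<k B}"
      proof
        fix Z assume "Z \<in> range (\<lambda>i::nat. t [^] i <# B)"
        then obtain i :: nat where i: "Z = t [^] i <# B" by blast
        have "t [^] i = t [^] (i mod k B) \<otimes> t [^] (k B * (i div k B))" using t by (simp add: nat_pow_mult)
        then have "Z = t [^] (i mod k B) <# (t [^] (k B * (i div k B)) <# B)"
          using i A.act_mult t B by simp
        also have "t [^] (k B * (i div k B)) <# B = B" using kB(2)[OF B] by simp
        finally show "Z \<in> (\<lambda>i. t [^] i <# B) ` {..<k B}" using kB(1)[OF B] by auto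
      qed
    qed auto
    finally show ?thesis .
  qed
  have v_pow: "v (t [^] i <# B) = v B" if B: "B \<in> ?Y" for B and i :: nat
  proof (induction i)
    case 0 then show ?case using A.act_one[OF B] by simp
  next
    case (Suc i)
    have "t [^] Suc i <# B = t <# (t [^] i <# B)"
      unfolding nat_pow_Suc2[OF t] using A.act_mult[of t "t [^] i" B] t B by simp
    then show ?case using v_inv[OF A.act_closed[of "t [^] i" B]] t B Suc by simp
  qed
  have k_pow: "k (t [^] i <# B) = k B" if B: "B \<in> ?Y" for B and i :: nat
  proof -
    let ?Z = "t [^] i <# B"
    have Z: "?Z \<in> ?Y" using A.act_closed t B by simp
    have "t [^] j <# ?Z = ?Z \<longleftrightarrow> t [^] j <# B = B" for j :: nat
    proof -
      have "t [^] j <# ?Z = t [^] i <# (t [^] j <# B)"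
        using t B by (simp flip: A.act_mult add: nat_pow_mult add.commute)
      moreover have "t [^] i <# (t [^] j <# B) = t [^] i <# B \<longleftrightarrow> t [^] j <# B = B"
      proof
        assume "t [^] i <# (t [^] j <# B) = t [^] i <# B"
        then have "inv (t [^] i) <# (t [^] i <# (t [^] j <# B)) = inv (t [^] i) <# (t [^] i <# B)" by simp
        then show "t [^] j <# B = B" using t B A.act_closed by (simp flip: A.act_mult add: A.act_one)
      qed simp
      ultimately show ?thesis by simp
    qed
    then have "k ?Z dvd j \<longleftrightarrow> k B dvd j" for j using kB(2)[OF Z] kB(2)[OF B] by simp
    then show ?thesis by (metis dvd_antisym dvd_refl)
  qed
  \<comment> \<open>The value of \<open>v\<close> on an orbit, read at an arbitrary member;
    \<open>v\<close> is constant along t-orbits.\<close>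
  define W where "W R = v (SOME B. B \<in> R)" for R
  have W: "W (C.orb B) = v B" if B: "B \<in> ?Y" for B
  proof -
    have "(SOME Z. Z \<in> C.orb B) \<in> C.orb B" using C.orb_refl[OF B] by (rule someI)
    then show ?thesis unfolding W_def using orb[OF B] v_pow[OF B] by auto
  qed
  define V where "V = (\<Sum>R\<in>C.orb ` ?Y. W R)"
  show thesis
  proof (rule that)
    show "[transfer_map G P d t = V] (mod m)"
      unfolding transfer_map_def V_def C.sum_orbits
    proof (rule cong_sum)
      fix R assume "R \<in> C.orb ` ?Y"
      then obtain B where B: "B \<in> ?Y" "R = C.orb B" by blast
      have "(\<Sum>Z\<in>R. d (transfer_arg G t Z)) = (\<Sum>i<k B. d (transfer_arg G t (t [^] i <# B)))"
        unfolding B(2) orb[OF B(1)] using pow_inj[OF B(1)] by (simp add: sum.reindex)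
      also have "[\<dots> = d (transfer_arg G (t [^] k B) B)] (mod m)"
        by (rule transfer_arg_pow[OF d t B(1)])
      \<comment> \<open>The power t^k with k = \<open>k B\<close> fixes \<open>B\<close>, so the
        same representative occurs on both sides.\<close>
      also have "transfer_arg G (t [^] k B) B = inv (coset_rep B) \<otimes> t [^] k B \<otimes> coset_rep B"
        using kB(2)[OF B(1), of "k B"] by (simp add: transfer_arg_def)
      also have "[d (inv (coset_rep B) \<otimes> t [^] k B \<otimes> coset_rep B) = v B] (mod m)"
        by (rule v[OF B(1)]) (simp add: k_def)
      also have "v B = W R" using W[OF B(1)] B(2) by simp
      finally show "[(\<Sum>Z\<in>R. d (transfer_arg G t Z)) = W R] (mod m)" .
    qed
    have "(\<Sum>B\<in>?Y. int (order G div k B) * v B) = (\<Sum>R\<in>C.orb ` ?Y. int (order G) * W R)"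
      unfolding C.sum_orbits
    proof (rule sum.cong[OF refl])
      fix R assume "R \<in> C.orb ` ?Y"
      then obtain B where B: "B \<in> ?Y" "R = C.orb B" by blast
      have "(\<Sum>Z\<in>R. int (order G div k Z) * v Z) = (\<Sum>i<k B. int (order G div k B) * v B)"
        unfolding B(2) orb[OF B(1)] using pow_inj[OF B(1)] k_pow[OF B(1)] v_pow[OF B(1)]
        by (simp add: sum.reindex)
      also have "\<dots> = int (k B * (order G div k B)) * v B" by simp
      also have "k B * (order G div k B) = order G" using kB(3)[OF B(1)] by simp
      finally show "(\<Sum>Z\<in>R. int (order G div k Z) * v Z) = int (order G) * W R" using W[OF B(1)] B(2) by simp
    qed
    then show "int (order G) * V = (\<Sum>B\<in>?Y.
        int (order G div least_pow G (conj_set G (coset_rep B) P) t) * v B)"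
      by (simp add: V_def k_def sum_distrib_left)
  qed
qed

lemma sum_over_cosets:
  fixes f :: "'a \<Rightarrow> int"
  assumes f: "\<And>b x. \<lbrakk>b \<in> carrier G; x \<in> P\<rbrakk> \<Longrightarrow> f (b \<otimes> x) = f b"
  shows "sum f (carrier G) = int (card P) * (\<Sum>B\<in>left_cosets G P. f (coset_rep B))"
proof -
  have "sum f (carrier G) = (\<Sum>B\<in>left_cosets G P. \<Sum>b | b \<in> carrier G \<and> b <# P = B. f b)"
    unfolding left_cosets_def by (rule sum.image_gen[OF fin])
  also have "\<dots> = (\<Sum>B\<in>left_cosets G P. int (card P) * f (coset_rep B))"
  proof (rule sum.cong[OF refl])
    fix B assume B: "B \<in> left_cosets G P"
    let ?b = "coset_rep B"
    have b: "?b \<in> carrier G" "?b <# P = B" using left_coset_rep[OF B] by auto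
    have "{b \<in> carrier G. b <# P = B} = (\<lambda>x. ?b \<otimes> x) ` P"
    proof (intro equalityI subsetI)
      fix c assume c: "c \<in> {b \<in> carrier G. b <# P = B}"
      then have "c \<in> c <# P" using left_coset_mem_iff[of c c] subgroup.one_closed[OF P] by simp
      then show "c \<in> (\<lambda>x. ?b \<otimes> x) ` P" using c b by (auto simp: l_coset_def)
    next
      fix c assume "c \<in> (\<lambda>x. ?b \<otimes> x) ` P"
      then obtain x where x: "x \<in> P" "c = ?b \<otimes> x" by blast
      then have "c \<in> ?b <# P" by (auto simp: l_coset_def)
      then show "c \<in> {b \<in> carrier G. b <# P = B}"
        using l_repr_independence[of c ?b P] b P x subgroup.mem_carrier[OF P] by simp
    qed
    moreover have "inj_on (\<lambda>x. ?b \<otimes> x) P" using b subgroup.mem_carrier[OF P] by (auto simp: inj_on_def)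
    ultimately have "(\<Sum>b | b \<in> carrier G \<and> b <# P = B. f b) = (\<Sum>x\<in>P. f (?b \<otimes> x))"
      by (simp add: sum.reindex)
    also have "\<dots> = (\<Sum>x\<in>P. f ?b)" using f b by (intro sum.cong) auto
    finally show "(\<Sum>b | b \<in> carrier G \<and> b <# P = B. f b) = int (card P) * f ?b" by simp
  qed
  finally show ?thesis by (simp add: sum_distrib_left)
qed

lemma card_left_cosets: "card P * card (left_cosets G P) = order G"
  using sum_over_cosets[of "\<lambda>_. 1"] by (simp add: order_def flip: of_nat_mult)

end

end

end

section \<open>Transfer through the stable biset\<close>

lemma in_l_cosetD: "x \<in> b <#\<^bsub>G\<^esub> H \<Longrightarrow> \<exists>q\<in>H. x = b \<otimes>\<^bsub>G\<^esub> q"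
  by (auto simp: l_coset_def)

context saturated_fusion
begin

lemma T_mem: "t \<in> T \<Longrightarrow> t \<in> carrier S"
  by (rule subgroup.mem_carrier[OF T_subgroup])

lemma hom_S_conj_mod_T:
  assumes P: "subgroup P S" and \<phi>: "\<phi> \<in> hom_S P"
  obtains g where "g \<in> carrier S" "\<And>x. x \<in> P \<Longrightarrow> inv g \<otimes> \<phi> x \<otimes> g \<otimes> inv x \<in> T"
proof -
  obtain g where g: "g \<in> carrier S" "\<And>x. x \<in> P \<Longrightarrow> T #> \<phi> x = T #> (g \<otimes> x \<otimes> inv g)"
    using hom_inner_mod_T[OF P \<phi>] unfolding inner_mod_T_def by blast
  have "inv g \<otimes> \<phi> x \<otimes> g \<otimes> inv x \<in> T" if x: "x \<in> P" for x
  proof -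
    have c: "x \<in> carrier S" "\<phi> x \<in> carrier S" using x subgroup.mem_carrier[OF P] hom_S_closed[OF P \<phi>] by auto
    have "\<phi> x \<otimes> inv (g \<otimes> x \<otimes> inv g) \<in> T"
      using g(2)[OF x] rcos_eq_iff[OF T_subgroup] c g(1) by simp
    then have "inv g \<otimes> (\<phi> x \<otimes> inv (g \<otimes> x \<otimes> inv g)) \<otimes> inv (inv g) \<in> T"
      using g(1) by (intro T_conj) auto
    then show ?thesis using g(1) c by (simp add: inv_mult_group m_assoc)
  qed
  then show thesis using that g(1) by blast
qed

text \<open>Modulo \<open>T\<close> the morphism is a conjugation, and \<open>T\<close> is normal:
  the hyperfocal subgroup is strongly closed in F.\<close>

lemma hom_S_T_closed:
  assumes P: "subgroup P S" and \<phi>: "\<phi> \<in> hom_S P" and x: "x \<in> P" "x \<in> T"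
  shows "\<phi> x \<in> T"
proof -
  obtain g where g: "g \<in> carrier S" "inv g \<otimes> \<phi> x \<otimes> g \<otimes> inv x \<in> T"
    using hom_S_conj_mod_T[OF P \<phi>] x(1) by metis
  have c: "x \<in> carrier S" "\<phi> x \<in> carrier S" using x T_mem hom_S_closed[OF P \<phi>] by auto
  have "inv g \<otimes> \<phi> x \<otimes> g = inv g \<otimes> \<phi> x \<otimes> g \<otimes> inv x \<otimes> x" using c g(1) by (simp add: m_assoc)
  also have "\<dots> \<in> T" by (rule subgroup.m_closed[OF T_subgroup g(2) x(2)])
  finally have "g \<otimes> (inv g \<otimes> \<phi> x \<otimes> g) \<otimes> inv g \<in> T" using g(1) by (intro T_conj) auto
  then show ?thesis using c g(1) by (simp add: m_assoc)
qed

subsection \<open>Fixed points of a single element\<close>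

text \<open>The total weight of the \<open>E\<close> for which k is the least positive exponent with
  t^k in the second projection and y is the partner of t^k. These numbers contain all that the sum
  of transfers sees of t; \<open>mark_at\<close> drops the minimality of k.\<close>

definition weight_at :: "'a \<Rightarrow> nat \<Rightarrow> 'a \<Rightarrow> int" where
  "weight_at t k y = (\<Sum>E | E \<in> diags \<and> least_pow S (snd ` E) t = k \<and> (y, t [^] k) \<in> E. fam.weight E)"

definition mark_at :: "'a \<Rightarrow> nat \<Rightarrow> 'a \<Rightarrow> int" where
  "mark_at t k y = (\<Sum>E | E \<in> diags \<and> (y, t [^] k) \<in> E. fam.weight E)"

lemma snd_subgroup: "E \<in> diags \<Longrightarrow> subgroup (snd ` E) S"
  by (auto elim!: diagsE)

lemma diags_functional: "\<lbrakk>E \<in> diags; (y, x) \<in> E; (z, x) \<in> E\<rbrakk> \<Longrightarrow> y = z"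
  by (auto elim!: diagsE simp: diag_def)

lemma diags_in_carrier: "\<lbrakk>E \<in> diags; (y, x) \<in> E\<rbrakk> \<Longrightarrow> y \<in> carrier S \<and> x \<in> carrier S"
  using fam.DD_carrier[of E] by auto

lemma diags_pow: "\<lbrakk>E \<in> diags; (y, x) \<in> E\<rbrakk> \<Longrightarrow> (y [^] (i::nat), x [^] i) \<in> E"
proof (induction i)
  case 0
  then show ?case using subgroup.one_closed[OF diags_subgroup[OF 0(1)]] by simp
next
  case (Suc i)
  then show ?case using subgroup.m_closed[OF diags_subgroup[OF Suc(2)] Suc(1)[OF Suc(2,3)] Suc(3)] by simp
qed

lemma diags_least_pow:
  assumes E: "E \<in> diags" and t: "t \<in> carrier S"
  obtains y where "(y, t [^] least_pow S (snd ` E) t) \<in> E" "y \<in> carrier S"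
proof -
  have "t [^] least_pow S (snd ` E) t \<in> snd ` E"
    by (rule least_pow_props(2)[OF fin snd_subgroup[OF E] t])
  then obtain y where "(y, t [^] least_pow S (snd ` E) t) \<in> E" by force
  then show thesis using that diags_in_carrier[OF E] by blast
qed

text \<open>An \<open>E\<close> containing (y, t^k) has its own minimal exponent j, which divides k,
  and the partner z of t^j satisfies z^(k/j) = y because \<open>E\<close> is a graph. The marks are
  thus a triangular combination of the \<open>weight_at\<close>, with leading term at (k,
  y).\<close>

lemma mark_at_eq_sum:
  assumes t: "t \<in> carrier S" and k: "k > 0" and y: "y \<in> carrier S"
  shows "mark_at t k y = (\<Sum>(j, z)\<in>{(j, z). j \<in> {1..k} \<and> z \<in> carrier S \<and> j dvd k \<and> z [^] (k div j) = y}.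
    weight_at t j z)"
proof -
  let ?I = "{(j, z). j \<in> {1..k} \<and> z \<in> carrier S \<and> j dvd k \<and> z [^] (k div j) = y}"
  have finI: "finite ?I" by (rule finite_subset[of _ "{1..k} \<times> carrier S"]) (use fin in auto)
  have part: "{E. E \<in> diags \<and> (y, t [^] k) \<in> E} =
      (\<Union>(j, z)\<in>?I. {E. E \<in> diags \<and> least_pow S (snd ` E) t = j \<and> (z, t [^] j) \<in> E})"
  proof (intro equalityI subsetI)
    fix E assume "E \<in> {E. E \<in> diags \<and> (y, t [^] k) \<in> E}"
    then have E: "E \<in> diags" "(y, t [^] k) \<in> E" by auto
    let ?j = "least_pow S (snd ` E) t"
    note lp = least_pow_props[OF fin snd_subgroup[OF E(1)] t]
    have "t [^] k \<in> snd ` E" using E(2) by force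
    then have jk: "?j dvd k" using lp(3) by blast
    obtain z where z: "(z, t [^] ?j) \<in> E" "z \<in> carrier S" using diags_least_pow[OF E(1) t] .
    have "(z [^] (k div ?j), (t [^] ?j) [^] (k div ?j)) \<in> E" by (rule diags_pow[OF E(1) z(1)])
    then have "(z [^] (k div ?j), t [^] k) \<in> E" using t jk by (simp add: nat_pow_pow)
    then have "z [^] (k div ?j) = y" using diags_functional[OF E(1)] E(2) by blast
    then have "(?j, z) \<in> ?I" using z jk lp(1) dvd_imp_le[OF jk k] by simp
    moreover have "E \<in> (case (?j, z) of (j, z) \<Rightarrow>
        {E. E \<in> diags \<and> least_pow S (snd ` E) t = j \<and> (z, t [^] j) \<in> E})"
      using E z by simp
    ultimately show "E \<in> (\<Union>(j, z)\<in>?I. {E. E \<in> diags \<and> least_pow S (snd ` E) t = j \<and> (z, t [^] j) \<in> E})"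
      by (rule UN_I)
  next
    fix E assume "E \<in> (\<Union>(j, z)\<in>?I. {E. E \<in> diags \<and> least_pow S (snd ` E) t = j \<and> (z, t [^] j) \<in> E})"
    then obtain j z where *: "j dvd k" "z [^] (k div j) = y" "E \<in> diags" "(z, t [^] j) \<in> E" by auto
    have "(z [^] (k div j), (t [^] j) [^] (k div j)) \<in> E" by (rule diags_pow[OF *(3,4)])
    then show "E \<in> {E. E \<in> diags \<and> (y, t [^] k) \<in> E}" using * t by (simp add: nat_pow_pow)
  qed
  have "mark_at t k y = (\<Sum>i\<in>?I. \<Sum>E\<in>(case i of (j, z) \<Rightarrow>
      {E. E \<in> diags \<and> least_pow S (snd ` E) t = j \<and> (z, t [^] j) \<in> E}). fam.weight E)"
    unfolding mark_at_def part
    by (rule sum.UNION_disjoint[OF finI]) (auto simp: fam.finite_DD dest: diags_functional)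
  then show ?thesis unfolding weight_at_def by (simp add: case_prod_unfold)
qed

lemma mark_at_eq_mark:
  assumes t: "t \<in> carrier S" and y: "y \<in> carrier S"
  shows "mark_at t k y = fam.mark (generate (S \<times>\<times> S) {(y, t [^] k)})"
proof -
  have "(y, t [^] k) \<in> E \<longleftrightarrow> generate (S \<times>\<times> S) {(y, t [^] k)} \<subseteq> E" if "E \<in> diags" for E
    using fam.generate_subgroup_incl[of "{(y, t [^] k)}" E] diags_subgroup[OF that]
      generate.incl[of "(y, t [^] k)" "{(y, t [^] k)}" "S \<times>\<times> S"] by blast
  then show ?thesis unfolding mark_at_def fam.mark_def by (intro sum.cong) auto
qed

lemma diags_generate_transport:
  assumes P: "subgroup P S" and \<alpha>: "\<alpha> \<in> hom_S P" and t: "t \<in> P" and y: "y \<in> carrier S"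
    and C: "generate (S \<times>\<times> S) {(y, t [^] k)} \<in> diags"
  shows "generate (S \<times>\<times> S) {(y, \<alpha> t [^] (k::nat))} \<in> diags"
    "dcls (generate (S \<times>\<times> S) {(y, \<alpha> t [^] k)}) = dcls (generate (S \<times>\<times> S) {(y, t [^] k)})"
proof -
  have fG: "finite (carrier (S \<times>\<times> S))" using fin by simp
  let ?C = "generate (S \<times>\<times> S) {(y, t [^] k)}"
  have tS: "t \<in> carrier S" using subgroup.mem_carrier[OF P t] .
  have \<alpha>tS: "\<alpha> t \<in> carrier S" by (rule hom_S_closed[OF P \<alpha> t])
  have pw: "(a, b) [^]\<^bsub>S \<times>\<times> S\<^esub> (n::nat) = (a [^] n, b [^] n)" for a b n
    by (induction n) auto
  have gen: "generate (S \<times>\<times> S) {(y, s [^] k)} = range (\<lambda>n::nat. (y [^] n, s [^] (k * n)))"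
    if "s \<in> carrier S" for s
    using fam.generate_eq_pow[OF fG, of "(y, s [^] k)"] that y by (simp add: pw nat_pow_pow)
  have tP: "t [^] n \<in> P" for n :: nat by (rule subgroup_pow_closed[OF P t])
  have id: "(\<lambda>x\<in>carrier S. x) \<in> hom_S (carrier S)" by (rule F_incl[OF subgroup_self subgroup_self order_refl])
  have "map_prod (\<lambda>x\<in>carrier S. x) \<alpha> ` ?C = range (\<lambda>n::nat. (y [^] n, \<alpha> (t [^] (k * n))))"
    unfolding gen[OF tS] image_image using y by simp
  also have "\<dots> = generate (S \<times>\<times> S) {(y, \<alpha> t [^] k)}"
    unfolding gen[OF \<alpha>tS] by (simp add: hom_S_pow[OF P \<alpha> t])
  finally have eq: "map_prod (\<lambda>x\<in>carrier S. x) \<alpha> ` ?C = generate (S \<times>\<times> S) {(y, \<alpha> t [^] k)}" .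
  have "fst ` ?C \<subseteq> carrier S" "snd ` ?C \<subseteq> P" unfolding gen[OF tS] using y tP by auto
  then show "generate (S \<times>\<times> S) {(y, \<alpha> t [^] k)} \<in> diags"
    "dcls (generate (S \<times>\<times> S) {(y, \<alpha> t [^] k)}) = dcls ?C"
    using diags_map[OF C subgroup_self _ id P _ \<alpha>] unfolding eq by auto
qed

text \<open>The cyclic groups generated by (y, t^k) and (y, \<alpha>(t)^k) correspond under the pair
  of the identity and \<alpha>. Either they are twisted diagonals of the same class, or both lie
  outside the family, where marks vanish.\<close>

lemma mark_at_transport:
  assumes P: "subgroup P S" and \<alpha>: "\<alpha> \<in> hom_S P" and t: "t \<in> P" and y: "y \<in> carrier S"
  shows "mark_at (\<alpha> t) k y = mark_at t k y"
proof -
  have tS: "t \<in> carrier S" using subgroup.mem_carrier[OF P t] .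
  have \<alpha>tS: "\<alpha> t \<in> carrier S" by (rule hom_S_closed[OF P \<alpha> t])
  let ?C = "generate (S \<times>\<times> S) {(y, t [^] k)}" and ?C' = "generate (S \<times>\<times> S) {(y, \<alpha> t [^] k)}"
  let ?i = "\<lambda>y\<in>\<alpha> ` P. inv_into P \<alpha> y"
  have i: "?i (\<alpha> t) = t" using t hom_S_inj[OF P \<alpha>] by simp
  have fwd: "?C \<in> diags \<Longrightarrow> ?C' \<in> diags \<and> dcls ?C' = dcls ?C"
    using diags_generate_transport[OF P \<alpha> t y] by blast
  have "?C' \<in> diags \<Longrightarrow> ?C \<in> diags"
    using diags_generate_transport(1)[OF hom_S_image[OF P \<alpha>] hom_S_inverse[OF P \<alpha>] imageI[OF t] y, of k]
    unfolding i .
  moreover have "subgroup ?C (S \<times>\<times> S)" "subgroup ?C' (S \<times>\<times> S)"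
    using tS \<alpha>tS y by (intro fam.generate_is_subgroup; simp)+
  ultimately have "fam.mark ?C' = fam.mark ?C"
    using fwd fam.mark_stable[of ?C' ?C] fam.mark_outside[of ?C] fam.mark_outside[of ?C'] by metis
  then show ?thesis using mark_at_eq_mark tS \<alpha>tS y by simp
qed

text \<open>The triangular system is inverted by induction on k: every term other than (k, y) has j
  < k, since j = k forces z = y.\<close>

lemma weight_at_transport:
  assumes P: "subgroup P S" and \<alpha>: "\<alpha> \<in> hom_S P" and t: "t \<in> P"
  shows "\<lbrakk>k > 0; y \<in> carrier S\<rbrakk> \<Longrightarrow> weight_at (\<alpha> t) k y = weight_at t k y"
proof (induction k arbitrary: y rule: less_induct)
  case (less k)
  have tS: "t \<in> carrier S" using subgroup.mem_carrier[OF P t] .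
  have \<alpha>tS: "\<alpha> t \<in> carrier S" by (rule hom_S_closed[OF P \<alpha> t])
  let ?I = "{(j, z). j \<in> {1..k} \<and> z \<in> carrier S \<and> j dvd k \<and> z [^] (k div j) = y}"
  have finI: "finite ?I" by (rule finite_subset[of _ "{1..k} \<times> carrier S"]) (use fin in auto)
  have mem: "(k, y) \<in> ?I" using less.prems by simp
  have split: "mark_at s k y = weight_at s k y + (\<Sum>(j, z)\<in>?I - {(k, y)}. weight_at s j z)"
    if "s \<in> carrier S" for s
    using mark_at_eq_sum[OF that less.prems] sum.remove[OF finI mem, of "\<lambda>(j, z). weight_at s j z"] by simp
  have "(\<Sum>(j, z)\<in>?I - {(k, y)}. weight_at (\<alpha> t) j z) = (\<Sum>(j, z)\<in>?I - {(k, y)}. weight_at t j z)"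
  proof (rule sum.cong[OF refl])
    fix i assume i: "i \<in> ?I - {(k, y)}"
    then obtain j z where jz: "i = (j, z)" "j \<in> {1..k}" "z \<in> carrier S" "z [^] (k div j) = y" "(j, z) \<noteq> (k, y)"
      by auto
    have "j \<noteq> k" using jz less.prems by (auto simp: nat_pow_eone)
    then show "(case i of (j, z) \<Rightarrow> weight_at (\<alpha> t) j z) = (case i of (j, z) \<Rightarrow> weight_at t j z)"
      using less.IH[of j z] jz by simp
  qed
  then show ?case using split[OF tS] split[OF \<alpha>tS] mark_at_transport[OF P \<alpha> t less.prems(2)] by simp
qed

subsection \<open>The transfer of a character of the hyperfocal subgroup\<close>

context
  fixes lam :: "'a \<Rightarrow> int"
  assumes lam_hom: "mod_hom S (int p) T lam"
    and lam_conj: "\<And>g t. \<lbrakk>g \<in> carrier S; t \<in> T\<rbrakk> \<Longrightarrow> lam (g \<otimes> t \<otimes> inv g) = lam t"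
begin

text \<open>\<open>lam \<circ> \<phi> - lam\<close> is only defined on \<open>P \<inter> T\<close>; conjugation by \<open>g\<close> extends it to \<open>P\<close>.\<close>

lemma defect_hom:
  assumes P: "subgroup P S" and \<phi>: "\<phi> \<in> hom_S P"
  obtains d where "mod_hom S (int p) P d"
    "\<And>x. \<lbrakk>x \<in> P; x \<in> T\<rbrakk> \<Longrightarrow> [d x = lam (\<phi> x) - lam x] (mod (int p))"
proof -
  obtain g where g: "g \<in> carrier S" and gT: "\<And>x. x \<in> P \<Longrightarrow> inv g \<otimes> \<phi> x \<otimes> g \<otimes> inv x \<in> T"
    by (rule hom_S_conj_mod_T[OF P \<phi>]) blast
  \<comment> \<open>As \<phi>(x) and g x g^-1 agree modulo \<open>T\<close>, the argument lies in
    \<open>T\<close>. It is a crossed homomorphism in x, and the invariance of \<open>lam\<close>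
    under conjugation removes the twist.\<close>
  define d where "d x = lam (inv g \<otimes> \<phi> x \<otimes> g \<otimes> inv x)" for x
  have Pc: "\<And>x. x \<in> P \<Longrightarrow> x \<in> carrier S" by (rule subgroup.mem_carrier[OF P])
  have \<phi>c: "\<And>x. x \<in> P \<Longrightarrow> \<phi> x \<in> carrier S" by (rule hom_S_closed[OF P \<phi>])
  show thesis
  proof (rule that)
    show "mod_hom S (int p) P d"
      unfolding mod_hom_def
    proof (intro ballI)
      fix x y assume xy: "x \<in> P" "y \<in> P"
      let ?a = "inv g \<otimes> \<phi> x \<otimes> g \<otimes> inv x" and ?b = "inv g \<otimes> \<phi> y \<otimes> g \<otimes> inv y"
      have "inv g \<otimes> \<phi> (x \<otimes> y) \<otimes> g \<otimes> inv (x \<otimes> y) = ?a \<otimes> (x \<otimes> ?b \<otimes> inv x)"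
        using xy g Pc \<phi>c by (simp add: hom_S_mult[OF P \<phi> xy] inv_mult_group m_assoc)
      moreover have "x \<otimes> ?b \<otimes> inv x \<in> T" using T_conj gT xy Pc by simp
      ultimately have "[d (x \<otimes> y) = lam ?a + lam (x \<otimes> ?b \<otimes> inv x)] (mod (int p))"
        using lam_hom gT[OF xy(1)] by (simp add: d_def mod_hom_def)
      then show "[d (x \<otimes> y) = d x + d y] (mod (int p))"
        using lam_conj gT[OF xy(2)] Pc[OF xy(1)] by (simp add: d_def)
    qed
    fix x assume x: "x \<in> P" "x \<in> T"
    have \<phi>T: "\<phi> x \<in> T" by (rule hom_S_T_closed[OF P \<phi> x])
    have c: "inv g \<otimes> \<phi> x \<otimes> g = inv g \<otimes> \<phi> x \<otimes> inv (inv g)" using g by simp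
    have cT: "inv g \<otimes> \<phi> x \<otimes> g \<in> T" unfolding c using g \<phi>T by (intro T_conj) auto
    have "[d x = lam (inv g \<otimes> \<phi> x \<otimes> g) + lam (inv x)] (mod (int p))"
      using lam_hom cT subgroup.m_inv_closed[OF T_subgroup x(2)] by (simp add: d_def mod_hom_def)
    also have "lam (inv g \<otimes> \<phi> x \<otimes> g) = lam (\<phi> x)"
      unfolding c using g \<phi>T by (intro lam_conj) auto
    also have "[lam (\<phi> x) + lam (inv x) = lam (\<phi> x) + - lam x] (mod (int p))"
      using mod_hom_inv[OF lam_hom T_subgroup x(2)] by (intro cong_add) auto
    finally show "[d x = lam (\<phi> x) - lam x] (mod (int p))" by simp
  qed
qed

text \<open>The contribution of \<open>E\<close> to |S| times the \<lambda> \<circ> \<phi> part of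
  the transfer at t. The factor |S| / k spreads the value of an orbit of length k over its members
  without leaving the integers.\<close>

definition orbit_value :: "'a \<Rightarrow> ('a \<times> 'a) set \<Rightarrow> int" where
  "orbit_value t E = (let k = least_pow S (snd ` E) t in
     int (order S div k) * lam (THE y. (y, t [^] k) \<in> E))"

lemma orbit_value_eq:
  assumes "E \<in> diags" "k = least_pow S (snd ` E) t" "(y, t [^] k) \<in> E"
  shows "orbit_value t E = int (order S div k) * lam y"
proof -
  have "(THE y. (y, t [^] k) \<in> E) = y"
    using assms(3) by (rule the_equality) (use assms diags_functional in blast)
  then show ?thesis using assms(2) by (simp add: orbit_value_def Let_def)
qed

text \<open>Grouping the \<open>E\<close> by (k, y) shows that t enters only through
  \<open>weight_at\<close>, whose invariance under morphisms is known.\<close>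

lemma sum_orbit_value:
  assumes t: "t \<in> carrier S"
  shows "(\<Sum>E\<in>diags. fam.weight E * orbit_value t E) =
    (\<Sum>(k, y)\<in>{1..order S} \<times> carrier S. int (order S div k) * lam y * weight_at t k y)"
proof -
  let ?I = "{1..order S} \<times> carrier S"
  let ?A = "\<lambda>(k, y). {E. E \<in> diags \<and> least_pow S (snd ` E) t = k \<and> (y, t [^] k) \<in> E}"
  have finI: "finite ?I" using fin by simp
  have "diags = (\<Union>i\<in>?I. ?A i)"
  proof (intro equalityI subsetI)
    fix E assume E: "E \<in> diags"
    note lp = least_pow_props[OF fin snd_subgroup[OF E] t]
    obtain y where "(y, t [^] least_pow S (snd ` E) t) \<in> E" "y \<in> carrier S" using diags_least_pow[OF E t] .
    moreover have "least_pow S (snd ` E) t \<le> order S"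
      using lp(4) fin by (intro dvd_imp_le) (auto simp: order_gt_0_iff_finite)
    ultimately show "E \<in> (\<Union>i\<in>?I. ?A i)" using E lp(1) by auto
  qed auto
  then have "(\<Sum>E\<in>diags. fam.weight E * orbit_value t E) =
      (\<Sum>E\<in>(\<Union>i\<in>?I. ?A i). fam.weight E * orbit_value t E)" by simp
  also have "\<dots> = (\<Sum>i\<in>?I. \<Sum>E\<in>?A i. fam.weight E * orbit_value t E)"
    by (rule sum.UNION_disjoint[OF finI]) (auto simp: fam.finite_DD dest: diags_functional)
  also have "\<dots> = (\<Sum>i\<in>?I. case i of (k, y) \<Rightarrow> int (order S div k) * lam y * weight_at t k y)"
  proof (rule sum.cong[OF refl])
    fix i assume "i \<in> ?I"
    obtain k y where i: "i = (k, y)" by (cases i)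
    have "(\<Sum>E\<in>?A i. fam.weight E * orbit_value t E) =
        (\<Sum>E\<in>?A i. int (order S div k) * lam y * fam.weight E)"
      by (rule sum.cong[OF refl]) (auto simp: i orbit_value_eq)
    then show "(\<Sum>E\<in>?A i. fam.weight E * orbit_value t E) =
        (case i of (k, y) \<Rightarrow> int (order S div k) * lam y * weight_at t k y)"
      by (simp add: i weight_at_def sum_distrib_left)
  qed
  finally show ?thesis .
qed

lemma sum_orbit_value_transport:
  assumes P: "subgroup P S" and \<alpha>: "\<alpha> \<in> hom_S P" and t: "t \<in> P"
  shows "(\<Sum>E\<in>diags. fam.weight E * orbit_value (\<alpha> t) E) = (\<Sum>E\<in>diags. fam.weight E * orbit_value t E)"
  unfolding sum_orbit_value[OF subgroup.mem_carrier[OF P t]] sum_orbit_value[OF hom_S_closed[OF P \<alpha> t]]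
  by (rule sum.cong[OF refl]) (auto simp: weight_at_transport[OF P \<alpha> t])

text \<open>The character is the transfer of the defect of \<phi>. At t in \<open>T\<close> an orbit
  of length k through b P contributes \<lambda>(\<phi>(b^-1 t^k b)) - k \<lambda>(t); the lengths
  add up to [S:P], and \<open>V\<close> collects the first terms. In the sum over S \<times> S the
  first coordinate is absorbed by the invariance of \<lambda> and gives one factor |S|, the second
  meets each coset of \<open>P\<close> exactly |P| times, and the other |S| is the scaling in
  \<open>orbit_value\<close>.\<close>

lemma diag_transfer:
  assumes D: "D \<in> diags"
  shows "\<exists>\<chi>. mod_hom S (int p) (carrier S) \<chi> \<and> (\<forall>t\<in>T. \<exists>V.
    [\<chi> t = V - int (order S div card D) * lam t] (mod (int p)) \<and>
    (\<Sum>g\<in>carrier (S \<times>\<times> S). orbit_value t (conj_set (S \<times>\<times> S) g D)) =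
      int (card D) * int (order S) * int (order S) * V)"
proof -
  obtain P \<phi> where D_eq: "D = diag P \<phi>" and P: "subgroup P S" and \<phi>: "\<phi> \<in> hom_S P"
    using D by (rule diagsE)
  have Pc: "\<And>x. x \<in> P \<Longrightarrow> x \<in> carrier S" by (rule subgroup.mem_carrier[OF P])
  have cD: "card D = card P" by (simp add: D_eq card_diag)
  obtain d where d: "mod_hom S (int p) P d"
    and dT: "\<And>x. \<lbrakk>x \<in> P; x \<in> T\<rbrakk> \<Longrightarrow> [d x = lam (\<phi> x) - lam x] (mod (int p))"
    by (rule defect_hom[OF P \<phi>]) blast
  let ?X = "left_cosets S P"
  have cX: "order S div card P = card ?X"
    using card_left_cosets[OF fin P] card_subgroup_pos[OF P fin]
    by (metis less_numeral_extra(3) nonzero_mult_div_cancel_left)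
  show ?thesis
  proof (intro exI[of _ "transfer_map S P d"] conjI ballI)
    show "mod_hom S (int p) (carrier S) (transfer_map S P d)" by (rule transfer_mod_hom[OF fin P d])
    fix t assume tT: "t \<in> T"
    have t: "t \<in> carrier S" by (rule T_mem[OF tT])
    \<comment> \<open>Orbit length, and below it the \<lambda> \<circ> \<phi> value, at a
      representative b. Both have to be independent of b within its coset and constant along the
      t-orbit; these are the facts \<open>right\<close> and \<open>left\<close>.\<close>
    define k where "k b = least_pow S (conj_set S b P) t" for b
    define u where "u b = lam (\<phi> (inv b \<otimes> t [^] k b \<otimes> b))" for b
    have kb: "inv b \<otimes> t [^] k b \<otimes> b \<in> P" "inv b \<otimes> t [^] k b \<otimes> b \<in> T"
      "(t [^] k b) \<in> conj_set S b P" if b: "b \<in> carrier S" for b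
    proof -
      show k: "(t [^] k b) \<in> conj_set S b P"
        unfolding k_def by (rule least_pow_props(2)[OF fin subgroup_conj_set[OF fin P P b] t])
      then obtain x where x: "x \<in> P" "t [^] k b = b \<otimes> x \<otimes> inv b" by (auto simp: conj_set_def)
      then show "inv b \<otimes> t [^] k b \<otimes> b \<in> P" using b Pc by (simp add: m_assoc)
      have "inv b \<otimes> t [^] k b \<otimes> inv (inv b) \<in> T"
        using b subgroup_pow_closed[OF T_subgroup tT] by (intro T_conj) auto
      then show "inv b \<otimes> t [^] k b \<otimes> b \<in> T" using b by simp
    qed
    have right: "k (b \<otimes> q) = k b" "u (b \<otimes> q) = u b" if b: "b \<in> carrier S" and q: "q \<in> P" for b q
    proof -
      have "conj_set S q P = P"
        using conj_eq_subgroup[OF P finite_subgroup[OF P] Pc[OF q]] q P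
        by (simp add: conj_set_def subgroup.m_closed subgroup.m_inv_closed)
      then show k: "k (b \<otimes> q) = k b"
        unfolding k_def using conj_set_mult[of P b q] b Pc[OF q] subgroup.subset[OF P] by simp
      let ?z = "inv b \<otimes> t [^] k b \<otimes> b"
      have "inv (b \<otimes> q) \<otimes> t [^] k (b \<otimes> q) \<otimes> (b \<otimes> q) = inv q \<otimes> ?z \<otimes> q"
        unfolding k using b Pc[OF q] t by (simp add: inv_mult_group m_assoc)
      moreover have "\<phi> (inv q \<otimes> ?z \<otimes> q) = inv (\<phi> q) \<otimes> \<phi> ?z \<otimes> inv (inv (\<phi> q))"
        using q kb(1)[OF b] P hom_S_closed[OF P \<phi> q]
        by (simp add: hom_S_mult[OF P \<phi>] hom_S_inv[OF P \<phi>] subgroup.m_closed subgroup.m_inv_closed)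
      ultimately show "u (b \<otimes> q) = u b"
        unfolding u_def using lam_conj[OF inv_closed[OF hom_S_closed[OF P \<phi> q]] hom_S_T_closed[OF P \<phi> kb(1,2)[OF b]]]
        by simp
    qed
    have left: "k (t \<otimes> b) = k b" "u (t \<otimes> b) = u b" if b: "b \<in> carrier S" for b
    proof -
      have "t [^] j \<in> conj_set S (t \<otimes> b) P \<longleftrightarrow> t [^] j \<in> conj_set S b P" for j :: nat
      proof
        assume "t [^] j \<in> conj_set S (t \<otimes> b) P"
        then obtain x where x: "x \<in> P" "t [^] j = (t \<otimes> b) \<otimes> x \<otimes> inv (t \<otimes> b)" by (auto simp: conj_set_def)
        have comm: "t \<otimes> t [^] j = t [^] j \<otimes> t" using t nat_pow_Suc2[OF t, of j] by simp
        have "t [^] j = inv t \<otimes> (t \<otimes> t [^] j)" using t by simp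
        also have "\<dots> = inv t \<otimes> t [^] j \<otimes> t" unfolding comm using t by (simp add: m_assoc)
        also have "\<dots> = b \<otimes> x \<otimes> inv b" unfolding x(2) using t b Pc[OF x(1)] by (simp add: inv_mult_group m_assoc)
        finally show "t [^] j \<in> conj_set S b P" using x(1) by (auto simp: conj_set_def)
      next
        assume "t [^] j \<in> conj_set S b P"
        then obtain x where x: "x \<in> P" "t [^] j = b \<otimes> x \<otimes> inv b" by (auto simp: conj_set_def)
        have "t \<otimes> t [^] j = t [^] j \<otimes> t" using t nat_pow_Suc2[OF t, of j] by simp
        then have "t [^] j = t \<otimes> t [^] j \<otimes> inv t" using t by (simp add: m_assoc)
        also have "\<dots> = (t \<otimes> b) \<otimes> x \<otimes> inv (t \<otimes> b)" unfolding x(2) using t b Pc[OF x(1)] by (simp add: inv_mult_group m_assoc)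
        finally show "t [^] j \<in> conj_set S (t \<otimes> b) P" using x(1) by (auto simp: conj_set_def)
      qed
      then show k: "k (t \<otimes> b) = k b" unfolding k_def least_pow_def by simp
      have "t \<otimes> t [^] k b = t [^] k b \<otimes> t" using t nat_pow_Suc2[OF t, of "k b"] by simp
      then have "t [^] k b \<otimes> (t \<otimes> b) = t \<otimes> (t [^] k b \<otimes> b)" using t b by (simp add: m_assoc[symmetric])
      then have "inv (t \<otimes> b) \<otimes> t [^] k b \<otimes> (t \<otimes> b) = inv b \<otimes> t [^] k b \<otimes> b"
        using t b by (simp add: inv_mult_group m_assoc)
      then show "u (t \<otimes> b) = u b" unfolding u_def k by simp
    qed
    have rep: "k (coset_rep (t <# B)) = k (coset_rep B)" "u (coset_rep (t <# B)) = u (coset_rep B)"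
      if B: "B \<in> ?X" for B
    proof -
      let ?b = "coset_rep B"
      have b: "?b \<in> carrier S" "?b <# P = B" using left_coset_rep[OF fin P B] by auto
      have "t <# B \<in> ?X"
        using finite_action.act_closed[OF left_cosets_action[OF fin P] t B] .
      then have mem: "coset_rep (t <# B) \<in> t <# B" by (rule left_coset_rep(1)[OF fin P])
      have "t <# B = (t \<otimes> ?b) <# P"
        using lcos_m_assoc[OF subgroup.subset[OF P] t b(1)] b(2) by simp
      then have "coset_rep (t <# B) \<in> (t \<otimes> ?b) <# P" using mem by simp
      then obtain q where q: "q \<in> P" "coset_rep (t <# B) = (t \<otimes> ?b) \<otimes> q"
        using in_l_cosetD[of "coset_rep (t <# B)" S "t \<otimes> ?b" P] by blast
      then show "k (coset_rep (t <# B)) = k ?b" "u (coset_rep (t <# B)) = u ?b"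
        using right[of "t \<otimes> ?b" q] left[OF b(1)] t b(1) by simp_all
    qed
    obtain V where V: "[transfer_map S P d t = V] (mod (int p))"
      "int (order S) * V = (\<Sum>B\<in>?X. int (order S div least_pow S (conj_set S (coset_rep B) P) t)
        * (u (coset_rep B) - int (k (coset_rep B)) * lam t))"
    proof (rule transfer_eval[OF fin P d t, where v = "\<lambda>B. u (coset_rep B) - int (k (coset_rep B)) * lam t"])
      fix B assume "B \<in> ?X"
      then show "u (coset_rep (t <# B)) - int (k (coset_rep (t <# B))) * lam t =
          u (coset_rep B) - int (k (coset_rep B)) * lam t" using rep by simp
    next
      fix B k' assume B: "B \<in> ?X" and k': "k' = least_pow S (conj_set S (coset_rep B) P) t"
      let ?b = "coset_rep B"
      have b: "?b \<in> carrier S" using left_coset_rep[OF fin P B] by auto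
      have kk: "k' = k ?b" using k' by (simp add: k_def)
      let ?z = "inv ?b \<otimes> t [^] k ?b \<otimes> ?b"
      have "[d ?z = u ?b - lam ?z] (mod (int p))" unfolding u_def by (rule dT[OF kb(1,2)[OF b]])
      also have "lam ?z = lam (t [^] k ?b)"
        using lam_conj[OF inv_closed[OF b] subgroup_pow_closed[OF T_subgroup tT]] b by simp
      also have "[u ?b - lam (t [^] k ?b) = u ?b - int (k ?b) * lam t] (mod (int p))"
        using mod_hom_pow[OF lam_hom T_subgroup tT] by (intro cong_diff) auto
      finally show "[d (inv ?b \<otimes> t [^] k' \<otimes> ?b) = u ?b - int (k ?b) * lam t] (mod (int p))"
        unfolding kk .
    qed blast
    \<comment> \<open>Adding back [S:P] \<lambda>(t) leaves only the \<lambda> \<circ> \<phi> part,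
      for which an exact identity holds after scaling by |S|.\<close>
    let ?V = "V + int (card ?X) * lam t"
    have kd: "k b dvd order S" if "b \<in> carrier S" for b
      unfolding k_def by (rule least_pow_props(4)[OF fin subgroup_conj_set[OF fin P P that] t])
    have SV: "int (order S) * ?V = (\<Sum>B\<in>?X. int (order S div k (coset_rep B)) * u (coset_rep B))"
    proof -
      have "int (order S) * V = (\<Sum>B\<in>?X. int (order S div k (coset_rep B)) * u (coset_rep B) - int (order S) * lam t)"
        unfolding V(2) k_def[symmetric]
      proof (rule sum.cong[OF refl])
        fix B assume B: "B \<in> ?X"
        let ?k = "k (coset_rep B)"
        have "?k dvd order S" using kd left_coset_rep(2)[OF fin P B] by blast
        then have "int (order S div ?k) * int ?k = int (order S)" by (simp flip: of_nat_mult)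
        then show "int (order S div ?k) * (u (coset_rep B) - int ?k * lam t) =
            int (order S div ?k) * u (coset_rep B) - int (order S) * lam t"
          by (simp add: right_diff_distrib mult.assoc[symmetric])
      qed
      then show ?thesis by (simp add: sum_subtractf algebra_simps)
    qed
    have ov: "orbit_value t (conj_set (S \<times>\<times> S) (a, b) D) = int (order S div k b) * u b"
      if a: "a \<in> carrier S" and b: "b \<in> carrier S" for a b
    proof -
      let ?E = "conj_set (S \<times>\<times> S) (a, b) D" and ?z = "inv b \<otimes> t [^] k b \<otimes> b"
      have E: "?E \<in> diags" using diags_conj(1)[OF D] a b by simp
      have "?E = (\<lambda>x. (a \<otimes> \<phi> x \<otimes> inv a, b \<otimes> x \<otimes> inv b)) ` P"
        unfolding conj_set_DirProd[OF a b] D_eq diag_def image_image by simp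
      moreover from this have "snd ` ?E = conj_set S b P" by (auto simp: conj_set_def image_image)
      moreover have "b \<otimes> ?z \<otimes> inv b = t [^] k b" using b t by (simp add: m_assoc)
      ultimately have "(a \<otimes> \<phi> ?z \<otimes> inv a, t [^] k b) \<in> ?E" "k b = least_pow S (snd ` ?E) t"
        using kb(1)[OF b] by (auto simp: k_def intro!: rev_image_eqI[of ?z])
      from orbit_value_eq[OF E this(2,1)]
      show ?thesis using lam_conj[OF a hom_S_T_closed[OF P \<phi> kb(1,2)[OF b]]] by (simp add: u_def)
    qed
    show "\<exists>V. [transfer_map S P d t = V - int (order S div card D) * lam t] (mod (int p)) \<and>
      (\<Sum>g\<in>carrier (S \<times>\<times> S). orbit_value t (conj_set (S \<times>\<times> S) g D)) =
        int (card D) * int (order S) * int (order S) * V"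
    proof (intro exI conjI)
      show "[transfer_map S P d t = ?V - int (order S div card D) * lam t] (mod (int p))"
        using V(1) by (simp add: cD cX)
      have "(\<Sum>g\<in>carrier (S \<times>\<times> S). orbit_value t (conj_set (S \<times>\<times> S) g D)) =
          (\<Sum>(a, b)\<in>carrier S \<times> carrier S. int (order S div k b) * u b)"
        by (rule sum.cong) (auto simp: ov)
      also have "\<dots> = (\<Sum>a\<in>carrier S. \<Sum>b\<in>carrier S. int (order S div k b) * u b)"
        by (rule sum.cartesian_product[symmetric])
      also have "\<dots> = int (order S) * (\<Sum>b\<in>carrier S. int (order S div k b) * u b)"
        by (simp add: order_def)
      also have "(\<Sum>b\<in>carrier S. int (order S div k b) * u b) =
          int (card P) * (\<Sum>B\<in>?X. int (order S div k (coset_rep B)) * u (coset_rep B))"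
        by (rule sum_over_cosets[OF fin P]) (simp add: right)
      finally show "(\<Sum>g\<in>carrier (S \<times>\<times> S). orbit_value t (conj_set (S \<times>\<times> S) g D)) =
          int (card D) * int (order S) * int (order S) * ?V"
        unfolding SV[symmetric] cD by (simp add: mult_ac)
    qed
  qed
qed

end

end

section \<open>Orbit multiplicities, the degree of the biset, and the character of S\<close>

lemma (in group) mod_hom_sum:
  assumes "\<And>i. i \<in> I \<Longrightarrow> mod_hom G m P (f i)"
  shows "mod_hom G m P (\<lambda>x. \<Sum>i\<in>I. c i * f i x)"
  unfolding mod_hom_def
proof (intro ballI)
  fix x y assume xy: "x \<in> P" "y \<in> P"
  have "[(\<Sum>i\<in>I. c i * f i (x \<otimes> y)) = (\<Sum>i\<in>I. c i * (f i x + f i y))] (mod m)"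
    using assms xy by (intro cong_sum cong_mult) (auto simp: mod_hom_def)
  then show "[(\<Sum>i\<in>I. c i * f i (x \<otimes> y)) = (\<Sum>i\<in>I. c i * f i x) + (\<Sum>i\<in>I. c i * f i y)] (mod m)"
    by (simp add: distrib_left sum.distrib)
qed

lemma (in group) mod_hom_kernel_subgroup:
  assumes \<chi>: "mod_hom G m P \<chi>" and P: "subgroup P G"
  shows "subgroup {x \<in> P. [\<chi> x = 0] (mod m)} G"
proof (rule subgroupI)
  show "{x \<in> P. [\<chi> x = 0] (mod m)} \<subseteq> carrier G" using subgroup.subset[OF P] by auto
  show "{x \<in> P. [\<chi> x = 0] (mod m)} \<noteq> {}"
    using mod_hom_one[OF \<chi> P] subgroup.one_closed[OF P] by blast
  fix a b assume a: "a \<in> {x \<in> P. [\<chi> x = 0] (mod m)}"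
  have "[\<chi> (inv a) = - \<chi> a] (mod m)" using a mod_hom_inv[OF \<chi> P] by simp
  also have "[- \<chi> a = 0] (mod m)" using a by (simp add: cong_0_iff)
  finally show "inv a \<in> {x \<in> P. [\<chi> x = 0] (mod m)}"
    using a subgroup.m_inv_closed[OF P] by simp
  assume b: "b \<in> {x \<in> P. [\<chi> x = 0] (mod m)}"
  have "[\<chi> (a \<otimes> b) = \<chi> a + \<chi> b] (mod m)" using \<chi> a b by (simp add: mod_hom_def)
  also have "[\<chi> a + \<chi> b = 0 + 0] (mod m)" using a b by (intro cong_add) auto
  finally show "a \<otimes> b \<in> {x \<in> P. [\<chi> x = 0] (mod m)}" using a b subgroup.m_closed[OF P] by simp
qed

context saturated_fusion
begin

interpretation A: finite_action "S \<times>\<times> S" diags "conj_set (S \<times>\<times> S)"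
proof (rule finite_action.intro[OF DirProd_group[OF is_group is_group] finite_action_axioms.intro])
  show "finite (carrier (S \<times>\<times> S))" "finite diags" using fin fam.finite_DD by auto
  fix g h D assume D: "D \<in> diags"
  show "conj_set (S \<times>\<times> S) \<one>\<^bsub>S \<times>\<times> S\<^esub> D = D" by (rule fam.conj_set_one[OF fam.DD_carrier[OF D]])
  assume g: "g \<in> carrier (S \<times>\<times> S)"
  show "conj_set (S \<times>\<times> S) g D \<in> diags" by (rule diags_conj(1)[OF D g])
  assume h: "h \<in> carrier (S \<times>\<times> S)"
  show "conj_set (S \<times>\<times> S) (g \<otimes>\<^bsub>S \<times>\<times> S\<^esub> h) D = conj_set (S \<times>\<times> S) g (conj_set (S \<times>\<times> S) h D)"
    by (rule fam.conj_set_mult[OF fam.DD_carrier[OF D] g h])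
qed

text \<open>The multiplicity of the orbit \<open>(S \<times> S) / D\<close> in the virtual biset.\<close>

definition coef :: "('a \<times> 'a) set \<Rightarrow> int" where
  "coef D = int (card D) * fam.weight D div int (card (normalizer (S \<times>\<times> S) D))"

lemma stab_eq_normalizer: "D \<in> diags \<Longrightarrow> A.stab D = normalizer (S \<times>\<times> S) D"
  using fam.normalizer_conj_set[OF diags_subgroup fam.finite_member, of D] by (auto simp: A.stab_def)

text \<open>Weights are constant on an orbit and the stabilizer of \<open>D\<close> is its
  normalizer. The factor |D| is what makes the division in \<open>coef\<close> exact.\<close>

lemma orbit_sum:
  fixes f :: "('a \<times> 'a) set \<Rightarrow> int"
  assumes D: "D \<in> diags"
  shows "int (card D) * (\<Sum>E\<in>A.orb D. fam.weight E * f E) =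
    coef D * (\<Sum>g\<in>carrier (S \<times>\<times> S). f (conj_set (S \<times>\<times> S) g D))"
proof -
  have "(\<Sum>E\<in>A.orb D. fam.weight E * f E) = (\<Sum>E\<in>A.orb D. fam.weight D * f E)"
    by (rule sum.cong) (auto simp: A.orb_def fam.weight_conj[OF D])
  then have "int (card D) * (\<Sum>E\<in>A.orb D. fam.weight E * f E) =
      (int (card D) * fam.weight D) * sum f (A.orb D)" by (simp add: sum_distrib_left mult.assoc)
  also have "int (card D) * fam.weight D = coef D * int (card (A.stab D))"
    using fam.weight_dvd[OF D] by (simp add: coef_def stab_eq_normalizer[OF D])
  finally show ?thesis using A.sum_act[OF D, of f] by (simp add: mult.assoc)
qed

definition orbit_reps :: "('a \<times> 'a) set set" where
  "orbit_reps = (\<lambda>R. SOME D. D \<in> R) ` A.orb ` diags"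

lemma orbit_reps_subset: "orbit_reps \<subseteq> diags"
proof
  fix D assume "D \<in> orbit_reps"
  then obtain E where E: "E \<in> diags" "D = (SOME D. D \<in> A.orb E)" by (auto simp: orbit_reps_def)
  have "D \<in> A.orb E" unfolding E(2) using A.orb_refl[OF E(1)] by (rule someI)
  then show "D \<in> diags" using A.orb_subset[OF E(1)] by blast
qed

lemma finite_orbit_reps: "finite orbit_reps"
  using fam.finite_DD by (simp add: orbit_reps_def)

lemma sum_orbit_reps:
  fixes f :: "('a \<times> 'a) set \<Rightarrow> int"
  shows "sum f diags = (\<Sum>D\<in>orbit_reps. sum f (A.orb D))"
proof -
  have *: "A.orb (SOME D. D \<in> R) = R" if "R \<in> A.orb ` diags" for R
  proof -
    obtain E where E: "E \<in> diags" "R = A.orb E" using \<open>R \<in> A.orb ` diags\<close> by blast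
    have "(SOME D. D \<in> R) \<in> A.orb E" unfolding E(2) using A.orb_refl[OF E(1)] by (rule someI)
    then show ?thesis using A.orb_eq[OF E(1)] E(2) by simp
  qed
  then have "inj_on (\<lambda>R. SOME D. D \<in> R) (A.orb ` diags)"
    by (intro inj_on_inverseI[of _ A.orb]) simp
  then have "(\<Sum>D\<in>orbit_reps. sum f (A.orb D)) = (\<Sum>R\<in>A.orb ` diags. sum f (A.orb (SOME D. D \<in> R)))"
    unfolding orbit_reps_def by (rule sum.reindex[unfolded comp_def])
  also have "\<dots> = (\<Sum>R\<in>A.orb ` diags. sum f R)" using * by (intro sum.cong) auto
  finally show ?thesis using A.sum_orbits[of f] by simp
qed

lemma card_diags_le: "D \<in> diags \<Longrightarrow> card D dvd order S" and card_diags_pos: "D \<in> diags \<Longrightarrow> card D > 0"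
  by (auto elim!: diagsE simp: card_diag card_subgroup_dvd card_subgroup_pos[OF _ fin])

lemma orbit_sum_const:
  assumes D: "D \<in> diags" and top: "card D = order S"
  shows "(\<Sum>E\<in>A.orb D. fam.weight E) = coef D * int (order S)"
proof -
  have "int (order S) * (\<Sum>E\<in>A.orb D. fam.weight E) = coef D * int (card (carrier (S \<times>\<times> S)))"
    using orbit_sum[OF D, of "\<lambda>_. 1"] top by simp
  also have "\<dots> = int (order S) * (coef D * int (order S))"
    by (simp add: order_def card_cartesian_product)
  finally show ?thesis using card_diags_pos[OF D] top by simp
qed

text \<open>Modulo \<open>p\<close> only the \<open>D\<close> of order |S| count; they are the
  graphs of the elements of Aut_F(S). All have the full diagonal as \<open>drep\<close> and nothing
  above them, hence the same weight, and the multiplicities of their orbits add up to |Aut_F(S) :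
  Inn(S)|. This is prime to \<open>p\<close>, as Inn(S) is a Sylow subgroup of Aut_F(S).\<close>

lemma degree_not_dvd: "\<not> int p dvd (\<Sum>D\<in>orbit_reps. coef D * int (order S div card D))"
proof
  let ?N = "\<Sum>D\<in>orbit_reps. coef D * int (order S div card D)"
  let ?R1 = "{D \<in> orbit_reps. card D = order S}"
  let ?D0 = "(\<lambda>x. (x, x)) ` carrier S"
  let ?n0 = "card (normalizer (S \<times>\<times> S) ?D0)"
  let ?tops = "{E \<in> diags. card E = order S}"
  have S: "subgroup (carrier S) S" by (rule subgroup_self)
  have pos: "order S > 0" using fin by (simp add: order_gt_0_iff_finite)
  assume N: "int p dvd ?N"
  have "?N = (\<Sum>D\<in>?R1. coef D * int (order S div card D)) +
      (\<Sum>D\<in>orbit_reps - ?R1. coef D * int (order S div card D))"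
    by (subst sum.subset_diff[of ?R1]) (auto simp: finite_orbit_reps)
  also have "(\<Sum>D\<in>?R1. coef D * int (order S div card D)) = sum coef ?R1"
    by (rule sum.cong) (use pos in auto)
  finally have N_eq: "?N = sum coef ?R1 + (\<Sum>D\<in>orbit_reps - ?R1. coef D * int (order S div card D))" .
  have "int p dvd (\<Sum>D\<in>orbit_reps - ?R1. coef D * int (order S div card D))"
  proof (rule dvd_sum)
    fix D assume D: "D \<in> orbit_reps - ?R1"
    then have dv: "card D dvd order S" using orbit_reps_subset card_diags_le by blast
    then have eq: "card D * (order S div card D) = p ^ n" using ord by simp
    then obtain i where i: "order S div card D = p ^ i" by (metis divides_primepow_nat[OF p] dvd_triv_right)
    have "i \<noteq> 0"
    proof
      assume "i = 0"
      then have "card D = order S" using eq i ord by simp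
      then show False using D by simp
    qed
    then show "int p dvd coef D * int (order S div card D)" using i by simp
  qed
  then have p1: "int p dvd sum coef ?R1" using N N_eq by (simp add: dvd_add_left_iff)
  have tops_diag: "?tops = diag (carrier S) ` F (carrier S) (carrier S)"
  proof (intro equalityI subsetI)
    fix E assume E: "E \<in> ?tops"
    then obtain P \<phi> where *: "E = diag P \<phi>" "subgroup P S" "\<phi> \<in> hom_S P" by (auto elim: diagsE)
    then have "P = carrier S"
      using E fin subgroup.subset[OF *(2)] by (simp add: card_diag order_def card_subset_eq)
    then show "E \<in> diag (carrier S) ` F (carrier S) (carrier S)" using * by blast
  qed (auto intro: diagsI[OF S] simp: card_diag order_def)
  have "inj_on (diag (carrier S)) (F (carrier S) (carrier S))"
  proof (rule inj_onI)
    fix \<phi> \<psi> assume *: "\<phi> \<in> F (carrier S) (carrier S)" "\<psi> \<in> F (carrier S) (carrier S)"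
      "diag (carrier S) \<phi> = diag (carrier S) \<psi>"
    have "\<phi> x = \<psi> x" if "x \<in> carrier S" for x
    proof -
      have "(\<phi> x, x) \<in> diag (carrier S) \<psi>" unfolding *(3)[symmetric] using that by (auto simp: diag_def)
      then show ?thesis by (auto simp: diag_def)
    qed
    then show "\<phi> = \<psi>" using hom_S_ext[OF S *(1)] hom_S_ext[OF S *(2)] by (intro extensionalityI)
  qed
  note inj = this
  have ctops: "card ?tops = card (F (carrier S) (carrier S))"
    unfolding tops_diag using inj by (rule card_image)
  have cD0: "card ?D0 = order S" unfolding order_def by (rule card_image) (auto simp: inj_on_def)
  have D0: "?D0 \<in> diags" by (rule diag_id[OF S])
  have no_upper: "fam.upper E = 0" if "E \<in> diags" "card E = order S" for E
  proof -
    have "{E'. E' \<in> diags \<and> E \<subset> E'} = {}"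
      using fam.card_less[of E] that card_diags_le pos
      by (fastforce dest: dvd_imp_le)
    then show ?thesis unfolding fam.upper_def by (simp only: sum.empty)
  qed
  have rep: "drep E = ?D0" if E: "E \<in> ?tops" for E
  proof -
    obtain \<phi> where \<phi>: "E = diag (carrier S) \<phi>" using E unfolding tops_diag by blast
    obtain Q \<theta> where Q: "\<theta> \<in> hom_S (carrier S)" "\<theta> ` carrier S = Q"
      "drep (diag (carrier S) \<phi>) = (\<lambda>x. (x, x)) ` Q" using drep_props[OF S] by metis
    have "card Q = card (carrier S)" using Q(2) card_image[OF hom_S_inj[OF S Q(1)]] by simp
    moreover have "Q \<subseteq> carrier S" using subgroup.subset[OF hom_S_image[OF S Q(1)]] Q(2) by simp
    ultimately have "Q = carrier S" using fin by (simp add: card_subset_eq)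
    then show ?thesis using Q(3) \<phi> by simp
  qed
  have wt: "fam.weight E = int (?n0 div order S)" if "E \<in> ?tops" for E
    using fam.weight_eq[of E] rep[OF that] no_upper that D0 cD0 by simp
  have sumR1: "int (order S) * sum coef ?R1 = int (card ?tops) * int (?n0 div order S)"
  proof -
    let ?f = "\<lambda>E. if card E = order S then fam.weight E else 0"
    have "sum ?f diags = (\<Sum>E\<in>?tops. fam.weight E)"
      using fam.finite_DD by (simp add: sum.inter_filter)
    also have "\<dots> = (\<Sum>E\<in>?tops. int (?n0 div order S))" using wt by (intro sum.cong) auto
    finally have 1: "sum ?f diags = int (card ?tops) * int (?n0 div order S)" by simp
    have orbf: "sum ?f (A.orb D) = (if card D = order S then coef D * int (order S) else 0)"
      if D: "D \<in> orbit_reps" for D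
    proof -
      have D': "D \<in> diags" using D orbit_reps_subset by blast
      have c: "card E = card D" if "E \<in> A.orb D" for E
        using that fam.card_conj_set[OF fam.DD_carrier[OF D']] by (auto simp: A.orb_def)
      show ?thesis
      proof (cases "card D = order S")
        case True
        have "sum ?f (A.orb D) = sum fam.weight (A.orb D)" using c True by (intro sum.cong) auto
        then show ?thesis using orbit_sum_const[OF D' True] True by simp
      next
        case False
        then show ?thesis using c by (simp add: sum.neutral)
      qed
    qed
    have "sum ?f diags = (\<Sum>D\<in>orbit_reps. if card D = order S then coef D * int (order S) else 0)"
      unfolding sum_orbit_reps by (rule sum.cong[OF refl]) (rule orbf)
    also have "\<dots> = (\<Sum>D\<in>?R1. coef D * int (order S))"
      using finite_orbit_reps by (simp add: sum.inter_filter)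
    also have "\<dots> = int (order S) * sum coef ?R1" by (simp add: sum_distrib_left mult.commute)
    finally show ?thesis using 1 by simp
  qed
  \<comment> \<open>The pair (a, b) carries the diagonal to the graph of conjugation by a b^-1. The
    orbit thus has |Inn(S)| elements, which determines the order of the normalizer of the
    diagonal.\<close>
  have orbD0: "A.orb ?D0 = diag (carrier S) ` conj_hom S (carrier S) (carrier S)"
  proof -
    have 1: "conj_set (S \<times>\<times> S) (a, b) ?D0 = diag (carrier S) (conj_map S (a \<otimes> inv b) (carrier S))"
      if "a \<in> carrier S" "b \<in> carrier S" for a b
    proof -
      have "conj_set (S \<times>\<times> S) (a, b) ?D0 = (\<lambda>x. (a \<otimes> x \<otimes> inv a, b \<otimes> x \<otimes> inv b)) ` carrier S"
        unfolding conj_set_DirProd[OF that] image_image by simp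
      also have "\<dots> = (\<lambda>x. (a \<otimes> inv b \<otimes> x \<otimes> inv (a \<otimes> inv b), x)) ` (\<lambda>x. b \<otimes> x \<otimes> inv b) ` carrier S"
        unfolding image_image
        by (rule image_cong[OF refl]) (use that in \<open>simp add: inv_mult_group m_assoc\<close>)
      also have "(\<lambda>x. b \<otimes> x \<otimes> inv b) ` carrier S = carrier S"
        using conj_eq_subgroup[OF S fin that(2)] that(2) by simp
      finally show ?thesis unfolding diag_def conj_map_def by (simp cong: image_cong)
    qed
    show ?thesis
    proof (intro equalityI subsetI)
      fix E assume "E \<in> A.orb ?D0"
      then obtain a b where ab: "a \<in> carrier S" "b \<in> carrier S" "E = conj_set (S \<times>\<times> S) (a, b) ?D0"
        by (auto simp: A.orb_def)
      have "conj_map S (a \<otimes> inv b) (carrier S) \<in> conj_hom S (carrier S) (carrier S)"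
        using ab by (auto simp: conj_hom_def conj_map_def intro!: exI[of _ "a \<otimes> inv b"])
      then show "E \<in> diag (carrier S) ` conj_hom S (carrier S) (carrier S)" using 1[OF ab(1,2)] ab(3) by blast
    next
      fix E assume "E \<in> diag (carrier S) ` conj_hom S (carrier S) (carrier S)"
      then obtain g where g: "g \<in> carrier S" "E = diag (carrier S) (conj_map S g (carrier S))"
        by (auto simp: conj_hom_def)
      then have "E = conj_set (S \<times>\<times> S) (g, \<one>) ?D0" using 1[of g \<one>] by simp
      then show "E \<in> A.orb ?D0" using g(1) unfolding A.orb_def by (intro image_eqI[of _ _ "(g, \<one>)"]) auto
    qed
  qed
  let ?I = "conj_hom S (carrier S) (carrier S)" and ?Au = "aut_group F (carrier S)"
  have "?I \<subseteq> F (carrier S) (carrier S)" using F_conj_hom[OF S S] by blast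
  then have cI: "card (A.orb ?D0) = card ?I"
    unfolding orbD0 using inj by (intro card_image) (rule inj_on_subset)
  have In: "card ?I * ?n0 = order S * order S"
    using A.card_orb_stab[OF D0] cI stab_eq_normalizer[OF D0] by (simp add: order_def card_cartesian_product)
  have dv: "order S dvd ?n0"
    using fam.card_subgroup_dvd'[OF diags_subgroup[OF D0] fam.subgroup_normalizer[OF diags_subgroup[OF D0]]
        fam.subset_normalizer[OF diags_subgroup[OF D0] fam.finite_member[OF D0]]] cD0 by simp
  \<comment> \<open>This is |Z(S)|: the normalizer of the diagonal consists of the pairs (a, b) with
    a b^-1 central.\<close>
  define \<kappa> where "\<kappa> = ?n0 div order S"
  have n0: "?n0 = \<kappa> * order S" using dv by (simp add: \<kappa>_def)
  have I\<kappa>: "card ?I * \<kappa> = order S" using In pos by (simp add: n0)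
  have "\<kappa> > 0" using I\<kappa> pos by (metis mult_0_right neq0_conv)
  have "int (card ?I) * int \<kappa> * sum coef ?R1 = int (order ?Au) * int \<kappa>"
  proof -
    have "int (card ?I) * int \<kappa> = int (order S)" using I\<kappa> by (simp flip: of_nat_mult)
    moreover have "order ?Au = card (F (carrier S) (carrier S))" by (simp add: order_def)
    ultimately show ?thesis using sumR1[folded \<kappa>_def] by (simp only: ctops)
  qed
  then have Isum: "int (card ?I) * sum coef ?R1 = int (order ?Au)" using \<open>\<kappa> > 0\<close> by simp
  have cIp: "card ?I = p ^ multiplicity p (order ?Au)"
    using fully_normalized_sylow[OF S fully_normalized_carrier] by (simp add: sylow_subgroup_def)
  have "int p * int (card ?I) dvd int (order ?Au)"
    unfolding Isum[symmetric] using p1 by (simp add: mult.commute mult_dvd_mono)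
  then have "p ^ Suc (multiplicity p (order ?Au)) dvd order ?Au"
    by (simp add: cIp flip: of_nat_mult of_nat_power)
  moreover have "order ?Au > 0"
    using finite_aut[OF S] group_aut[OF S] by (simp add: monoid.order_gt_0_iff_finite group.is_monoid)
  ultimately show False using not_Suc_multiplicity_dvd[OF p] by blast
qed

lemma invariant_mod_hom_vanishes:
  assumes \<tau>: "mod_hom S (int p) T \<tau>"
    and stable: "\<And>P \<alpha> t. \<lbrakk>subgroup P S; \<alpha> \<in> hom_S P; t \<in> P; t \<in> T\<rbrakk> \<Longrightarrow> \<tau> (\<alpha> t) = \<tau> t"
    and t: "t \<in> T"
  shows "[\<tau> t = 0] (mod (int p))"
proof -
  let ?K = "{x \<in> T. [\<tau> x = 0] (mod (int p))}"
  have K: "subgroup ?K S" by (rule mod_hom_kernel_subgroup[OF \<tau> T_subgroup])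
  have "p'_commutators p \<subseteq> ?K"
  proof
    fix u assume u: "u \<in> p'_commutators p"
    then obtain P x \<alpha> m where P: "subgroup P S" and x: "x \<in> P" and \<alpha>: "\<alpha> \<in> F P P"
      and u_eq: "u = inv x \<otimes> \<alpha> x" and m: "\<not> p dvd m" "\<forall>y\<in>P. (\<alpha> ^^ m) y = y"
      by (auto simp: p'_commutators_def)
    have \<alpha>S: "\<alpha> \<in> hom_S P" by (rule F_to_S[OF P P \<alpha>])
    have Pc: "\<And>x. x \<in> P \<Longrightarrow> x \<in> carrier S" by (rule subgroup.mem_carrier[OF P])
    have cl: "\<And>y. y \<in> P \<Longrightarrow> \<alpha> y \<in> P" using aut_Bij(2)[OF P \<alpha>] by blast
    have pcl: "(\<alpha> ^^ j) y \<in> P" if "y \<in> P" for y j by (induction j) (use that cl in auto)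
    have pmul: "(\<alpha> ^^ j) (y \<otimes> z) = (\<alpha> ^^ j) y \<otimes> (\<alpha> ^^ j) z" if "y \<in> P" "z \<in> P" for y z j
      by (induction j) (use that pcl hom_S_mult[OF P \<alpha>S] in auto)
    have uT: "u \<in> T" using u by (auto simp: hyperfocal_eq_p'[OF p] intro: generate.incl)
    have uP: "u \<in> P" unfolding u_eq using x cl P by (simp add: subgroup.m_closed subgroup.m_inv_closed)
    have \<alpha>u: "(\<alpha> ^^ j) u \<in> T \<and> \<tau> ((\<alpha> ^^ j) u) = \<tau> u" for j
      by (induction j) (use uT stable[OF P \<alpha>S pcl[OF uP]] hom_S_T_closed[OF P \<alpha>S pcl[OF uP]] in auto)
    \<comment> \<open>telescoping: the product of the \<open>\<alpha>\<^sup>i(u)\<close>, \<open>i < j\<close>, is \<open>x\<^sup>-\<^sup>1 \<alpha>\<^sup>j(x)\<close>\<close>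
    have tele: "inv x \<otimes> (\<alpha> ^^ j) x \<in> T \<and> [\<tau> (inv x \<otimes> (\<alpha> ^^ j) x) = int j * \<tau> u] (mod (int p))" for j
    proof (induction j)
      case 0
      then show ?case
        using Pc[OF x] mod_hom_one[OF \<tau> T_subgroup] subgroup.one_closed[OF T_subgroup] by simp
    next
      case (Suc j)
      have "(\<alpha> ^^ Suc j) x = (\<alpha> ^^ j) (x \<otimes> u)"
        unfolding u_eq using Pc x cl by (simp add: funpow_swap1)
      then have eq: "inv x \<otimes> (\<alpha> ^^ Suc j) x = (inv x \<otimes> (\<alpha> ^^ j) x) \<otimes> (\<alpha> ^^ j) u"
        using Pc x pcl[OF x] pcl[OF uP] by (simp add: pmul[OF x uP] m_assoc)
      have "[\<tau> (inv x \<otimes> (\<alpha> ^^ Suc j) x) = \<tau> (inv x \<otimes> (\<alpha> ^^ j) x) + \<tau> ((\<alpha> ^^ j) u)] (mod (int p))"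
        unfolding eq using \<tau> conjunct1[OF Suc] conjunct1[OF \<alpha>u[of j]] unfolding mod_hom_def by blast
      also have "[\<tau> (inv x \<otimes> (\<alpha> ^^ j) x) + \<tau> ((\<alpha> ^^ j) u) = int j * \<tau> u + \<tau> u] (mod (int p))"
        using Suc \<alpha>u by (intro cong_add) auto
      finally have "[\<tau> (inv x \<otimes> (\<alpha> ^^ Suc j) x) = int (Suc j) * \<tau> u] (mod (int p))"
        by (simp add: algebra_simps)
      then show ?case unfolding eq using Suc \<alpha>u subgroup.m_closed[OF T_subgroup] by blast
    qed
    have "[\<tau> \<one> = int m * \<tau> u] (mod (int p))" using tele[of m] m(2) x Pc[OF x] by simp
    then have "[int m * \<tau> u = 0] (mod (int p))"
      using mod_hom_one[OF \<tau> T_subgroup] by (metis cong_sym cong_trans)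
    then have "int p dvd int m * \<tau> u" by (simp add: cong_0_iff)
    then have "int p dvd \<tau> u"
      using p m(1) by (metis int_dvd_int_iff prime_dvd_multD prime_nat_int_transfer)
    then show "u \<in> ?K" using uT by (simp add: cong_0_iff)
  qed
  then have "T \<subseteq> ?K" unfolding hyperfocal_eq_p'[OF p] by (rule generate_subgroup_incl[OF _ K[unfolded hyperfocal_eq_p'[OF p]]])
  then show ?thesis using t by blast
qed

text \<open>The number \<tau>(t) is an exact integer, fixed by |S|^2 \<tau>(t) being the sum of
  weights times orbit values. That sum is F-invariant, and |S|^2, although in general divisible by
  \<open>p\<close>, cancels in the integers; so \<tau> is invariant as an integer function.\<close>

lemma lam_extends:
  assumes lam: "mod_hom S (int p) T lam"
    "\<And>g t. \<lbrakk>g \<in> carrier S; t \<in> T\<rbrakk> \<Longrightarrow> lam (g \<otimes> t \<otimes> inv g) = lam t"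
  obtains \<chi> c where "mod_hom S (int p) (carrier S) \<chi>" "\<not> int p dvd c"
    "\<And>t. t \<in> T \<Longrightarrow> [\<chi> t = c * lam t] (mod (int p))"
proof -
  let ?o = "int (order S)"
  have pos: "?o > 0" using fin by (simp add: order_gt_0_iff_finite)
  define v where "v t D V \<longleftrightarrow> (\<Sum>g\<in>carrier (S \<times>\<times> S). orbit_value lam t (conj_set (S \<times>\<times> S) g D)) =
      int (card D) * ?o * ?o * V" for t D V
  have "\<forall>D\<in>orbit_reps. \<exists>\<chi>. mod_hom S (int p) (carrier S) \<chi> \<and> (\<forall>t\<in>T. \<exists>V.
    [\<chi> t = V - int (order S div card D) * lam t] (mod (int p)) \<and> v t D V)"
    using diag_transfer[OF lam] orbit_reps_subset unfolding v_def by blast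
  then obtain \<xi> where \<xi>: "\<And>D. D \<in> orbit_reps \<Longrightarrow> mod_hom S (int p) (carrier S) (\<xi> D)"
    "\<And>D t. \<lbrakk>D \<in> orbit_reps; t \<in> T\<rbrakk> \<Longrightarrow> \<exists>V.
      [\<xi> D t = V - int (order S div card D) * lam t] (mod (int p)) \<and> v t D V"
    by (metis (lifting) bchoice)
  define \<chi> where "\<chi> t = (\<Sum>D\<in>orbit_reps. coef D * \<xi> D t)" for t
  define c where "c = (\<Sum>D\<in>orbit_reps. coef D * int (order S div card D))"
  have \<chi>: "mod_hom S (int p) (carrier S) \<chi>"
    using mod_hom_sum[of orbit_reps, OF \<xi>(1)] by (simp add: \<chi>_def[abs_def])
  have "\<exists>\<tau>. [\<chi> t = \<tau> - c * lam t] (mod (int p)) \<and>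
      ?o * ?o * \<tau> = (\<Sum>E\<in>diags. fam.weight E * orbit_value lam t E)" if t: "t \<in> T" for t
  proof -
    obtain V where V: "\<And>D. D \<in> orbit_reps \<Longrightarrow>
      [\<xi> D t = V D - int (order S div card D) * lam t] (mod (int p)) \<and> v t D (V D)"
      using \<xi>(2)[OF _ t] by metis
    have "[\<chi> t = (\<Sum>D\<in>orbit_reps. coef D * (V D - int (order S div card D) * lam t))] (mod (int p))"
      unfolding \<chi>_def using V by (intro cong_sum cong_mult) auto
    then have "[\<chi> t = (\<Sum>D\<in>orbit_reps. coef D * V D) - c * lam t] (mod (int p))"
      by (simp add: c_def right_diff_distrib sum_subtractf sum_distrib_right mult.assoc)
    moreover have "?o * ?o * (\<Sum>D\<in>orbit_reps. coef D * V D) =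
        (\<Sum>E\<in>diags. fam.weight E * orbit_value lam t E)"
      unfolding sum_orbit_reps sum_distrib_left
    proof (rule sum.cong[OF refl])
      fix D assume D: "D \<in> orbit_reps"
      then have D': "D \<in> diags" using orbit_reps_subset by blast
      have "int (card D) * (\<Sum>E\<in>A.orb D. fam.weight E * orbit_value lam t E) =
          int (card D) * (?o * ?o * (coef D * V D))"
        using orbit_sum[OF D', of "orbit_value lam t"] V[OF D] by (simp add: v_def mult_ac)
      then show "?o * ?o * (coef D * V D) = (\<Sum>E\<in>A.orb D. fam.weight E * orbit_value lam t E)"
        using card_diags_pos[OF D'] by simp
    qed
    ultimately show ?thesis by blast
  qed
  then have "\<forall>t\<in>T. \<exists>\<tau>. [\<chi> t = \<tau> - c * lam t] (mod (int p)) \<and>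
      ?o * ?o * \<tau> = (\<Sum>E\<in>diags. fam.weight E * orbit_value lam t E)" by blast
  from bchoice[OF this] obtain \<tau> where
    \<tau>: "\<And>t. t \<in> T \<Longrightarrow> [\<chi> t = \<tau> t - c * lam t] (mod (int p))"
    "\<And>t. t \<in> T \<Longrightarrow> ?o * ?o * \<tau> t = (\<Sum>E\<in>diags. fam.weight E * orbit_value lam t E)"
    by blast
  have \<tau>': "[\<tau> t = \<chi> t + c * lam t] (mod (int p))" if "t \<in> T" for t
    using cong_add[OF \<tau>(1)[OF that] cong_refl[of "c * lam t"]] by (simp add: cong_sym)
  have hom\<tau>: "mod_hom S (int p) T \<tau>"
    unfolding mod_hom_def
  proof (intro ballI)
    fix x y assume xy: "x \<in> T" "y \<in> T"
    have "[\<tau> (x \<otimes> y) = \<chi> (x \<otimes> y) + c * lam (x \<otimes> y)] (mod (int p))"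
      by (rule \<tau>'[OF subgroup.m_closed[OF T_subgroup xy]])
    also have "[\<chi> (x \<otimes> y) + c * lam (x \<otimes> y) = (\<chi> x + \<chi> y) + c * (lam x + lam y)] (mod (int p))"
      using \<chi> lam(1) xy T_mem by (intro cong_add cong_mult cong_refl) (auto simp: mod_hom_def)
    also have "(\<chi> x + \<chi> y) + c * (lam x + lam y) = (\<chi> x + c * lam x) + (\<chi> y + c * lam y)"
      by (simp add: algebra_simps)
    also have "[(\<chi> x + c * lam x) + (\<chi> y + c * lam y) = \<tau> x + \<tau> y] (mod (int p))"
      using \<tau>'[OF xy(1)] \<tau>'[OF xy(2)] by (intro cong_add) (auto simp: cong_sym)
    finally show "[\<tau> (x \<otimes> y) = \<tau> x + \<tau> y] (mod (int p))" .
  qed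
  have stable: "\<tau> (\<alpha> t) = \<tau> t" if "subgroup P S" "\<alpha> \<in> hom_S P" "t \<in> P" "t \<in> T" for P \<alpha> t
  proof -
    have "?o * ?o * \<tau> (\<alpha> t) = ?o * ?o * \<tau> t"
      using \<tau>(2) hom_S_T_closed[OF that] that(4) sum_orbit_value_transport[OF lam that(1-3)] by simp
    then show ?thesis using pos by simp
  qed
  show thesis
  \<comment> \<open>Since \<tau> vanishes on \<open>T\<close> modulo \<open>p\<close>, the
    congruence \<chi> = \<tau> - c \<lambda> leaves the factor -c, with c the degree of the
    biset.\<close>
  proof (rule that[OF \<chi>, of "- c"])
    show "\<not> int p dvd - c" using degree_not_dvd by (simp add: c_def)
    fix t assume t: "t \<in> T"
    have \<tau>0: "[\<tau> t = 0] (mod (int p))"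
      by (rule invariant_mod_hom_vanishes[OF hom\<tau> _ t]) (rule stable)
    have "[\<chi> t = \<tau> t - c * lam t] (mod (int p))" by (rule \<tau>(1)[OF t])
    also have "[\<tau> t - c * lam t = 0 - c * lam t] (mod (int p))"
      using \<tau>0 by (intro cong_diff) auto
    finally show "[\<chi> t = - c * lam t] (mod (int p))" by simp
  qed
qed

text \<open>Maximality is used through a single subgroup: the elements of \<open>T\<close> whose
  class modulo \<open>M\<close> is central in S/M and a power of one central class of order
  \<open>p\<close>. It is normal and larger than \<open>M\<close>, hence all of \<open>T\<close>.
  The exponent with respect to that class is the \<lambda> to be extended.\<close>

lemma separating_mod_hom:
  assumes N: "subgroup N S" "\<And>g x. \<lbrakk>g \<in> carrier S; x \<in> N\<rbrakk> \<Longrightarrow> g \<otimes> x \<otimes> inv g \<in> N" "N \<subset> T"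
  obtains \<chi> t where "mod_hom S (int p) (carrier S) \<chi>" "\<And>x. x \<in> N \<Longrightarrow> [\<chi> x = 0] (mod (int p))"
    "t \<in> T" "\<not> [\<chi> t = 0] (mod (int p))"
proof -
  define \<N> where "\<N> = {M. subgroup M S \<and> (\<forall>g\<in>carrier S. \<forall>x\<in>M. g \<otimes> x \<otimes> inv g \<in> M) \<and> N \<subseteq> M \<and> M \<subset> T}"
  have finT: "finite T" by (rule finite_subgroup[OF T_subgroup])
  have "finite \<N>" by (rule finite_subset[of _ "Pow T"]) (use finT in \<open>auto simp: \<N>_def\<close>)
  moreover have "N \<in> \<N>" using N by (simp add: \<N>_def)
  ultimately obtain M where M: "M \<in> \<N>" "\<And>M'. M' \<in> \<N> \<Longrightarrow> card M' \<le> card M"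
    using Max_in[of "card ` \<N>"] Max_ge[of "card ` \<N>"] by (metis (no_types, lifting) empty_iff finite_imageI imageE image_eqI)
  have sM: "subgroup M S" and M_conj: "\<And>g x. \<lbrakk>g \<in> carrier S; x \<in> M\<rbrakk> \<Longrightarrow> g \<otimes> x \<otimes> inv g \<in> M"
    and NM: "N \<subseteq> M" and MT: "M \<subset> T" using M(1) by (auto simp: \<N>_def)
  have "M \<lhd> S" using sM M_conj by (simp add: normal_inv_iff)
  then interpret M: normal M S .
  interpret R: group "S Mod M" by (rule M.factorgroup_is_group)
  interpret \<pi>: group_hom S "S Mod M" "\<lambda>x. M #> x"
    using M.r_coset_hom_Mod by (simp add: group_hom_def group_hom_axioms_def is_group R.is_group)
  let ?\<pi> = "\<lambda>x. M #> x" and ?R = "S Mod M"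
  have \<pi>M: "?\<pi> x = \<one>\<^bsub>?R\<^esub> \<longleftrightarrow> x \<in> M" if "x \<in> carrier S" for x
    using coset_join1[OF _ that sM] coset_join2[OF that sM] by auto
  obtain x where x: "x \<in> T" "x \<notin> M" "\<And>g. g \<in> carrier S \<Longrightarrow> g \<otimes> x \<otimes> inv g \<otimes> inv x \<in> M"
    using p_group_central_step[OF p fin ord sM M_conj T_subgroup T_conj MT] by metis
  have xS: "x \<in> carrier S" by (rule T_mem[OF x(1)])
  define q where "q = least_pow S M x"
  note q = least_pow_props[OF fin sM xS, folded q_def]
  obtain i where i: "q = p ^ i" using q(4) ord divides_primepow_nat[OF p] by auto
  have "i \<noteq> 0" using q(2) i x(2) xS by (intro notI) simp
  then obtain i' where i': "i = Suc i'" by (cases i) auto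
  \<comment> \<open>The class of x has order p^(i'+1) modulo \<open>M\<close>, so this power has
    order exactly \<open>p\<close>.\<close>
  define x0 where "x0 = x [^] (p ^ i')"
  have x0S: "x0 \<in> carrier S" using xS by (simp add: x0_def)
  have x0T: "x0 \<in> T" unfolding x0_def by (rule subgroup_pow_closed[OF T_subgroup x(1)])
  have x0_pow: "x0 [^] j \<in> M \<longleftrightarrow> p dvd j" for j :: nat
  proof -
    have "x0 [^] j \<in> M \<longleftrightarrow> p ^ i' * p dvd p ^ i' * j"
      using q(3)[of "p ^ i' * j"] xS by (simp add: x0_def nat_pow_pow i i' mult.commute)
    then show ?thesis using p by (simp add: prime_gt_0_nat)
  qed
  have x0M: "x0 \<notin> M" using x0_pow[of 1] x0S p by (auto dest: not_prime_unit)
  have \<pi>x: "?\<pi> (g \<otimes> x \<otimes> inv g) = ?\<pi> x" if "g \<in> carrier S" for g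
    by (subst rcos_eq_iff[OF sM]) (use x(3)[OF that] that xS in auto)
  have pow_conj: "(g \<otimes> y \<otimes> inv g) [^] (j::nat) = g \<otimes> y [^] j \<otimes> inv g"
    if "g \<in> carrier S" "y \<in> carrier S" for g y j
    by (induction j) (use that in \<open>simp_all add: m_assoc\<close>)
  have \<pi>x0: "?\<pi> (g \<otimes> x0 \<otimes> inv g) = ?\<pi> x0" if g: "g \<in> carrier S" for g
  proof -
    have "?\<pi> (g \<otimes> x0 \<otimes> inv g) = ?\<pi> ((g \<otimes> x \<otimes> inv g) [^] (p ^ i'))"
      unfolding x0_def using pow_conj[OF g xS] by simp
    also have "\<dots> = ?\<pi> (g \<otimes> x \<otimes> inv g) [^]\<^bsub>?R\<^esub> (p ^ i')"
      by (rule M.FactGroup_pow[symmetric]) (use g xS in simp)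
    also have "\<dots> = ?\<pi> x0" unfolding \<pi>x[OF g] x0_def using xS by (simp add: M.FactGroup_pow)
    finally show ?thesis .
  qed
  let ?a = "?\<pi> x0"
  have aR: "?a \<in> carrier ?R" using x0S by simp
  have ord_a: "R.ord ?a = p"
    unfolding R.ord_unique[OF aR]
  proof
    fix j :: nat
    show "?a [^]\<^bsub>?R\<^esub> j = \<one>\<^bsub>?R\<^esub> \<longleftrightarrow> p dvd j"
      unfolding M.FactGroup_pow[OF x0S] by (simp only: \<pi>M[OF nat_pow_closed[OF x0S]] x0_pow)
  qed
  \<comment> \<open>Centrality is part of the condition, so that equality with \<open>T\<close>
    yields both the cyclic quotient and the invariance of \<lambda>.\<close>
  let ?M' = "{t \<in> T. (\<exists>j::int. ?\<pi> t = ?a [^]\<^bsub>?R\<^esub> j) \<and> (\<forall>g\<in>carrier S. ?\<pi> (g \<otimes> t \<otimes> inv g) = ?\<pi> t)}"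
  have M'T: "?M' = T"
  proof (rule ccontr)
    assume ne: "?M' \<noteq> T"
    have sM': "subgroup ?M' S"
    proof (rule subgroupI)
      show "?M' \<subseteq> carrier S" using T_mem by auto
      have "?a = ?a [^]\<^bsub>?R\<^esub> (1::int)" using aR by (simp only: R.int_pow_1)
      then have "x0 \<in> ?M'" using x0T \<pi>x0 by blast
      then show "?M' \<noteq> {}" by blast
      fix s t assume s: "s \<in> ?M'"
      then obtain j :: int where j: "s \<in> carrier S" "?\<pi> s = ?a [^]\<^bsub>?R\<^esub> j" using T_mem by blast
      have "?\<pi> (inv s) = ?a [^]\<^bsub>?R\<^esub> (- j)"
        using \<pi>.hom_inv[OF j(1)] j(2) R.int_pow_neg[OF aR] by simp
      moreover have "?\<pi> (g \<otimes> inv s \<otimes> inv g) = ?\<pi> (inv s)" if g: "g \<in> carrier S" for g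
      proof -
        have "?\<pi> (g \<otimes> inv s \<otimes> inv g) = inv\<^bsub>?R\<^esub> ?\<pi> (g \<otimes> s \<otimes> inv g)"
          using \<pi>.hom_inv[of "g \<otimes> s \<otimes> inv g"] g j(1) by (simp add: inv_mult_group m_assoc)
        also have "\<dots> = inv\<^bsub>?R\<^esub> ?\<pi> s" using s g by auto
        finally show ?thesis using \<pi>.hom_inv[OF j(1)] by simp
      qed
      ultimately show "inv s \<in> ?M'" using s subgroup.m_inv_closed[OF T_subgroup] by blast
      assume t: "t \<in> ?M'"
      then obtain k :: int where k: "t \<in> carrier S" "?\<pi> t = ?a [^]\<^bsub>?R\<^esub> k" using T_mem by blast
      have "?\<pi> (s \<otimes> t) = ?a [^]\<^bsub>?R\<^esub> (j + k)"
        using \<pi>.hom_mult[OF j(1) k(1)] j(2) k(2) R.int_pow_mult[OF aR, of j k] by metis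
      moreover have "?\<pi> (g \<otimes> (s \<otimes> t) \<otimes> inv g) = ?\<pi> (s \<otimes> t)" if g: "g \<in> carrier S" for g
      proof -
        have "g \<otimes> (s \<otimes> t) \<otimes> inv g = (g \<otimes> s \<otimes> inv g) \<otimes> (g \<otimes> t \<otimes> inv g)"
          using g j(1) k(1) by (simp add: m_assoc)
        then have "?\<pi> (g \<otimes> (s \<otimes> t) \<otimes> inv g) = ?\<pi> (g \<otimes> s \<otimes> inv g) \<otimes>\<^bsub>?R\<^esub> ?\<pi> (g \<otimes> t \<otimes> inv g)"
          using \<pi>.hom_mult[of "g \<otimes> s \<otimes> inv g" "g \<otimes> t \<otimes> inv g"] g j(1) k(1) by simp
        also have "\<dots> = ?\<pi> s \<otimes>\<^bsub>?R\<^esub> ?\<pi> t" using s t g by auto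
        finally show ?thesis using \<pi>.hom_mult[OF j(1) k(1)] by simp
      qed
      ultimately show "s \<otimes> t \<in> ?M'" using s t subgroup.m_closed[OF T_subgroup] by blast
    qed
    have cM': "g \<otimes> t \<otimes> inv g \<in> ?M'" if g: "g \<in> carrier S" and t: "t \<in> ?M'" for g t
    proof -
      have tS: "t \<in> carrier S" using t T_mem by blast
      have "?\<pi> (h \<otimes> (g \<otimes> t \<otimes> inv g) \<otimes> inv h) = ?\<pi> (g \<otimes> t \<otimes> inv g)" if h: "h \<in> carrier S" for h
      proof -
        have "h \<otimes> (g \<otimes> t \<otimes> inv g) \<otimes> inv h = (h \<otimes> g) \<otimes> t \<otimes> inv (h \<otimes> g)"
          using g h tS by (simp add: inv_mult_group m_assoc)
        moreover have "?\<pi> ((h \<otimes> g) \<otimes> t \<otimes> inv (h \<otimes> g)) = ?\<pi> t" using t g h m_closed by blast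
        ultimately show ?thesis using t g by auto
      qed
      moreover have "?\<pi> (g \<otimes> t \<otimes> inv g) = ?\<pi> t" using t g by blast
      ultimately show ?thesis using t T_conj[OF g] by auto
    qed
    have MM': "M \<subset> ?M'"
    proof -
      have "y \<in> ?M'" if y: "y \<in> M" for y
      proof -
        have yS: "y \<in> carrier S" using subgroup.mem_carrier[OF sM y] .
        have \<pi>1: "?\<pi> z = \<one>\<^bsub>?R\<^esub>" if "z \<in> M" for z using \<pi>M[OF subgroup.mem_carrier[OF sM that]] that by blast
        have "?\<pi> y = ?a [^]\<^bsub>?R\<^esub> (0::int)" using \<pi>1[OF y] by (simp only: int_pow_0)
        moreover have "?\<pi> (g \<otimes> y \<otimes> inv g) = ?\<pi> y" if "g \<in> carrier S" for g
          using \<pi>1[OF y] \<pi>1[OF M_conj[OF that y]] by simp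
        ultimately show ?thesis using y MT by blast
      qed
      moreover have "?a = ?a [^]\<^bsub>?R\<^esub> (1::int)" using aR by (simp only: R.int_pow_1)
      then have "x0 \<in> ?M'" using x0T \<pi>x0 by blast
      ultimately show ?thesis using x0M by blast
    qed
    have "?M' \<in> \<N>"
      unfolding \<N>_def mem_Collect_eq[of ?M']
    proof (intro conjI ballI)
      show "N \<subseteq> ?M'" using NM MM' by (meson order_trans psubset_imp_subset)
      show "?M' \<subset> T" by (rule psubsetI[OF _ ne]) (rule Collect_subset)
    qed (fact sM', fact cM')
    then have "card ?M' \<le> card M" by (rule M(2))
    moreover have "card M < card ?M'" by (rule psubset_card_mono[OF _ MM']) (use finT in auto)
    ultimately show False by simp
  qed
  define lam where "lam t = (SOME j::int. ?\<pi> t = ?a [^]\<^bsub>?R\<^esub> j)" for t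
  have lam: "?\<pi> t = ?a [^]\<^bsub>?R\<^esub> lam t" if "t \<in> T" for t
    unfolding lam_def by (rule someI_ex) (use that M'T in blast)
  have lam_cong: "[i = j] (mod (int p))" if "?a [^]\<^bsub>?R\<^esub> i = ?a [^]\<^bsub>?R\<^esub> j" for i j :: int
    using that R.int_pow_eq[OF aR, of i j] ord_a by (simp add: cong_iff_dvd_diff dvd_diff_commute)
  have lam_hom: "mod_hom S (int p) T lam"
    unfolding mod_hom_def
  proof (intro ballI)
    fix s t assume st: "s \<in> T" "t \<in> T"
    have "?\<pi> (s \<otimes> t) = ?a [^]\<^bsub>?R\<^esub> (lam s + lam t)"
      using \<pi>.hom_mult[OF T_mem[OF st(1)] T_mem[OF st(2)]] lam[OF st(1)] lam[OF st(2)]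
        R.int_pow_mult[OF aR, of "lam s" "lam t"] by metis
    then show "[lam (s \<otimes> t) = lam s + lam t] (mod (int p))"
      using lam[OF subgroup.m_closed[OF T_subgroup st]] by (intro lam_cong) simp
  qed
  have lam_conj: "lam (g \<otimes> t \<otimes> inv g) = lam t" if "g \<in> carrier S" "t \<in> T" for g t
  proof -
    have "?\<pi> (g \<otimes> t \<otimes> inv g) = ?\<pi> t" using that M'T by blast
    \<comment> \<open>The choice in \<open>lam\<close> depends only on the coset, so equal cosets
      give equal integers and not merely congruent ones.\<close>
    then show ?thesis unfolding lam_def by simp
  qed
  obtain \<chi> c where \<chi>: "mod_hom S (int p) (carrier S) \<chi>" "\<not> int p dvd c"
    "\<And>t. t \<in> T \<Longrightarrow> [\<chi> t = c * lam t] (mod (int p))"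
    using lam_extends[OF lam_hom lam_conj] by metis
  show thesis
  proof (rule that[OF \<chi>(1) _ x0T])
    fix y assume y: "y \<in> N"
    then have yM: "y \<in> M" and yT: "y \<in> T" using NM MT by auto
    have "?\<pi> y = ?a [^]\<^bsub>?R\<^esub> (0::int)"
      using \<pi>M[OF subgroup.mem_carrier[OF sM yM]] yM by (simp only: int_pow_0)
    then have "[lam y = 0] (mod (int p))" using lam[OF yT] by (intro lam_cong) simp
    then have "[c * lam y = c * 0] (mod (int p))" by (intro cong_mult) auto
    then show "[\<chi> y = 0] (mod (int p))" using cong_trans[OF \<chi>(3)[OF yT]] by simp
  next
    have "?a [^]\<^bsub>?R\<^esub> lam x0 = ?a [^]\<^bsub>?R\<^esub> (1::int)" using lam[OF x0T] aR by (simp only: R.int_pow_1)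
    then have "[lam x0 = 1] (mod (int p))" by (rule lam_cong)
    then have "[c * lam x0 = c * 1] (mod (int p))" by (intro cong_mult) auto
    then have "[\<chi> x0 = c] (mod (int p))" using cong_trans[OF \<chi>(3)[OF x0T]] by simp
    then show "\<not> [\<chi> x0 = 0] (mod (int p))"
      using \<chi>(2) by (metis cong_0_iff cong_sym cong_trans)
  qed
qed

section \<open>Focal and Frattini subgroups, and characters vanishing on them\<close>

lemma hyperfocal_subset_focal: "T \<subseteq> focal S F"
proof -
  have "aut_commutator S P (p_residual p (aut_group F P)) \<subseteq> aut_commutator S P (F P P)"
    if "subgroup P S" for P
    unfolding aut_commutator_def by (rule mono_generate) (use p_residual_subset[OF p that] in auto)
  then show ?thesis unfolding hyperfocal_def focal_def by (intro mono_generate) auto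
qed

lemma aut_commutator_closed: "\<lbrakk>subgroup P S; B \<subseteq> F P P\<rbrakk> \<Longrightarrow> aut_commutator S P B \<subseteq> carrier S"
proof -
  assume P: "subgroup P S" and B: "B \<subseteq> F P P"
  have "inv u \<otimes> \<alpha> u \<in> P" if "u \<in> P" "\<alpha> \<in> B" for u \<alpha>
    using aut_Bij(2)[OF P, of \<alpha>] that B P by (auto intro!: subgroup.m_closed subgroup.m_inv_closed)
  then show ?thesis
    unfolding aut_commutator_def using subgroup.mem_carrier[OF P]
    by (intro generate_incl) auto
qed

lemma focal_subgroup: "subgroup (focal S F) S"
  unfolding focal_def using aut_commutator_closed by (intro generate_is_subgroup) blast

lemma focal_incl:
  assumes P: "subgroup P S" and \<alpha>: "\<alpha> \<in> F P P" and u: "u \<in> P"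
  shows "inv u \<otimes> \<alpha> u \<in> focal S F"
proof -
  have "inv u \<otimes> \<alpha> u \<in> aut_commutator S P (F P P)"
    unfolding aut_commutator_def by (rule generate.incl) (use \<alpha> u in auto)
  then show ?thesis unfolding focal_def using P by (auto intro: generate.incl)
qed

lemma focal_subset:
  assumes K: "subgroup K S"
    and gen: "\<And>P \<alpha> u. \<lbrakk>subgroup P S; \<alpha> \<in> F P P; u \<in> P\<rbrakk> \<Longrightarrow> inv u \<otimes> \<alpha> u \<in> K"
  shows "focal S F \<subseteq> K"
proof -
  have "aut_commutator S P (F P P) \<subseteq> K" if "subgroup P S" for P
    unfolding aut_commutator_def by (rule generate_subgroup_incl[OF _ K]) (use gen[OF that] in auto)
  then show ?thesis unfolding focal_def by (intro generate_subgroup_incl[OF _ K]) auto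
qed

lemma frattini_one: "\<one> \<in> frattini S"
  unfolding frattini_def maximal_subgroup_def using subgroup.one_closed by auto

text \<open>The kernel is a maximal subgroup: an element y outside it has \<chi>(y) invertible
  modulo \<open>p\<close>, so every x is moved into the kernel by a suitable power of y.\<close>

lemma mod_hom_kernel_frattini:
  assumes \<chi>: "mod_hom S (int p) (carrier S) \<chi>" and t: "t \<in> carrier S" "\<not> [\<chi> t = 0] (mod (int p))"
  shows "frattini S \<subseteq> {x \<in> carrier S. [\<chi> x = 0] (mod (int p))}"
proof -
  let ?K = "{x \<in> carrier S. [\<chi> x = 0] (mod (int p))}"
  have K: "subgroup ?K S" by (rule mod_hom_kernel_subgroup[OF \<chi> subgroup_self])
  have "maximal_subgroup ?K S"
    unfolding maximal_subgroup_def
  proof (intro conjI allI impI)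
    show "subgroup ?K S" by (rule K)
    show "?K \<noteq> carrier S" using t by blast
    fix L assume L: "subgroup L S \<and> ?K \<subseteq> L"
    show "L = ?K \<or> L = carrier S"
    proof (cases "L = ?K")
      case False
      then obtain y where y: "y \<in> L" "y \<notin> ?K" using L by blast
      have yS: "y \<in> carrier S" using y(1) L subgroup.mem_carrier by metis
      have "\<not> int p dvd \<chi> y" using y(2) yS by (simp add: cong_0_iff)
      then have "coprime (\<chi> y) (int p)"
        using p by (metis coprime_commute prime_imp_coprime prime_nat_int_transfer)
      then obtain z where z: "[\<chi> y * z = 1] (mod (int p))" using cong_solve_coprime_int by blast
      have "x \<in> L" if x: "x \<in> carrier S" for x
      proof -
        \<comment> \<open>A natural number representing -\<chi>(x) / \<chi>(y) modulo
          \<open>p\<close>, where z is inverse to \<chi>(y).\<close>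
        define k where "k = nat ((- \<chi> x * z) mod int p)"
        have "int k = (- \<chi> x * z) mod int p" using p by (simp add: k_def prime_gt_0_nat)
        then have k: "[int k = - \<chi> x * z] (mod (int p))" by (simp add: cong_def)
        have "[\<chi> (x \<otimes> y [^] k) = \<chi> x + \<chi> (y [^] k)] (mod (int p))"
          using \<chi> x yS by (simp add: mod_hom_def)
        also have "[\<chi> x + \<chi> (y [^] k) = \<chi> x + int k * \<chi> y] (mod (int p))"
          using mod_hom_pow[OF \<chi> subgroup_self yS] by (intro cong_add) auto
        also have "[\<chi> x + int k * \<chi> y = \<chi> x + (- \<chi> x * z) * \<chi> y] (mod (int p))"
          using k by (intro cong_add cong_mult) auto
        also have "\<chi> x + (- \<chi> x * z) * \<chi> y = \<chi> x - \<chi> x * (\<chi> y * z)" by (simp add: algebra_simps)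
        also have "[\<chi> x - \<chi> x * (\<chi> y * z) = \<chi> x - \<chi> x * 1] (mod (int p))"
          using z by (intro cong_diff cong_mult) auto
        finally have "x \<otimes> y [^] k \<in> L" using x yS L by auto
        moreover have "y [^] k \<in> L" using subgroup_pow_closed y(1) L by blast
        moreover have "x = (x \<otimes> y [^] k) \<otimes> inv (y [^] k)" using x yS by (simp add: m_assoc)
        ultimately show ?thesis using L subgroup.m_closed subgroup.m_inv_closed by metis
      qed
      then show ?thesis using L subgroup.subset by blast
    qed simp
  qed
  then show ?thesis unfolding frattini_def by blast
qed

text \<open>Modulo \<open>T\<close> the element \<alpha>(u) is conjugate to u; since \<chi> vanishes
  on \<open>T\<close> and has abelian values, it does not distinguish the two.\<close>

lemma aut_mod_hom:
  assumes \<chi>: "mod_hom S (int p) (carrier S) \<chi>" and T0: "\<And>x. x \<in> T \<Longrightarrow> [\<chi> x = 0] (mod (int p))"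
    and P: "subgroup P S" and \<alpha>: "\<alpha> \<in> F P P" and u: "u \<in> P"
  shows "[\<chi> (inv u \<otimes> \<alpha> u) = 0] (mod (int p))"
proof -
  obtain g where g: "g \<in> carrier S" "\<And>x. x \<in> P \<Longrightarrow> inv g \<otimes> \<alpha> x \<otimes> g \<otimes> inv x \<in> T"
    using hom_S_conj_mod_T[OF P F_to_S[OF P P \<alpha>]] by metis
  have c: "u \<in> carrier S" "\<alpha> u \<in> carrier S"
    using u aut_Bij(2)[OF P \<alpha>] subgroup.mem_carrier[OF P] by auto
  have h: "[\<chi> (x \<otimes> y) = \<chi> x + \<chi> y] (mod (int p))" if "x \<in> carrier S" "y \<in> carrier S" for x y
    using \<chi> that by (simp add: mod_hom_def)
  have i: "[\<chi> (inv x) = - \<chi> x] (mod (int p))" if "x \<in> carrier S" for x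
    using mod_hom_inv[OF \<chi> subgroup_self that] .
  have "[\<chi> (inv g \<otimes> \<alpha> u \<otimes> g \<otimes> inv u) = ((\<chi> (inv g) + \<chi> (\<alpha> u)) + \<chi> g) + \<chi> (inv u)] (mod (int p))"
    using c g(1) by (intro cong_trans[OF h] cong_add[OF _ cong_refl] h) auto
  also have "[((\<chi> (inv g) + \<chi> (\<alpha> u)) + \<chi> g) + \<chi> (inv u) = ((- \<chi> g + \<chi> (\<alpha> u)) + \<chi> g) + \<chi> (inv u)] (mod (int p))"
    using i[OF g(1)] by (intro cong_add) auto
  also have "((- \<chi> g + \<chi> (\<alpha> u)) + \<chi> g) + \<chi> (inv u) = \<chi> (inv u) + \<chi> (\<alpha> u)" by simp
  also have "[\<chi> (inv u) + \<chi> (\<alpha> u) = \<chi> (inv u \<otimes> \<alpha> u)] (mod (int p))"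
    using h[of "inv u" "\<alpha> u"] c by (simp add: cong_sym)
  finally show ?thesis using T0[OF g(2)[OF u]] by (metis cong_sym cong_trans)
qed

end

section \<open>Comparison of two fusion systems\<close>

locale fusion_pair = F: saturated_fusion S F p n + H: saturated_fusion S H p n
  for S (structure) and F H p n +
  assumes sub: "\<And>P Q. \<lbrakk>subgroup P S; subgroup Q S\<rbrakk> \<Longrightarrow> H P Q \<subseteq> F P Q"
begin

text \<open>Immediate from the description by automorphisms of order prime to \<open>p\<close>:
  every such automorphism in \<open>H\<close> is one in \<open>F\<close>.\<close>

lemma hyperfocal_mono: "H.T \<subseteq> F.T"
  unfolding F.hyperfocal_eq_p'[OF F.p] H.hyperfocal_eq_p'[OF F.p]
  by (rule F.mono_generate) (use sub in \<open>unfold F.p'_commutators_def H.p'_commutators_def, blast\<close>)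

lemma focal_mono: "focal S H \<subseteq> focal S F"
  by (rule H.focal_subset[OF F.focal_subgroup]) (use sub F.focal_incl in blast)

lemma elementary_imp_hyperfocal:
  assumes eq: "elementary_focal S F = elementary_focal S H"
  shows "F.T = H.T"
proof (rule ccontr)
  assume "F.T \<noteq> H.T"
  then have "H.T \<subset> F.T" using hyperfocal_mono by blast
  then obtain \<chi> t where \<chi>: "mod_hom S (int p) (carrier S) \<chi>"
    and T0: "\<And>x. x \<in> H.T \<Longrightarrow> [\<chi> x = 0] (mod (int p))"
    and t: "t \<in> F.T" "\<not> [\<chi> t = 0] (mod (int p))"
    using F.separating_mod_hom[OF H.T_subgroup H.T_conj] by metis
  let ?K = "{x \<in> carrier S. [\<chi> x = 0] (mod (int p))}"
  have K: "subgroup ?K S" by (rule F.mod_hom_kernel_subgroup[OF \<chi> F.subgroup_self])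
  have "focal S H \<subseteq> ?K"
  proof (rule H.focal_subset[OF K])
    fix P \<alpha> u assume P: "subgroup P S" and \<alpha>: "\<alpha> \<in> H P P" and u: "u \<in> P"
    have "u \<in> carrier S" "\<alpha> u \<in> carrier S"
      using u H.aut_Bij(2)[OF P \<alpha>] subgroup.mem_carrier[OF P] by auto
    then show "inv u \<otimes> \<alpha> u \<in> ?K" using H.aut_mod_hom[OF \<chi> T0 P \<alpha> u] by simp
  qed
  moreover have "frattini S \<subseteq> ?K" by (rule F.mod_hom_kernel_frattini[OF \<chi> F.T_mem[OF t(1)] t(2)])
  ultimately have "elementary_focal S H \<subseteq> ?K"
    unfolding elementary_focal_def set_mult_def using subgroup.m_closed[OF K] by blast
  moreover have "t \<in> elementary_focal S F"
  proof -
    have "t \<in> focal S F" using t(1) F.hyperfocal_subset_focal by blast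
    moreover have "t = \<one> \<otimes> t" using F.T_mem[OF t(1)] by simp
    ultimately show ?thesis unfolding elementary_focal_def set_mult_def using F.frattini_one by blast
  qed
  ultimately show False using eq t(2) by blast
qed

text \<open>Modulo \<open>T\<close> the automorphism is conjugation by g, so u^-1 \<alpha>(u) is a
  conjugate of an element of \<open>T\<close> times the commutator u^-1 g u g^-1. The commutator
  lies in the focal subgroup of \<open>H\<close> because \<open>H\<close> contains the inner
  automorphisms of \<open>S\<close>.\<close>

lemma hyperfocal_imp_focal:
  assumes eq: "F.T = H.T" shows "focal S F = focal S H"
proof
  show "focal S H \<subseteq> focal S F" by (rule focal_mono)
  show "focal S F \<subseteq> focal S H"
  proof (rule F.focal_subset[OF H.focal_subgroup])
    fix P \<alpha> u assume P: "subgroup P S" and \<alpha>: "\<alpha> \<in> F P P" and u: "u \<in> P"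
    obtain g where g: "g \<in> carrier S" "inv g \<otimes> \<alpha> u \<otimes> g \<otimes> inv u \<in> F.T"
      using F.hom_S_conj_mod_T[OF P F.F_to_S[OF P P \<alpha>]] u by metis
    have c: "u \<in> carrier S" "\<alpha> u \<in> carrier S"
      using u F.aut_Bij(2)[OF P \<alpha>] subgroup.mem_carrier[OF P] by auto
    let ?s = "inv g \<otimes> \<alpha> u \<otimes> g \<otimes> inv u" and ?c = "conj_map S g (carrier S)"
    have "inv u \<otimes> g \<otimes> ?s \<otimes> inv (inv u \<otimes> g) \<in> focal S H"
      using F.T_conj[OF _ g(2), of "inv u \<otimes> g"] H.hyperfocal_subset_focal c(1) g(1) eq by auto
    moreover have "inv u \<otimes> ?c u \<in> focal S H"
      by (rule H.focal_incl[OF F.subgroup_self H.conj_map_hom[OF F.subgroup_self g(1)] c(1)])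
    ultimately have "(inv u \<otimes> g \<otimes> ?s \<otimes> inv (inv u \<otimes> g)) \<otimes> (inv u \<otimes> ?c u) \<in> focal S H"
      by (rule subgroup.m_closed[OF H.focal_subgroup])
    also have "(inv u \<otimes> g \<otimes> ?s \<otimes> inv (inv u \<otimes> g)) \<otimes> (inv u \<otimes> ?c u) = inv u \<otimes> \<alpha> u"
      using c g(1) by (simp add: conj_map_def F.inv_mult_group F.m_assoc)
    finally show "inv u \<otimes> \<alpha> u \<in> focal S H" .
  qed
qed

end

theorem theoremT:
  fixes p :: nat and S :: "('a, 'b) monoid_scheme" and F H :: "'a hom_family"
  assumes "Factorial_Ring.prime p"
    and "finite_p_group p S"
    and "fusion_system S F" and "saturated p S F"
    and "fusion_subsystem S F (carrier S) H" and "saturated p S H"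
  shows "(elementary_focal S F = elementary_focal S H \<longleftrightarrow> focal S F = focal S H) \<and>
         (focal S F = focal S H \<longleftrightarrow> hyperfocal p S F = hyperfocal p S H)"
proof -
  obtain n where S: "group S" "finite (carrier S)" "order S = p ^ n"
    using assms(2) by (auto simp: finite_p_group_def)
  have H: "fusion_system S H" "\<And>P Q. \<lbrakk>subgroup P S; subgroup Q S\<rbrakk> \<Longrightarrow> H P Q \<subseteq> F P Q"
    using assms(5) by (auto simp: fusion_subsystem_def)
  interpret fusion_pair S F H p n
    by (intro fusion_pair.intro saturated_fusion.intro saturated_fusion_axioms.intro fusion_cat.intro
        fusion_cat_axioms.intro fusion_pair_axioms.intro S H assms)
  \<comment> \<open>The elementary focal subgroup is a function of the focal one; this closes the
    cycle of implications (1), (3), (2), (1).\<close>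
  have "focal S F = focal S H \<Longrightarrow> elementary_focal S F = elementary_focal S H"
    by (simp add: elementary_focal_def)
  then show ?thesis using elementary_imp_hyperfocal hyperfocal_imp_focal by blast
qed

end
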